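(* Let $a=b=p$ and $c<r<\frac p2$ (with $c\ge 0$). Then the optimal diversity-multiplexing tradeoff of the half-duplex $(a,b,c)$-relay channel with receive CSI is attained by dynamic decode-and-forward; that is, at multiplexing gain $r$ the supremum of the diversity gains achievable by all schemes using only receive CSI equals the diversity gain of dynamic decode-and-forward.
   Context: Channel. For $a,b,c\ge 0$ and $\rho>1$, the half-duplex $(a,b,c)$-relay channel has a source S, relay R, destination D, each with one antenna. The gains of the S-R, R-D, S-D links are $h_{sr}\rho^{a/2},h_{rd}\rho^{b/2},h_{sd}\rho^{c/2}$ with $h_{sr},h_{rd},h_{sd}$ i.i.d. $\mathcal{CN}(0,1)$, constant over a codeword (quasi-static fading) and independent across codewords. At times when the relay listens, $y_r=h_{sr}\rho^{a/2}x_s+z_r$ and $y_d=h_{sd}\rho^{c/2}x_s+z_d$; at times when the relay transmits, $y_r=0$ and $y_d=h_{sd}\rho^{c/2}x_s+h_{rd}\rho^{b/2}x_r+z_d$. Noises are i.i.d. $\mathcal{CN}(0,1)$ over time and independent across nodes; $x_s,x_r$ satisfy a unit average power constraint; the relay is causal. Codeword lengths may be taken arbitrarily large. Receive CSI: the source knows no channel realization; the relay knows only $h_{sr}$ (its listen/transmit schedule may be random and may depend on $h_{sr}$ and its received signals); the destination knows all realizations. All nodes know $a,b,c,\rho,r$. DMT. A family of codes indexed by $\rho$, with rates $R(\rho)$ and error probabilities $P_e(\rho)$ averaged over fading and noise, achieves multiplexing gain $r$ and diversity gain $d$ if $\lim_{\rho\to\infty}R(\rho)/\log\rho=r$ and $\lim_{\rho\to\infty}\log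 P_e(\rho)/\log\rho=-d$. The optimal DMT at $r$ is the supremum of diversity gains achievable at multiplexing gain $r$. Dynamic decode-and-forward (DDF): the source uses a random Gaussian codebook; the relay listens until it can decode the message, i.e. for a fraction $t=R(\rho)/\log(1+|h_{sr}|^2\rho^a)$ of the block, and then (if $t\le1$) transmits a re-encoding of the message with an independent Gaussian codebook for the remaining time. It is in outage if either $t>1$ and $\log(1+|h_{sd}|^2\rho^c)<R(\rho)$, or $t\le 1$ and $t\log(1+|h_{sd}|^2\rho^c)+(1-t)\log(1+|h_{sd}|^2\rho^c+|h_{rd}|^2\rho^b)<R(\rho)$. Its diversity gain is the exponent of the outage probability. *)

theory Defs
  imports "HOL-Probability.Probability"
begin

definition complex_gaussian :: "complex measure" where
  "complex_gaussian = density lborel (\<lambda>z. ennreal (exp (- (cmod z)\<^sup>2) / pi))"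

text \<open>Channel realizations are triples \<open>(h_sr, h_rd, h_sd)\<close>.\<close>

definition fading :: "(complex \<times> complex \<times> complex) measure" where
  "fading = complex_gaussian \<Otimes>\<^sub>M (complex_gaussian \<Otimes>\<^sub>M complex_gaussian)"

definition noise :: "nat \<Rightarrow> (nat \<Rightarrow> complex) measure" where
  "noise n = (\<Pi>\<^sub>M i\<in>{..<n}. complex_gaussian)"

definition relay_randomness :: "real measure" where
  "relay_randomness = uniform_measure lborel {0..1}"

text \<open>
  A code for one fading block. Messages are \<open>0, \<dots>, num_messages - 1\<close> and time indices are
  \<open>0, \<dots>, blocklength - 1\<close>. The source sees only the message. At time \<open>i\<close> the relay decides
  whether to listen, and what to send if it does not, from its private randomness, from \<open>h_sr\<close>
  and from what it received at the times \<open>0, \<dots>, i - 1\<close>; this past is a function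
  with extensional domain \<open>{..<i}\<close>. The destination sees its received block and the whole
  channel realization, but not the relay's schedule.
\<close>

record relay_code =
  blocklength :: nat
  num_messages :: nat
  source_symbol :: "nat \<Rightarrow> nat \<Rightarrow> complex"
  relay_listens :: "nat \<Rightarrow> real \<Rightarrow> complex \<Rightarrow> (nat \<Rightarrow> complex) \<Rightarrow> bool"
  relay_symbol :: "nat \<Rightarrow> real \<Rightarrow> complex \<Rightarrow> (nat \<Rightarrow> complex) \<Rightarrow> complex"
  decoder :: "complex \<times> complex \<times> complex \<Rightarrow> (nat \<Rightarrow> complex) \<Rightarrow> nat"

definition rate :: "relay_code \<Rightarrow> real" where
  "rate C = ln (real (num_messages C)) / real (blocklength C)"

text \<open>
  \<open>relay_past a \<rho> C m h u z i\<close> is what the relay has received before time \<open>i\<close> when the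
  message is \<open>m\<close>, the S-R coefficient is \<open>h\<close>, the relay's randomness is \<open>u\<close> and the noise at the
  relay is \<open>z\<close>.
\<close>

primrec relay_past ::
  "real \<Rightarrow> real \<Rightarrow> relay_code \<Rightarrow> nat \<Rightarrow> complex \<Rightarrow> real \<Rightarrow> (nat \<Rightarrow> complex) \<Rightarrow> nat \<Rightarrow> (nat \<Rightarrow> complex)"
where
  "relay_past a \<rho> C m h u z 0 = (\<lambda>_. undefined)"
| "relay_past a \<rho> C m h u z (Suc i) =
     (let y = relay_past a \<rho> C m h u z i
      in y(i := (if relay_listens C i u h y
                 then h * of_real (\<rho> powr (a / 2)) * source_symbol C m i + z i
                 else 0)))"

definition relay_input ::
  "real \<Rightarrow> real \<Rightarrow> relay_code \<Rightarrow> nat \<Rightarrow> complex \<Rightarrow> real \<Rightarrow> (nat \<Rightarrow> complex) \<Rightarrow> nat \<Rightarrow> complex"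
where
  "relay_input a \<rho> C m h u z i =
     (let y = relay_past a \<rho> C m h u z i
      in if relay_listens C i u h y then 0 else relay_symbol C i u h y)"

definition dest_output ::
  "real \<Rightarrow> real \<Rightarrow> real \<Rightarrow> real \<Rightarrow> relay_code \<Rightarrow> nat \<Rightarrow> complex \<times> complex \<times> complex \<Rightarrow> real
   \<Rightarrow> (nat \<Rightarrow> complex) \<Rightarrow> (nat \<Rightarrow> complex) \<Rightarrow> (nat \<Rightarrow> complex)"
where
  "dest_output a b c \<rho> C m h u z_r z_d =
     (case h of (h_sr, h_rd, h_sd) \<Rightarrow>
        \<lambda>i\<in>{..<blocklength C}.
          h_sd * of_real (\<rho> powr (c / 2)) * source_symbol C m i
          + h_rd * of_real (\<rho> powr (b / 2)) * relay_input a \<rho> C m h_sr u z_r i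
          + z_d i)"

definition measurable_code :: "relay_code \<Rightarrow> bool" where
  "measurable_code C \<longleftrightarrow>
     (\<forall>i<blocklength C.
        (\<lambda>(u, h, y). relay_listens C i u h y)
          \<in> borel \<Otimes>\<^sub>M (borel \<Otimes>\<^sub>M (\<Pi>\<^sub>M j\<in>{..<i}. borel)) \<rightarrow>\<^sub>M count_space UNIV \<and>
        (\<lambda>(u, h, y). relay_symbol C i u h y)
          \<in> borel \<Otimes>\<^sub>M (borel \<Otimes>\<^sub>M (\<Pi>\<^sub>M j\<in>{..<i}. borel)) \<rightarrow>\<^sub>M borel) \<and>
     (\<lambda>(h, y). decoder C h y)
       \<in> (borel \<Otimes>\<^sub>M (borel \<Otimes>\<^sub>M borel)) \<Otimes>\<^sub>M (\<Pi>\<^sub>M j\<in>{..<blocklength C}. borel)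
         \<rightarrow>\<^sub>M count_space UNIV"

text \<open>
  Power is averaged over the block and over equiprobable messages; at the relay also over its
  noise and private randomness, but not over the fading: the constraint holds for each \<open>h_sr\<close>.
\<close>

definition source_power_ok :: "relay_code \<Rightarrow> bool" where
  "source_power_ok C \<longleftrightarrow>
     (\<Sum>m<num_messages C. \<Sum>i<blocklength C. (cmod (source_symbol C m i))\<^sup>2)
       / (real (num_messages C) * real (blocklength C)) \<le> 1"

definition relay_power_ok :: "real \<Rightarrow> real \<Rightarrow> relay_code \<Rightarrow> bool" where
  "relay_power_ok a \<rho> C \<longleftrightarrow>
     (\<forall>h.
       (\<Sum>m<num_messages C. \<Sum>i<blocklength C.
          \<integral>\<^sup>+ (u, z). ennreal ((cmod (relay_input a \<rho> C m h u z i))\<^sup>2)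
            \<partial>(relay_randomness \<Otimes>\<^sub>M noise (blocklength C)))
         / ennreal (real (num_messages C) * real (blocklength C)) \<le> 1)"

definition admissible_code :: "real \<Rightarrow> real \<Rightarrow> relay_code \<Rightarrow> bool" where
  "admissible_code a \<rho> C \<longleftrightarrow>
     0 < blocklength C \<and> 0 < num_messages C \<and>
     measurable_code C \<and> source_power_ok C \<and> relay_power_ok a \<rho> C"

definition error_prob :: "real \<Rightarrow> real \<Rightarrow> real \<Rightarrow> real \<Rightarrow> relay_code \<Rightarrow> real" where
  "error_prob a b c \<rho> C =
     (\<Sum>m<num_messages C.
        \<P>((h, u, z_r, z_d) in
            fading \<Otimes>\<^sub>M (relay_randomness \<Otimes>\<^sub>M (noise (blocklength C) \<Otimes>\<^sub>M noise (blocklength C))).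
          decoder C h (dest_output a b c \<rho> C m h u z_r z_d) \<noteq> m))
     / real (num_messages C)"

definition snr_exponent :: "real \<Rightarrow> real \<Rightarrow> ereal" where
  "snr_exponent P \<rho> = (if P = 0 then \<infinity> else ereal (- ln P / ln \<rho>))"

definition achieves_multiplexing_gain :: "(real \<Rightarrow> relay_code) \<Rightarrow> real \<Rightarrow> bool" where
  "achieves_multiplexing_gain \<C> r \<longleftrightarrow> ((\<lambda>\<rho>. rate (\<C> \<rho>) / ln \<rho>) \<longlongrightarrow> r) at_top"

definition achieves_diversity_gain ::
  "real \<Rightarrow> real \<Rightarrow> real \<Rightarrow> (real \<Rightarrow> relay_code) \<Rightarrow> ereal \<Rightarrow> bool"
where
  "achieves_diversity_gain a b c \<C> d \<longleftrightarrow>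
     ((\<lambda>\<rho>. snr_exponent (error_prob a b c \<rho> (\<C> \<rho>)) \<rho>) \<longlongrightarrow> d) at_top"

text \<open>
  The blocklength may vary with \<open>\<rho>\<close> without restriction.
\<close>

definition optimal_dmt :: "real \<Rightarrow> real \<Rightarrow> real \<Rightarrow> real \<Rightarrow> ereal" where
  "optimal_dmt a b c r =
     Sup {d. \<exists>\<C>. (\<forall>\<rho>>1. admissible_code a \<rho> (\<C> \<rho>)) \<and>
                 achieves_multiplexing_gain \<C> r \<and> achieves_diversity_gain a b c \<C> d}"

text \<open>
  For \<open>h_sr = 0\<close> the listening fraction should be infinite, whereas division by zero makes it \<open>0\<close>;
  this concerns a null set of channel realizations only.
\<close>

definition ddf_outage ::
  "real \<Rightarrow> real \<Rightarrow> real \<Rightarrow> real \<Rightarrow> real \<Rightarrow> complex \<times> complex \<times> complex \<Rightarrow> bool"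
where
  "ddf_outage a b c \<rho> R h \<longleftrightarrow>
     (case h of (h_sr, h_rd, h_sd) \<Rightarrow>
        let t = R / ln (1 + (cmod h_sr)\<^sup>2 * \<rho> powr a);
            direct = ln (1 + (cmod h_sd)\<^sup>2 * \<rho> powr c);
            both = ln (1 + (cmod h_sd)\<^sup>2 * \<rho> powr c + (cmod h_rd)\<^sup>2 * \<rho> powr b)
        in (t > 1 \<and> direct < R) \<or> (t \<le> 1 \<and> t * direct + (1 - t) * both < R))"

definition ddf_outage_prob :: "real \<Rightarrow> real \<Rightarrow> real \<Rightarrow> real \<Rightarrow> real \<Rightarrow> real" where
  "ddf_outage_prob a b c \<rho> R = \<P>(h in fading. ddf_outage a b c \<rho> R h)"

text \<open>
  \<open>d\<close> is the outage exponent for every choice of rates with multiplexing gain \<open>r\<close>.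
\<close>

definition ddf_diversity_gain :: "real \<Rightarrow> real \<Rightarrow> real \<Rightarrow> real \<Rightarrow> ereal \<Rightarrow> bool" where
  "ddf_diversity_gain a b c r d \<longleftrightarrow>
     (\<forall>R. ((\<lambda>\<rho>. R \<rho> / ln \<rho>) \<longlongrightarrow> r) at_top \<longrightarrow>
          ((\<lambda>\<rho>. snr_exponent (ddf_outage_prob a b c \<rho> (R \<rho>)) \<rho>) \<longlongrightarrow> d) at_top)"

end

theory Submission
  imports Defs "HOL-Real_Asymp.Real_Asymp"
begin

text \<open>
  With \<open>|h|\<^sup>2 = \<rho> powr (-\<alpha>), \<rho> powr (-\<beta>), \<rho> powr (-\<gamma>)\<close> for the S-R, R-D and S-D links, both sides equal
  \<open>d = (p - r) - r (r - c) / (p - r)\<close>. Dynamic decode-and-forward is out of outage whenever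
  \<open>(p - \<alpha> - r) (p - \<beta> - r) \<ge> r (r - c + \<gamma>)\<close>, and this holds if \<open>\<alpha> + \<beta> + \<gamma> \<le> d\<close>, because \<open>\<alpha> \<beta> \<ge> 0\<close> and
  \<open>p \<ge> 2 r\<close>.

  For the converse, fix a typical \<open>h_sr\<close>. A relay that listens for less than a fraction \<open>r / p\<close> of the
  block does not learn the message, so the code fails when \<open>\<gamma> \<ge> c\<close>; one that listens for longer has
  too little time to talk, so the code fails when \<open>\<beta> > d\<close>. As the relay knows neither \<open>\<beta>\<close> nor \<open>\<gamma>\<close> it
  cannot adapt its choice to them, and \<open>c < d\<close>. Both failures follow from comparing the output law
  given the message with a message-independent law.

  For achievability the blocklength is a large constant: since a factor \<open>\<rho> powr \<epsilon>\<close> is free, the noise may be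
  treated as bounded, and the union bound over a random codebook already has an exponent
  proportional to the blocklength.
\<close>

section \<open>The complex Gaussian distribution\<close>

text \<open>The value \<open>d\<close> is the solution of
  \<open>r / p * c + (1 - r / p) * (p - d) = r\<close>: a relay that listens for the fraction
  \<open>r / p\<close> receives just enough at p ln \<rho> per symbol, and the remaining time must
  make up for the weak direct link over an R-D link weakened to exponent p - d. The obstacle in the
  converse is that the schedule is random, depends on the relay's noise and is hidden from the
  destination. There is no listening fraction, only its mean over messages, noise and private
  randomness. Both bounds are therefore kept affine in the listening and talking times, so that
  expectations pass through them, and ignorance of the schedule costs only ln 2 per symbol. All such
  constants per symbol vanish against ln \<rho>. A conditional error probability bounded away from 0
  is enough, because the exponent comes entirely from the fading; this is why Markov's inequality
  suffices. For achievability, the codebook is judged by distances alone: threshold tests replace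
  likelihoods, so noise disappears from the counting and each channel poses a finite combinatorial
  problem.\<close>

definition gauss :: "real \<Rightarrow> complex \<Rightarrow> real" where
  "gauss v z = exp (- (cmod z)\<^sup>2 / v) / (pi * v)"

lemma gauss_nonneg [simp]: "0 < v \<Longrightarrow> 0 \<le> gauss v z"
  by (simp add: gauss_def)

lemma gauss_measurable [measurable]: "gauss v \<in> borel_measurable borel"
  unfolding gauss_def by measurable

text \<open>The density splits into normal densities of variance \<open>v / 2\<close> in the real
  and imaginary parts, so the integral factors over the basis of the plane.\<close>

lemma nn_integral_gauss:
  assumes v: "0 < v"
  shows "(\<integral>\<^sup>+z. ennreal (gauss v z) \<partial>lborel) = 1"
proof -
  let ?s = "sqrt (v / 2)"
  have s: "?s > 0" "2 * ?s\<^sup>2 = v" using v by auto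
  have "ennreal (gauss v z) = (\<Prod>b\<in>Basis. ennreal (normal_density 0 ?s (z \<bullet> b)))" for z :: complex
  proof -
    have "gauss v z = normal_density 0 ?s (Re z) * normal_density 0 ?s (Im z)"
    proof -
      have "sqrt (2 * pi * ?s\<^sup>2) * sqrt (2 * pi * ?s\<^sup>2) = pi * v" using v by simp
      moreover have "- (cmod z)\<^sup>2 / v = - (Re z - 0)\<^sup>2 / (2 * ?s\<^sup>2) + - (Im z - 0)\<^sup>2 / (2 * ?s\<^sup>2)"
        using s(2) by (simp add: cmod_power2 add_divide_distrib diff_divide_distrib)
      ultimately show ?thesis
        unfolding gauss_def normal_density_def by (simp only: exp_add) simp
    qed
    then show ?thesis
      by (simp add: Basis_complex_def prod.insert inner_complex_def ennreal_mult)
  qed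
  then have "(\<integral>\<^sup>+z. ennreal (gauss v z) \<partial>lborel)
     = (\<integral>\<^sup>+z. (\<Prod>b\<in>Basis. ennreal (normal_density 0 ?s (z \<bullet> b))) \<partial>(lborel :: complex measure))"
    by simp
  also have "\<dots> = (\<Prod>b\<in>(Basis :: complex set). \<integral>\<^sup>+x. ennreal (normal_density 0 ?s x) \<partial>lborel)"
    by (rule nn_integral_lborel_prod) auto
  also have "(\<integral>\<^sup>+x. ennreal (normal_density 0 ?s x) \<partial>lborel) = 1"
    using s by (subst nn_integral_eq_integral) auto
  finally show ?thesis by simp
qed

lemma complex_gaussian_eq: "complex_gaussian = density lborel (\<lambda>z. ennreal (gauss 1 z))"
  by (simp add: complex_gaussian_def gauss_def)

lemma measure_Times:
  assumes "prob_space M2" "X \<in> sets M1" "Y \<in> sets M2"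
  shows "measure (M1 \<Otimes>\<^sub>M M2) (X \<times> Y) = measure M1 X * measure M2 Y"
proof -
  interpret prob_space M2 by fact
  show ?thesis using assms by (simp add: measure_def emeasure_pair_measure_Times enn2real_mult)
qed

lemma prob_space_complex_gaussian: "prob_space complex_gaussian"
  by (rule prob_spaceI) (simp add: complex_gaussian_eq emeasure_density nn_integral_gauss)

lemma sets_complex_gaussian [measurable_cong, simp]: "sets complex_gaussian = sets borel"
  by (simp add: complex_gaussian_eq)

lemma space_complex_gaussian [simp]: "space complex_gaussian = UNIV"
  by (simp add: complex_gaussian_eq)

interpretation cg: prob_space complex_gaussian
  by (rule prob_space_complex_gaussian)

lemma emeasure_complex_cball:
  assumes "0 \<le> x"
  shows "emeasure lborel (cball (a::complex) (sqrt x)) = ennreal (pi * x)"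
  using assms by (simp add: emeasure_cball unit_ball_vol_2)

lemma le_sqrt_iff: "0 \<le> y \<Longrightarrow> y \<le> sqrt x \<longleftrightarrow> y\<^sup>2 \<le> (x::real)"
  by (metis real_sqrt_abs real_sqrt_le_iff abs_of_nonneg)

text \<open>The density is at most \<open>1 / pi\<close> and the disc has area
  \<open>pi * x\<close>. The arbitrary centre serves combined gains such as
  \<open>h2 + w * h3\<close> with \<open>h3\<close> held fixed.\<close>

lemma complex_gaussian_small_ball:
  assumes "0 \<le> x"
  shows "measure complex_gaussian {h. (cmod (h + a))\<^sup>2 \<le> x} \<le> x"
proof -
  have eq: "{h. (cmod (h + a))\<^sup>2 \<le> x} = cball (- a) (sqrt x)"
  proof -
    have "dist (- a) h = cmod (h + a)" for h
      by (metis dist_norm norm_minus_commute diff_minus_eq_add)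
    then show ?thesis by (auto simp: le_sqrt_iff)
  qed
  have "emeasure complex_gaussian (cball (- a) (sqrt x))
      = (\<integral>\<^sup>+z. ennreal (gauss 1 z) * indicator (cball (- a) (sqrt x)) z \<partial>lborel)"
    by (simp add: complex_gaussian_eq emeasure_density)
  also have "\<dots> \<le> (\<integral>\<^sup>+z. ennreal (1 / pi) * indicator (cball (- a) (sqrt x)) z \<partial>lborel)"
    by (intro nn_integral_mono mult_right_mono) (auto simp: gauss_def divide_right_mono ennreal_leI)
  also have "\<dots> = ennreal x"
  proof -
    have "(\<integral>\<^sup>+z. ennreal (1 / pi) * indicator (cball (- a) (sqrt x)) z \<partial>lborel) = ennreal (1 / pi) * ennreal (pi * x)"
      using assms by (subst nn_integral_cmult_indicator) (auto simp: emeasure_complex_cball)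
    also have "\<dots> = ennreal x" using assms by (simp flip: ennreal_mult)
    finally show ?thesis .
  qed
  finally show ?thesis
    unfolding eq using assms by (simp add: cg.emeasure_eq_measure)
qed

text \<open>The origin is removed since for \<open>h_sr = 0\<close> the listening fraction of \<open>ddf_outage\<close> is \<open>0\<close> by convention.\<close>

definition punctured_ball :: "real \<Rightarrow> complex set" where
  "punctured_ball x = {h. h \<noteq> 0 \<and> (cmod h)\<^sup>2 \<le> x}"

lemma punctured_ball_measurable [measurable]: "punctured_ball x \<in> sets borel"
  unfolding punctured_ball_def by measurable

text \<open>For \<open>x \<le> 1\<close> the density on the disc is at least exp (-1) / pi, and
  removing the origin does not change the area.\<close>

lemma complex_gaussian_small_ball_ge:
  assumes "0 \<le> x" "x \<le> 1"
  shows "x * exp (-1) \<le> measure complex_gaussian (punctured_ball x)"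
proof -
  have eq: "punctured_ball x = cball 0 (sqrt x) - {0}"
    by (auto simp: punctured_ball_def le_sqrt_iff)
  have "ennreal (x / exp 1) = ennreal (1 / (pi * exp 1)) * emeasure lborel (cball (0::complex) (sqrt x) - {0})"
    using assms by (subst emeasure_Diff_null_set) (auto simp: null_sets_def emeasure_complex_cball simp flip: ennreal_mult)
  also have "\<dots> = (\<integral>\<^sup>+z. ennreal (1 / (pi * exp 1)) * indicator (punctured_ball x) z \<partial>lborel)"
    by (subst nn_integral_cmult_indicator) (auto simp: eq)
  also have "\<dots> \<le> (\<integral>\<^sup>+z. ennreal (gauss 1 z) * indicator (punctured_ball x) z \<partial>lborel)"
  proof (intro nn_integral_mono)
    fix z :: complex
    show "ennreal (1 / (pi * exp 1)) * indicator (punctured_ball x) z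
      \<le> ennreal (gauss 1 z) * indicator (punctured_ball x) z"
    proof (cases "z \<in> punctured_ball x")
      case True
      then have "exp (-1) \<le> exp (- (cmod z)\<^sup>2)" using assms by (simp add: punctured_ball_def)
      then have "1 / (pi * exp 1) \<le> gauss 1 z"
        by (simp add: gauss_def divide_simps exp_minus)
      then show ?thesis using True by (simp add: ennreal_leI)
    qed auto
  qed
  also have "\<dots> = emeasure complex_gaussian (punctured_ball x)"
    by (simp add: complex_gaussian_eq emeasure_density)
  finally show ?thesis
    using assms by (simp add: cg.emeasure_eq_measure exp_minus divide_inverse)
qed

lemma nn_integral_complex_gaussian:
  "f \<in> borel_measurable borel \<Longrightarrow>
   (\<integral>\<^sup>+z. f z \<partial>complex_gaussian) = (\<integral>\<^sup>+z. ennreal (gauss 1 z) * f z \<partial>lborel)"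
  by (simp add: complex_gaussian_eq nn_integral_density)

text \<open>The bound 2 is the normalisation left over when the integrand is dominated by twice the
  density of variance 2, through x exp (-x) \<le> exp (-x / 2).\<close>

lemma complex_gaussian_second_moment:
  "(\<integral>\<^sup>+z. ennreal ((cmod z)\<^sup>2) \<partial>complex_gaussian) \<le> 2"
proof -
  have "(\<integral>\<^sup>+z. ennreal ((cmod z)\<^sup>2) \<partial>complex_gaussian)
      = (\<integral>\<^sup>+z. ennreal (gauss 1 z * (cmod z)\<^sup>2) \<partial>lborel)"
    by (simp add: nn_integral_complex_gaussian ennreal_mult)
  also have "\<dots> \<le> (\<integral>\<^sup>+z. 2 * ennreal (gauss 2 z) \<partial>lborel)"
  proof (intro nn_integral_mono)
    fix z :: complex
    define x where "x = (cmod z)\<^sup>2"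
    have "0 \<le> (1 - x / 4)\<^sup>2" by simp
    then have "x \<le> (1 + x / 4)\<^sup>2" by (simp add: power2_eq_square field_simps)
    also have "\<dots> \<le> (exp (x / 4))\<^sup>2"
      using exp_ge_add_one_self[of "x/4"] by (intro power_mono) (auto simp: x_def)
    also have "\<dots> = exp (x / 2)" by (simp add: exp_double[symmetric])
    finally have "x * exp (- x) \<le> exp (x / 2) * exp (- x)" by (intro mult_right_mono) auto
    also have "\<dots> = exp (- x / 2)" by (simp flip: exp_add)
    finally have "gauss 1 z * (cmod z)\<^sup>2 \<le> 2 * gauss 2 z"
      by (simp add: gauss_def x_def divide_simps mult.commute)
    then show "ennreal (gauss 1 z * (cmod z)\<^sup>2) \<le> 2 * ennreal (gauss 2 z)"
      by (metis ennreal_leI ennreal_mult'' ennreal_numeral gauss_nonneg zero_less_numeral)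
  qed
  also have "\<dots> = 2" by (simp add: nn_integral_cmult nn_integral_gauss)
  finally show ?thesis .
qed

text \<open>Half of the exponent pays for the tail; the other half remains as the integrable density
  \<open>gauss 2\<close>.\<close>

lemma complex_gaussian_tail:
  assumes "0 \<le> T"
  shows "measure complex_gaussian {z. T < cmod z} \<le> 2 * exp (- T\<^sup>2 / 2)"
proof -
  have [measurable]: "{z::complex. T < cmod z} \<in> sets borel" by measurable
  have "emeasure complex_gaussian {z. T < cmod z}
      = (\<integral>\<^sup>+z. ennreal (gauss 1 z) * indicator {z. T < cmod z} z \<partial>lborel)"
    by (simp add: complex_gaussian_eq emeasure_density)
  also have "\<dots> \<le> (\<integral>\<^sup>+z. ennreal (2 * exp (- T\<^sup>2 / 2)) * ennreal (gauss 2 z) \<partial>lborel)"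
  proof (intro nn_integral_mono)
    fix z :: complex
    have "gauss 1 z \<le> 2 * exp (- T\<^sup>2 / 2) * gauss 2 z" if "T < cmod z"
    proof -
      have "T\<^sup>2 \<le> (cmod z)\<^sup>2" using that assms by (intro power_mono) auto
      then have "exp (- (cmod z)\<^sup>2) \<le> exp (- T\<^sup>2 / 2) * exp (- (cmod z)\<^sup>2 / 2)"
        by (simp flip: exp_add)
      then show ?thesis by (simp add: gauss_def divide_simps)
    qed
    then show "ennreal (gauss 1 z) * indicator {z. T < cmod z} z
        \<le> ennreal (2 * exp (- T\<^sup>2 / 2)) * ennreal (gauss 2 z)"
      by (auto simp: indicator_def ennreal_leI simp flip: ennreal_mult)
  qed
  also have "\<dots> = ennreal (2 * exp (- T\<^sup>2 / 2))"
    by (simp add: nn_integral_cmult nn_integral_gauss)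
  finally show ?thesis
    by (simp add: cg.emeasure_eq_measure)
qed

section \<open>Densities of causally shifted noise\<close>

abbreviation seqs :: "nat \<Rightarrow> (nat \<Rightarrow> complex) measure" where
  "seqs n \<equiv> (\<Pi>\<^sub>M i\<in>{..<n}. borel)"

definition leb :: "nat \<Rightarrow> (nat \<Rightarrow> complex) measure" where
  "leb n = (\<Pi>\<^sub>M i\<in>{..<n}. lborel)"

lemma sets_leb [measurable_cong]: "sets (leb n) = sets (seqs n)"
  unfolding leb_def by (intro sets_PiM_cong) auto

lemma sets_noise [measurable_cong]: "sets (noise n) = sets (seqs n)"
  unfolding noise_def by (intro sets_PiM_cong) auto

lemma space_leb: "space (leb n) = PiE {..<n} (\<lambda>_. UNIV)"
  by (simp add: leb_def space_PiM)

lemma space_noise: "space (noise n) = PiE {..<n} (\<lambda>_. UNIV)"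
  by (simp add: noise_def space_PiM)

interpretation lebs: product_sigma_finite "\<lambda>_. lborel :: complex measure"
  by standard

interpretation cgs: product_sigma_finite "\<lambda>_. complex_gaussian"
  by standard

lemma prob_space_noise: "prob_space (noise n)"
  unfolding noise_def by (rule prob_space_PiM) (rule prob_space_complex_gaussian)

interpretation noise: prob_space "noise n" for n
  by (rule prob_space_noise)

lemma sigma_finite_leb: "sigma_finite_measure (leb n)"
  unfolding leb_def by (rule lebs.sigma_finite) simp

interpretation leb: sigma_finite_measure "leb n" for n
  by (rule sigma_finite_leb)

lemma measurable_upd_last [measurable]:
  "(\<lambda>(w, y). w(n := y)) \<in> seqs n \<Otimes>\<^sub>M borel \<rightarrow>\<^sub>M seqs (Suc n)"
  unfolding lessThan_Suc by (rule measurable_add_dim)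

lemma measurable_upd_last' [measurable (raw)]:
  assumes [measurable]: "f \<in> M \<rightarrow>\<^sub>M seqs n" "g \<in> M \<rightarrow>\<^sub>M borel"
  shows "(\<lambda>x. (f x)(n := g x)) \<in> M \<rightarrow>\<^sub>M seqs (Suc n)"
proof -
  have "(\<lambda>x. (\<lambda>(w, y). w(n := y)) (f x, g x)) \<in> M \<rightarrow>\<^sub>M seqs (Suc n)"
    by measurable
  then show ?thesis by simp
qed

lemma nn_integral_leb_Suc:
  assumes "f \<in> borel_measurable (seqs (Suc n))"
  shows "(\<integral>\<^sup>+w. f w \<partial>leb (Suc n)) = (\<integral>\<^sup>+w. \<integral>\<^sup>+y. f (w(n := y)) \<partial>lborel \<partial>leb n)"
proof -
  have "f \<in> borel_measurable (leb (Suc n))"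
    using assms by (simp cong: measurable_cong_sets add: sets_leb)
  then show ?thesis
    unfolding leb_def lessThan_Suc by (intro lebs.product_nn_integral_insert) auto
qed

lemma nn_integral_noise_Suc:
  assumes "f \<in> borel_measurable (seqs (Suc n))"
  shows "(\<integral>\<^sup>+z. f z \<partial>noise (Suc n)) = (\<integral>\<^sup>+z. \<integral>\<^sup>+y. f (z(n := y)) \<partial>complex_gaussian \<partial>noise n)"
proof -
  have "f \<in> borel_measurable (noise (Suc n))"
    using assms by (simp cong: measurable_cong_sets add: sets_noise)
  then show ?thesis
    unfolding noise_def lessThan_Suc by (intro cgs.product_nn_integral_insert) auto
qed

lemma nn_integral_lborel_shift:
  fixes f :: "'a::euclidean_space \<Rightarrow> ennreal"
  assumes "f \<in> borel_measurable borel"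
  shows "(\<integral>\<^sup>+y. f (y + c) \<partial>lborel) = (\<integral>\<^sup>+y. f y \<partial>lborel)"
proof -
  have "(\<integral>\<^sup>+y. f y \<partial>lborel) = (\<integral>\<^sup>+y. f y \<partial>distr lborel borel ((+) c))"
    by (simp only: lborel_distr_plus)
  also have "\<dots> = (\<integral>\<^sup>+y. f (y + c) \<partial>lborel)"
    using assms by (subst nn_integral_distr) (auto simp: add.commute)
  finally show ?thesis ..
qed

text \<open>The chain rule for densities: \<open>\<kappa> i\<close> is the conditional density of
  output \<open>i\<close> given the outputs before it. The restriction makes that past an element of
  \<open>seqs i\<close>.\<close>

definition causal_density ::
  "(nat \<Rightarrow> (nat \<Rightarrow> complex) \<Rightarrow> complex \<Rightarrow> ennreal) \<Rightarrow> nat \<Rightarrow> (nat \<Rightarrow> complex) \<Rightarrow> ennreal" where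
  "causal_density \<kappa> n w = (\<Prod>i<n. \<kappa> i (restrict w {..<i}) (w i))"

lemma causal_density_Suc:
  assumes "w \<in> space (leb n)"
  shows "causal_density \<kappa> (Suc n) (w(n := y)) = causal_density \<kappa> n w * \<kappa> n w y"
proof -
  have "restrict (w(n := y)) {..<i} = restrict w {..<i}" if "i \<le> n" for i
    using that by (auto simp: restrict_def)
  moreover have "restrict w {..<n} = w"
    using assms by (auto simp: space_leb PiE_def extensional_restrict)
  ultimately show ?thesis
    by (auto simp: causal_density_def intro!: prod.cong)
qed

lemma causal_density_measurable [measurable (raw)]:
  assumes \<kappa> [measurable]: "\<And>i. i < n \<Longrightarrow> (\<lambda>(w, y). \<kappa> i w y) \<in> borel_measurable (seqs i \<Otimes>\<^sub>M borel)"
  shows "causal_density \<kappa> n \<in> borel_measurable (seqs n)"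
  unfolding causal_density_def
proof (rule borel_measurable_prod_ennreal)
  fix i assume "i \<in> {..<n}"
  then have i: "i < n" by simp
  have "(\<lambda>w. (\<lambda>(w, y). \<kappa> i w y) (restrict w {..<i}, w i)) \<in> borel_measurable (seqs n)"
    by (rule measurable_compose[OF _ \<kappa>[OF i]])
      (use i in \<open>auto intro!: measurable_Pair measurable_restrict_subset measurable_component_singleton\<close>)
  then show "(\<lambda>w. \<kappa> i (restrict w {..<i}) (w i)) \<in> borel_measurable (seqs n)" by simp
qed

text \<open>The last coordinate is integrated out first, since only the last kernel depends on
  it.\<close>

lemma nn_integral_causal_density_le:
  assumes \<kappa>: "\<And>i. i < n \<Longrightarrow> (\<lambda>(w, y). \<kappa> i w y) \<in> borel_measurable (seqs i \<Otimes>\<^sub>M borel)"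
    and le: "\<And>i w. i < n \<Longrightarrow> w \<in> space (leb i) \<Longrightarrow> (\<integral>\<^sup>+y. \<kappa> i w y \<partial>lborel) \<le> 1"
  shows "(\<integral>\<^sup>+w. causal_density \<kappa> n w \<partial>leb n) \<le> 1"
  using assms
proof (induction n)
  case 0
  then show ?case by (simp add: causal_density_def leb_def PiM_empty nn_integral_count_space_finite)
next
  case (Suc n)
  note [measurable] = Suc.prems(1)[OF lessI]
  have "(\<integral>\<^sup>+w. causal_density \<kappa> (Suc n) w \<partial>leb (Suc n))
     = (\<integral>\<^sup>+w. \<integral>\<^sup>+y. causal_density \<kappa> (Suc n) (w(n := y)) \<partial>lborel \<partial>leb n)"
    by (intro nn_integral_leb_Suc causal_density_measurable Suc.prems)
  also have "\<dots> = (\<integral>\<^sup>+w. causal_density \<kappa> n w * (\<integral>\<^sup>+y. \<kappa> n w y \<partial>lborel) \<partial>leb n)"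
  proof (rule nn_integral_cong)
    fix w assume w: "w \<in> space (leb n)"
    then have w': "w \<in> space (seqs n)" by (simp add: space_leb space_PiM)
    have "(\<lambda>y. (\<lambda>(w, y). \<kappa> n w y) (w, y)) \<in> borel_measurable borel"
      using w' by measurable
    then have [measurable]: "\<kappa> n w \<in> borel_measurable borel" by simp
    show "(\<integral>\<^sup>+y. causal_density \<kappa> (Suc n) (w(n := y)) \<partial>lborel)
      = causal_density \<kappa> n w * (\<integral>\<^sup>+y. \<kappa> n w y \<partial>lborel)"
      by (simp add: causal_density_Suc[OF w] nn_integral_cmult)
  qed
  also have "\<dots> \<le> (\<integral>\<^sup>+w. causal_density \<kappa> n w * 1 \<partial>leb n)"
    using Suc.prems(2) by (intro nn_integral_mono mult_left_mono) auto
  also have "\<dots> \<le> 1" using Suc by simp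
  finally show ?case .
qed

text \<open>A channel with feedback: each output is noise plus a signal computed from the earlier
  outputs. Starting from \<open>undefined\<close> keeps the values in the extensional space
  \<open>seqs n\<close>.\<close>

primrec shifted :: "(nat \<Rightarrow> (nat \<Rightarrow> complex) \<Rightarrow> complex) \<Rightarrow> (nat \<Rightarrow> complex) \<Rightarrow> nat \<Rightarrow> (nat \<Rightarrow> complex)" where
  "shifted s z 0 = (\<lambda>_. undefined)"
| "shifted s z (Suc n) = (let w = shifted s z n in w(n := z n + s n w))"

lemma shifted_cong: "(\<And>i. i < n \<Longrightarrow> z i = z' i) \<Longrightarrow> shifted s z n = shifted s z' n"
  by (induction n) (auto simp: Let_def)

lemma shifted_measurable:
  assumes "\<And>i. i < n \<Longrightarrow> s i \<in> borel_measurable (seqs i)"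
  shows "n \<le> m \<Longrightarrow> (\<lambda>z. shifted s z n) \<in> seqs m \<rightarrow>\<^sub>M seqs n"
  using assms
proof (induction n)
  case 0
  then show ?case by (simp add: PiM_empty)
next
  case (Suc n)
  have [measurable]: "(\<lambda>z. shifted s z n) \<in> seqs m \<rightarrow>\<^sub>M seqs n"
    "s n \<in> borel_measurable (seqs n)" "(\<lambda>z. z n) \<in> borel_measurable (seqs m)"
    using Suc by (auto intro!: measurable_component_singleton)
  show ?case unfolding shifted.simps Let_def by measurable
qed

text \<open>The map from noise to outputs is triangular with unit diagonal, hence preserves Lebesgue
  measure. The induction translates the last coordinate by a shift that is fixed once the earlier
  outputs are.\<close>

lemma nn_integral_shifted:
  assumes "\<And>i. i < n \<Longrightarrow> s i \<in> borel_measurable (seqs i)"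
    and "G \<in> borel_measurable (seqs n)"
  shows "(\<integral>\<^sup>+z. G (shifted s z n) \<partial>noise n)
       = (\<integral>\<^sup>+w. G w * causal_density (\<lambda>i w y. ennreal (gauss 1 (y - s i w))) n w \<partial>leb n)"
  using assms
proof (induction n arbitrary: G)
  case 0
  then show ?case
    by (simp add: causal_density_def noise_def leb_def PiM_empty nn_integral_count_space_finite)
next
  case (Suc n)
  let ?\<kappa> = "\<lambda>i w y. ennreal (gauss 1 (y - s i w))"
  note [measurable] = Suc.prems(1)[OF lessI] Suc.prems(2)
  have [measurable]: "(\<lambda>z. shifted s z n) \<in> seqs n \<rightarrow>\<^sub>M seqs n"
    by (rule shifted_measurable) (use Suc.prems in auto)
  have [measurable]: "(\<lambda>z. shifted s z (Suc n)) \<in> seqs (Suc n) \<rightarrow>\<^sub>M seqs (Suc n)"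
    by (rule shifted_measurable) (use Suc.prems in auto)
  have \<kappa>m: "(\<lambda>(w, y). ?\<kappa> i w y) \<in> borel_measurable (seqs i \<Otimes>\<^sub>M borel)" if "i < Suc n" for i
  proof -
    note [measurable] = Suc.prems(1)[OF that]
    show ?thesis by measurable
  qed
  define G' where "G' w = (\<integral>\<^sup>+y. ?\<kappa> n w y * G (w(n := y)) \<partial>lborel)" for w
  have [measurable]: "G' \<in> borel_measurable (seqs n)"
    unfolding G'_def by measurable
  have "(\<integral>\<^sup>+z. G (shifted s z (Suc n)) \<partial>noise (Suc n))
      = (\<integral>\<^sup>+z. \<integral>\<^sup>+y. G (shifted s (z(n := y)) (Suc n)) \<partial>complex_gaussian \<partial>noise n)"
    by (intro nn_integral_noise_Suc) measurable
  also have "\<dots> = (\<integral>\<^sup>+z. G' (shifted s z n) \<partial>noise n)"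
  proof (rule nn_integral_cong)
    fix z assume "z \<in> space (noise n)"
    then have z: "z \<in> space (seqs n)" by (simp add: space_noise space_PiM)
    define w where "w = shifted s z n"
    have w [measurable]: "w \<in> space (seqs n)"
      unfolding w_def using z by (rule measurable_space[rotated]) measurable
    have "shifted s (z(n := y)) n = w" for y
      unfolding w_def by (rule shifted_cong) auto
    then have "(\<integral>\<^sup>+y. G (shifted s (z(n := y)) (Suc n)) \<partial>complex_gaussian)
        = (\<integral>\<^sup>+y. G (w(n := y + s n w)) \<partial>complex_gaussian)"
      by (simp add: Let_def)
    also have "\<dots> = (\<integral>\<^sup>+y. ennreal (gauss 1 y) * G (w(n := y + s n w)) \<partial>lborel)"
      using w by (intro nn_integral_complex_gaussian) measurable
    also have "\<dots> = (\<integral>\<^sup>+y. ?\<kappa> n w (y + s n w) * G (w(n := y + s n w)) \<partial>lborel)"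
      by simp
    also have "\<dots> = G' w"
      unfolding G'_def using w by (intro nn_integral_lborel_shift) measurable
    finally show "(\<integral>\<^sup>+y. G (shifted s (z(n := y)) (Suc n)) \<partial>complex_gaussian) = G' (shifted s z n)"
      by (simp add: w_def)
  qed
  also have "\<dots> = (\<integral>\<^sup>+w. G' w * causal_density ?\<kappa> n w \<partial>leb n)"
    using Suc by (intro Suc.IH) auto
  also have "\<dots> = (\<integral>\<^sup>+w. \<integral>\<^sup>+y. G (w(n := y)) * causal_density ?\<kappa> (Suc n) (w(n := y)) \<partial>lborel \<partial>leb n)"
  proof (rule nn_integral_cong)
    fix w assume w: "w \<in> space (leb n)"
    then have w' [measurable]: "w \<in> space (seqs n)" by (simp add: space_leb space_PiM)
    show "G' w * causal_density ?\<kappa> n w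
      = (\<integral>\<^sup>+y. G (w(n := y)) * causal_density ?\<kappa> (Suc n) (w(n := y)) \<partial>lborel)"
      unfolding G'_def causal_density_Suc[OF w]
      by (subst nn_integral_multc[symmetric]) (measurable, simp add: mult_ac)
  qed
  also have "\<dots> = (\<integral>\<^sup>+w. G w * causal_density ?\<kappa> (Suc n) w \<partial>leb (Suc n))"
  proof (rule nn_integral_leb_Suc[symmetric])
    have [measurable]: "causal_density ?\<kappa> (Suc n) \<in> borel_measurable (seqs (Suc n))"
      by (rule causal_density_measurable) (rule \<kappa>m)
    show "(\<lambda>w. G w * causal_density ?\<kappa> (Suc n) w) \<in> borel_measurable (seqs (Suc n))"
      by measurable
  qed
  finally show ?case .
qed

section \<open>Success probability against a message-independent law\<close>

text \<open>Where \<open>f m\<close> is at most \<open>\<theta> * q\<close>, a correct decision is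
  charged to \<open>q\<close>. The decision regions of different messages are disjoint, so these
  charges sum to at most \<open>\<theta>\<close> however many messages there are.\<close>

lemma sum_success_le:
  fixes f :: "nat \<Rightarrow> 'a \<Rightarrow> ennreal"
  assumes [measurable]: "D \<in> \<mu> \<rightarrow>\<^sub>M count_space UNIV" "\<And>m. m < M \<Longrightarrow> f m \<in> borel_measurable \<mu>"
      "q \<in> borel_measurable \<mu>"
    and q: "(\<integral>\<^sup>+y. q y \<partial>\<mu>) \<le> 1"
  shows "(\<Sum>m<M. \<integral>\<^sup>+y. indicator {y. D y = m} y * f m y \<partial>\<mu>)
       \<le> \<theta> + (\<Sum>m<M. \<integral>\<^sup>+y. indicator {y. \<theta> * q y < f m y} y * f m y \<partial>\<mu>)"
proof -
  have ind [measurable]: "(\<lambda>y. indicator {y. D y = m} y :: ennreal) \<in> borel_measurable \<mu>" for m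
    unfolding indicator_def by measurable
  have ind' [measurable]: "(\<lambda>y. indicator {y. \<theta> * q y < f m y} y :: ennreal) \<in> borel_measurable \<mu>"
    if [simp]: "m < M" for m
    unfolding indicator_def by measurable
  have "(\<Sum>m<M. \<integral>\<^sup>+y. indicator {y. D y = m} y * f m y \<partial>\<mu>)
     \<le> (\<Sum>m<M. \<integral>\<^sup>+y. indicator {y. D y = m} y * (\<theta> * q y)
                     + indicator {y. \<theta> * q y < f m y} y * f m y \<partial>\<mu>)"
    by (intro sum_mono nn_integral_mono) (auto simp: indicator_def not_less)
  also have "\<dots> = (\<Sum>m<M. \<integral>\<^sup>+y. indicator {y. D y = m} y * (\<theta> * q y) \<partial>\<mu>)
       + (\<Sum>m<M. \<integral>\<^sup>+y. indicator {y. \<theta> * q y < f m y} y * f m y \<partial>\<mu>)"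
    by (subst sum.distrib[symmetric], intro sum.cong refl nn_integral_add) auto
  also have "(\<Sum>m<M. \<integral>\<^sup>+y. indicator {y. D y = m} y * (\<theta> * q y) \<partial>\<mu>)
      = (\<integral>\<^sup>+y. (\<Sum>m<M. indicator {y. D y = m} y) * (\<theta> * q y) \<partial>\<mu>)"
    by (subst nn_integral_sum[symmetric]) (auto simp: sum_distrib_right)
  also have "\<dots> \<le> (\<integral>\<^sup>+y. \<theta> * q y \<partial>\<mu>)"
  proof (rule nn_integral_mono)
    fix y
    have "(\<Sum>m<M. indicator {y. D y = m} y :: ennreal) = (\<Sum>m<M. if m = D y then 1 else 0)"
      by (intro sum.cong) (auto simp: indicator_def)
    also have "\<dots> \<le> 1" by (subst sum.delta) auto
    finally show "(\<Sum>m<M. indicator {y. D y = m} y) * (\<theta> * q y) \<le> \<theta> * q y"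
      by (metis mult.left_neutral mult_right_mono zero_le)
  qed
  also have "\<dots> \<le> \<theta>"
    using q by (subst nn_integral_cmult) (auto intro: mult_left_le)
  finally show ?thesis by (simp add: add_right_mono)
qed

lemma causal_cost_measurable:
  fixes c :: "nat \<Rightarrow> (nat \<Rightarrow> complex) \<Rightarrow> complex \<Rightarrow> real"
  assumes c: "\<And>i. i < n \<Longrightarrow> (\<lambda>(w, y). c i w y) \<in> borel_measurable (seqs i \<Otimes>\<^sub>M borel)"
  shows "(\<lambda>w. \<Sum>i<n. c i (restrict w {..<i}) (w i)) \<in> borel_measurable (seqs n)"
proof (rule borel_measurable_sum)
  fix i assume "i \<in> {..<n}"
  then have i: "i < n" by simp
  have "(\<lambda>w. (\<lambda>(w, y). c i w y) (restrict w {..<i}, w i)) \<in> borel_measurable (seqs n)"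
    by (rule measurable_compose[OF _ c[OF i]])
      (use i in \<open>auto intro!: measurable_Pair measurable_restrict_subset measurable_component_singleton\<close>)
  then show "(\<lambda>w. c i (restrict w {..<i}) (w i)) \<in> borel_measurable (seqs n)" by simp
qed

text \<open>
  The bound of Verdu and Han on the success probability, combined with Markov's inequality for
  the log-likelihood ratio between the output law and the message-independent law \<open>\<kappa>\<close>.
\<close>

lemma causal_success_bound:
  fixes c :: "nat \<Rightarrow> nat \<Rightarrow> (nat \<Rightarrow> complex) \<Rightarrow> complex \<Rightarrow> real"
  assumes D [measurable]: "D \<in> seqs n \<rightarrow>\<^sub>M count_space UNIV"
    and s: "\<And>m i. m < M \<Longrightarrow> i < n \<Longrightarrow> s m i \<in> borel_measurable (seqs i)"
    and \<kappa>: "\<And>i. i < n \<Longrightarrow> (\<lambda>(w, y). \<kappa> i w y) \<in> borel_measurable (seqs i \<Otimes>\<^sub>M borel)"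
    and le: "\<And>i w. i < n \<Longrightarrow> w \<in> space (leb i) \<Longrightarrow> (\<integral>\<^sup>+y. \<kappa> i w y \<partial>lborel) \<le> 1"
    and c: "\<And>m i. m < M \<Longrightarrow> i < n \<Longrightarrow> (\<lambda>(w, y). c m i w y) \<in> borel_measurable (seqs i \<Otimes>\<^sub>M borel)"
    and c0: "\<And>m i w y. m < M \<Longrightarrow> i < n \<Longrightarrow> 0 \<le> c m i w y"
    and ratio: "\<And>m i w y. m < M \<Longrightarrow> i < n \<Longrightarrow>
       ennreal (gauss 1 (y - s m i w)) \<le> ennreal (exp (c m i w y)) * \<kappa> i w y"
    and L: "0 < L"
  shows "(\<Sum>m<M. \<integral>\<^sup>+z. indicator {w. D w = m} (shifted (s m) z n) \<partial>noise n)
       \<le> ennreal (exp L) + (\<Sum>m<M. \<integral>\<^sup>+z. ennreal ((\<Sum>i<n.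
            c m i (restrict (shifted (s m) z n) {..<i}) (shifted (s m) z n i)) / L) \<partial>noise n)"
proof -
  define V where "V m w = (\<Sum>i<n. c m i (restrict w {..<i}) (w i))" for m w
  define f where "f m = causal_density (\<lambda>i w y. ennreal (gauss 1 (y - s m i w))) n" for m
  define q where "q = causal_density \<kappa> n"
  have V [measurable]: "V m \<in> borel_measurable (seqs n)" if m: "m < M" for m
    unfolding V_def by (rule causal_cost_measurable) (rule c[OF m])
  have f [measurable]: "f m \<in> borel_measurable (seqs n)" if m: "m < M" for m
    unfolding f_def
  proof (rule causal_density_measurable)
    fix i assume "i < n"
    note [measurable] = s[OF m this]
    show "(\<lambda>(w, y). ennreal (gauss 1 (y - s m i w))) \<in> borel_measurable (seqs i \<Otimes>\<^sub>M borel)"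
      by measurable
  qed
  have q [measurable]: "q \<in> borel_measurable (seqs n)"
    unfolding q_def by (rule causal_density_measurable) (rule \<kappa>)
  have fq: "f m w \<le> ennreal (exp (V m w)) * q w" if m: "m < M" for m w
  proof -
    have "f m w \<le> (\<Prod>i<n. ennreal (exp (c m i (restrict w {..<i}) (w i))) * \<kappa> i (restrict w {..<i}) (w i))"
      unfolding f_def causal_density_def using m by (intro prod_mono_ennreal ratio) auto
    also have "\<dots> = ennreal (exp (V m w)) * q w"
      by (simp add: prod.distrib prod_ennreal V_def exp_sum q_def causal_density_def)
    finally show ?thesis .
  qed
  have trans: "(\<integral>\<^sup>+z. G (shifted (s m) z n) \<partial>noise n) = (\<integral>\<^sup>+w. G w * f m w \<partial>leb n)"
    if "m < M" "G \<in> borel_measurable (seqs n)" for m G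
    unfolding f_def by (rule nn_integral_shifted) (use s that in auto)
  have ind [measurable]: "(\<lambda>w. indicator {w. D w = m} w :: ennreal) \<in> borel_measurable (seqs n)" for m
    unfolding indicator_def by measurable
  have "(\<Sum>m<M. \<integral>\<^sup>+z. indicator {w. D w = m} (shifted (s m) z n) \<partial>noise n)
      = (\<Sum>m<M. \<integral>\<^sup>+w. indicator {w. D w = m} w * f m w \<partial>leb n)"
    by (intro sum.cong refl trans) auto
  also have "\<dots> \<le> ennreal (exp L)
      + (\<Sum>m<M. \<integral>\<^sup>+w. indicator {w. ennreal (exp L) * q w < f m w} w * f m w \<partial>leb n)"
  proof (rule sum_success_le)
    show "(\<integral>\<^sup>+w. q w \<partial>leb n) \<le> 1"
      unfolding q_def by (rule nn_integral_causal_density_le) (use \<kappa> le in auto)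
  qed measurable
  also have "(\<Sum>m<M. \<integral>\<^sup>+w. indicator {w. ennreal (exp L) * q w < f m w} w * f m w \<partial>leb n)
      \<le> (\<Sum>m<M. \<integral>\<^sup>+w. ennreal (V m w / L) * f m w \<partial>leb n)"
  proof (intro sum_mono nn_integral_mono)
    fix m w assume "m \<in> {..<M}"
    then have m: "m < M" by simp
    have "1 \<le> V m w / L" if "ennreal (exp L) * q w < f m w"
    proof (rule ccontr)
      assume "\<not> 1 \<le> V m w / L"
      then have "exp (V m w) \<le> exp L" using L by (simp add: divide_simps)
      then have "ennreal (exp (V m w)) * q w \<le> ennreal (exp L) * q w"
        by (intro mult_right_mono ennreal_leI) auto
      with fq[OF m, of w] that show False by simp
    qed
    then have "(1::ennreal) \<le> ennreal (V m w / L)" if "ennreal (exp L) * q w < f m w"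
      using that ennreal_leI[of 1 "V m w / L"] by simp
    then show "indicator {w. ennreal (exp L) * q w < f m w} w * f m w \<le> ennreal (V m w / L) * f m w"
      by (intro mult_right_mono) (auto simp: indicator_def)
  qed
  also have "(\<Sum>m<M. \<integral>\<^sup>+w. ennreal (V m w / L) * f m w \<partial>leb n)
      = (\<Sum>m<M. \<integral>\<^sup>+z. ennreal (V m (shifted (s m) z n) / L) \<partial>noise n)"
    by (intro sum.cong refl trans[symmetric]) auto
  finally show ?thesis by (simp add: V_def add_left_mono)
qed

section \<open>Concatenated noise blocks\<close>

definition seq_append :: "nat \<Rightarrow> nat \<Rightarrow> (nat \<Rightarrow> complex) \<Rightarrow> (nat \<Rightarrow> complex) \<Rightarrow> (nat \<Rightarrow> complex)" where
  "seq_append n k z z' = (\<lambda>i\<in>{..<n + k}. if i < n then z i else z' (i - n))"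

lemma seq_append_measurable [measurable (raw)]:
  assumes "f \<in> M \<rightarrow>\<^sub>M seqs n" "g \<in> M \<rightarrow>\<^sub>M seqs k"
  shows "(\<lambda>x. seq_append n k (f x) (g x)) \<in> M \<rightarrow>\<^sub>M seqs (n + k)"
  unfolding seq_append_def
proof (rule measurable_restrict)
  fix i assume i: "i \<in> {..<n + k}"
  show "(\<lambda>x. if i < n then f x i else g x (i - n)) \<in> borel_measurable M"
  proof (cases "i < n")
    case True
    then show ?thesis
      using measurable_compose[OF assms(1) measurable_component_singleton[of i "{..<n}"]] by simp
  next
    case False
    then show ?thesis
      using i measurable_compose[OF assms(2) measurable_component_singleton[of "i - n" "{..<k}"]] by simp
  qed
qed

lemma nn_integral_noise_append:
  assumes "F \<in> borel_measurable (seqs (n + k))"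
  shows "(\<integral>\<^sup>+z. F z \<partial>noise (n + k)) = (\<integral>\<^sup>+z. \<integral>\<^sup>+z'. F (seq_append n k z z') \<partial>noise k \<partial>noise n)"
  using assms
proof (induction k arbitrary: F)
  case 0
  have "(\<integral>\<^sup>+z'. F (seq_append n 0 z z') \<partial>noise 0) = F z" if "z \<in> space (noise n)" for z
  proof -
    have "seq_append n 0 z z' = z" for z'
      using that by (auto simp: seq_append_def space_noise PiE_def extensional_def fun_eq_iff)
    then show ?thesis by (simp add: noise.emeasure_space_1)
  qed
  then have "(\<integral>\<^sup>+z. \<integral>\<^sup>+z'. F (seq_append n 0 z z') \<partial>noise 0 \<partial>noise n) = (\<integral>\<^sup>+z. F z \<partial>noise n)"
    by (intro nn_integral_cong)
  then show ?case by simp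
next
  case (Suc k)
  note [measurable] = Suc.prems
  have [measurable]: "F \<in> borel_measurable (seqs (Suc (n + k)))" using Suc.prems by simp
  have "(\<integral>\<^sup>+z. F z \<partial>noise (n + Suc k))
      = (\<integral>\<^sup>+z. \<integral>\<^sup>+y. F (z(n + k := y)) \<partial>complex_gaussian \<partial>noise (n + k))"
    using nn_integral_noise_Suc[of F "n + k"] Suc.prems by simp
  also have "\<dots> = (\<integral>\<^sup>+z. \<integral>\<^sup>+z'. \<integral>\<^sup>+y. F ((seq_append n k z z')(n + k := y)) \<partial>complex_gaussian \<partial>noise k \<partial>noise n)"
    by (rule Suc.IH) measurable
  also have "\<dots> = (\<integral>\<^sup>+z. \<integral>\<^sup>+z'. F (seq_append n (Suc k) z z') \<partial>noise (Suc k) \<partial>noise n)"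
  proof (rule nn_integral_cong)
    fix z assume "z \<in> space (noise n)"
    then have [measurable]: "z \<in> space (seqs n)" by (simp add: space_noise space_PiM)
    have "(\<lambda>z'. F (seq_append n (Suc k) z z')) \<in> borel_measurable (seqs (Suc k))"
      by (rule measurable_compose[OF seq_append_measurable Suc.prems]) auto
    moreover have "(seq_append n k z z')(n + k := y) = seq_append n (Suc k) z (z'(k := y))" for z' y
      by (auto simp: seq_append_def fun_eq_iff)
    ultimately show "(\<integral>\<^sup>+z'. \<integral>\<^sup>+y. F ((seq_append n k z z')(n + k := y)) \<partial>complex_gaussian \<partial>noise k)
        = (\<integral>\<^sup>+z'. F (seq_append n (Suc k) z z') \<partial>noise (Suc k))"
      by (simp add: nn_integral_noise_Suc)
  qed
  finally show ?case .
qed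

text \<open>The case without feedback, which is the destination's view once the relay's inputs are
  fixed.\<close>

lemma shifted_const: "shifted (\<lambda>i _. \<xi> i) z n = (\<lambda>i\<in>{..<n}. z i + \<xi> i)"
  by (induction n) (auto simp: Let_def fun_eq_iff)

section \<open>Relay codes as causal systems\<close>

lemma sets_relay_randomness [measurable_cong]: "sets relay_randomness = sets borel"
  by (simp add: relay_randomness_def)

lemma space_relay_randomness [simp]: "space relay_randomness = UNIV"
  by (simp add: relay_randomness_def)

lemma prob_space_relay_randomness: "prob_space relay_randomness"
  unfolding relay_randomness_def by (rule prob_space_uniform_measure) auto

interpretation rr: prob_space relay_randomness
  by (rule prob_space_relay_randomness)

interpretation rrn: pair_prob_space relay_randomness "noise n" for n
  by standard

lemma nn_integral_noise_component:
  assumes "i < n" and [measurable]: "f \<in> borel_measurable borel"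
  shows "(\<integral>\<^sup>+z. f (z i) \<partial>noise n) = (\<integral>\<^sup>+y. f y \<partial>complex_gaussian)"
proof -
  have "distr (noise n) complex_gaussian (\<lambda>z. z i) = complex_gaussian"
    unfolding noise_def using assms(1) prob_space_complex_gaussian
    by (intro distr_PiM_component) auto
  then have "(\<integral>\<^sup>+y. f y \<partial>complex_gaussian) = (\<integral>\<^sup>+y. f y \<partial>distr (noise n) complex_gaussian (\<lambda>z. z i))"
    by simp
  also have "\<dots> = (\<integral>\<^sup>+z. f (z i) \<partial>noise n)"
    using assms(1) by (intro nn_integral_distr) (auto simp: noise_def)
  finally show ?thesis ..
qed

lemma noise_second_moment: "i < n \<Longrightarrow> (\<integral>\<^sup>+z. ennreal ((cmod (z i))\<^sup>2) \<partial>noise n) \<le> 2"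
  by (subst nn_integral_noise_component[where f = "\<lambda>y. ennreal ((cmod y)\<^sup>2)"])
    (auto intro: complex_gaussian_second_moment)

text \<open>Recovers the relay's past from a raw output sequence, with neither the message nor the
  noise as an argument. This is what lets a message-independent law follow the relay's schedule and,
  through \<open>sent\<close>, its transmissions.\<close>

primrec heard :: "relay_code \<Rightarrow> complex \<Rightarrow> real \<Rightarrow> (nat \<Rightarrow> complex) \<Rightarrow> nat \<Rightarrow> (nat \<Rightarrow> complex)" where
  "heard C h u w 0 = (\<lambda>_. undefined)"
| "heard C h u w (Suc i) =
     (let y = heard C h u w i in y(i := (if relay_listens C i u h y then w i else 0)))"

definition sent :: "relay_code \<Rightarrow> complex \<Rightarrow> real \<Rightarrow> (nat \<Rightarrow> complex) \<Rightarrow> nat \<Rightarrow> complex" where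
  "sent C h u w i = (let y = heard C h u w i
     in if relay_listens C i u h y then 0 else relay_symbol C i u h y)"

definition relay_shift ::
  "real \<Rightarrow> real \<Rightarrow> relay_code \<Rightarrow> nat \<Rightarrow> complex \<Rightarrow> real \<Rightarrow> nat \<Rightarrow> (nat \<Rightarrow> complex) \<Rightarrow> complex" where
  "relay_shift a \<rho> C m h u i w =
     (if relay_listens C i u h (heard C h u w i)
      then h * of_real (\<rho> powr (a / 2)) * source_symbol C m i else 0)"

definition listening ::
  "real \<Rightarrow> real \<Rightarrow> relay_code \<Rightarrow> nat \<Rightarrow> complex \<Rightarrow> real \<Rightarrow> (nat \<Rightarrow> complex) \<Rightarrow> nat \<Rightarrow> bool" where
  "listening a \<rho> C m h u z i \<longleftrightarrow> relay_listens C i u h (relay_past a \<rho> C m h u z i)"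

lemma heard_cong: "(\<And>j. j < n \<Longrightarrow> w j = w' j) \<Longrightarrow> heard C h u w n = heard C h u w' n"
  by (induction n) (auto simp: Let_def)

lemma sent_cong: "(\<And>j. j < n \<Longrightarrow> w j = w' j) \<Longrightarrow> sent C h u w n = sent C h u w' n"
  unfolding sent_def using heard_cong[of n w w'] by simp

lemma shifted_stable: "i < n \<Longrightarrow> shifted s z n i = shifted s z (Suc i) i"
  by (induction n) (auto simp: Let_def less_Suc_eq)

text \<open>The two recursions agree slot by slot: a listened entry is the shifted noise, and every
  other entry is overwritten by \<open>0\<close> on both sides.\<close>

lemma relay_past_eq_heard:
  "relay_past a \<rho> C m h u z n = heard C h u (shifted (relay_shift a \<rho> C m h u) z n) n"
proof (induction n)
  case (Suc n)
  define w where "w = shifted (relay_shift a \<rho> C m h u) z n"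
  have IH: "relay_past a \<rho> C m h u z n = heard C h u w n"
    using Suc by (simp add: w_def)
  have w_Suc: "shifted (relay_shift a \<rho> C m h u) z (Suc n) = w(n := z n + relay_shift a \<rho> C m h u n w)"
    by (simp add: Let_def w_def)
  have heard_w: "heard C h u (w(n := v)) n = heard C h u w n" for v
    by (rule heard_cong) auto
  show ?case
    unfolding w_Suc
    unfolding heard.simps relay_past.simps Let_def heard_w IH
    unfolding relay_shift_def by (auto simp: add.commute fun_eq_iff)
qed simp

lemma relay_past_eq_heard':
  "i \<le> n \<Longrightarrow> relay_past a \<rho> C m h u z i = heard C h u (shifted (relay_shift a \<rho> C m h u) z n) i"
  unfolding relay_past_eq_heard by (rule heard_cong) (simp add: shifted_stable)

lemma relay_input_eq_sent:
  "i \<le> n \<Longrightarrow> relay_input a \<rho> C m h u z i = sent C h u (shifted (relay_shift a \<rho> C m h u) z n) i"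
  unfolding relay_input_def sent_def by (simp add: relay_past_eq_heard')

lemma relay_input_listening: "listening a \<rho> C m h u z i \<Longrightarrow> relay_input a \<rho> C m h u z i = 0"
  by (simp add: relay_input_def listening_def Let_def)

lemma relay_listens_measurable:
  assumes "measurable_code C" "i < blocklength C"
    and [measurable]: "U \<in> borel_measurable M" "H \<in> borel_measurable M" "Y \<in> M \<rightarrow>\<^sub>M seqs i"
  shows "Measurable.pred M (\<lambda>x. relay_listens C i (U x) (H x) (Y x))"
proof -
  have "(\<lambda>(u, h, y). relay_listens C i u h y)
      \<in> borel \<Otimes>\<^sub>M (borel \<Otimes>\<^sub>M seqs i) \<rightarrow>\<^sub>M count_space UNIV"
    using assms by (auto simp: measurable_code_def)
  from measurable_compose[OF _ this, of "\<lambda>x. (U x, H x, Y x)"] show ?thesis by simp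
qed

lemma relay_symbol_measurable:
  assumes "measurable_code C" "i < blocklength C"
    and [measurable]: "U \<in> borel_measurable M" "H \<in> borel_measurable M" "Y \<in> M \<rightarrow>\<^sub>M seqs i"
  shows "(\<lambda>x. relay_symbol C i (U x) (H x) (Y x)) \<in> borel_measurable M"
proof -
  have "(\<lambda>(u, h, y). relay_symbol C i u h y)
      \<in> borel \<Otimes>\<^sub>M (borel \<Otimes>\<^sub>M seqs i) \<rightarrow>\<^sub>M borel"
    using assms by (auto simp: measurable_code_def)
  from measurable_compose[OF _ this, of "\<lambda>x. (U x, H x, Y x)"] show ?thesis by simp
qed

lemma decoder_measurable:
  assumes "measurable_code C"
    and [measurable]: "H \<in> M \<rightarrow>\<^sub>M borel \<Otimes>\<^sub>M (borel \<Otimes>\<^sub>M borel)" "Y \<in> M \<rightarrow>\<^sub>M seqs (blocklength C)"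
  shows "(\<lambda>x. decoder C (H x) (Y x)) \<in> M \<rightarrow>\<^sub>M count_space UNIV"
proof -
  have "(\<lambda>(h, y). decoder C h y)
      \<in> (borel \<Otimes>\<^sub>M (borel \<Otimes>\<^sub>M borel)) \<Otimes>\<^sub>M seqs (blocklength C) \<rightarrow>\<^sub>M count_space UNIV"
    using assms by (auto simp: measurable_code_def)
  from measurable_compose[OF _ this, of "\<lambda>x. (H x, Y x)"] show ?thesis by simp
qed

lemma seqs_component_measurable:
  assumes "Z \<in> M \<rightarrow>\<^sub>M seqs n" "i < n"
  shows "(\<lambda>x. Z x i) \<in> borel_measurable M"
  using measurable_compose[OF assms(1) measurable_component_singleton[of i "{..<n}"]] assms(2) by simp

lemma noise_component_sq_measurable:
  assumes "i < n"
  shows "(\<lambda>z. ennreal ((cmod (z i))\<^sup>2)) \<in> borel_measurable (noise n)"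
proof -
  have [measurable]: "(\<lambda>z. z i) \<in> borel_measurable (noise n)"
    using assms by (intro seqs_component_measurable[of "\<lambda>z. z" _ n]) auto
  show ?thesis by measurable
qed

lemma relay_past_measurable:
  assumes C: "measurable_code C"
    and [measurable]: "U \<in> borel_measurable M" "H \<in> borel_measurable M" and Z: "Z \<in> M \<rightarrow>\<^sub>M seqs k"
  shows "n \<le> blocklength C \<Longrightarrow> n \<le> k \<Longrightarrow> (\<lambda>x. relay_past a \<rho> C m (H x) (U x) (Z x) n) \<in> M \<rightarrow>\<^sub>M seqs n"
proof (induction n)
  case 0
  then show ?case by (simp add: PiM_empty)
next
  case (Suc n)
  have [measurable]: "(\<lambda>x. relay_past a \<rho> C m (H x) (U x) (Z x) n) \<in> M \<rightarrow>\<^sub>M seqs n"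
    "(\<lambda>x. Z x n) \<in> borel_measurable M"
    using Suc Z by (auto intro: seqs_component_measurable)
  have [measurable]: "Measurable.pred M (\<lambda>x. relay_listens C n (U x) (H x) (relay_past a \<rho> C m (H x) (U x) (Z x) n))"
    using Suc.prems by (intro relay_listens_measurable C) auto
  show ?case unfolding relay_past.simps Let_def by measurable
qed

lemma heard_measurable:
  assumes C: "measurable_code C"
    and [measurable]: "U \<in> borel_measurable M" "H \<in> borel_measurable M" and Z: "Z \<in> M \<rightarrow>\<^sub>M seqs k"
  shows "n \<le> blocklength C \<Longrightarrow> n \<le> k \<Longrightarrow> (\<lambda>x. heard C (H x) (U x) (Z x) n) \<in> M \<rightarrow>\<^sub>M seqs n"
proof (induction n)
  case 0
  then show ?case by (simp add: PiM_empty)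
next
  case (Suc n)
  have [measurable]: "(\<lambda>x. heard C (H x) (U x) (Z x) n) \<in> M \<rightarrow>\<^sub>M seqs n"
    "(\<lambda>x. Z x n) \<in> borel_measurable M"
    using Suc Z by (auto intro: seqs_component_measurable)
  have [measurable]: "Measurable.pred M (\<lambda>x. relay_listens C n (U x) (H x) (heard C (H x) (U x) (Z x) n))"
    using Suc.prems by (intro relay_listens_measurable C) auto
  show ?case unfolding heard.simps Let_def by measurable
qed

lemma sent_measurable:
  assumes C: "measurable_code C"
    and UH [measurable]: "U \<in> borel_measurable M" "H \<in> borel_measurable M" and Z: "Z \<in> M \<rightarrow>\<^sub>M seqs k"
    and n: "n < blocklength C" "n \<le> k"
  shows "(\<lambda>x. sent C (H x) (U x) (Z x) n) \<in> borel_measurable M"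
proof -
  have [measurable]: "(\<lambda>x. heard C (H x) (U x) (Z x) n) \<in> M \<rightarrow>\<^sub>M seqs n"
    using n Z by (intro heard_measurable C UH) auto
  have [measurable]: "Measurable.pred M (\<lambda>x. relay_listens C n (U x) (H x) (heard C (H x) (U x) (Z x) n))"
    "(\<lambda>x. relay_symbol C n (U x) (H x) (heard C (H x) (U x) (Z x) n)) \<in> borel_measurable M"
    using n by (auto intro!: relay_listens_measurable relay_symbol_measurable C)
  show ?thesis unfolding sent_def Let_def by measurable
qed

lemma listening_measurable:
  assumes C: "measurable_code C"
    and UH [measurable]: "U \<in> borel_measurable M" "H \<in> borel_measurable M" and Z: "Z \<in> M \<rightarrow>\<^sub>M seqs k"
    and n: "n < blocklength C" "n \<le> k"
  shows "Measurable.pred M (\<lambda>x. listening a \<rho> C m (H x) (U x) (Z x) n)"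
  unfolding listening_def using n Z
  by (intro relay_listens_measurable relay_past_measurable C UH) auto

lemma relay_input_measurable:
  assumes C: "measurable_code C"
    and UH [measurable]: "U \<in> borel_measurable M" "H \<in> borel_measurable M" and Z: "Z \<in> M \<rightarrow>\<^sub>M seqs k"
    and n: "n < blocklength C" "n \<le> k"
  shows "(\<lambda>x. relay_input a \<rho> C m (H x) (U x) (Z x) n) \<in> borel_measurable M"
proof -
  have [measurable]: "(\<lambda>x. relay_past a \<rho> C m (H x) (U x) (Z x) n) \<in> M \<rightarrow>\<^sub>M seqs n"
    using n Z by (intro relay_past_measurable C UH) auto
  have [measurable]: "Measurable.pred M (\<lambda>x. relay_listens C n (U x) (H x) (relay_past a \<rho> C m (H x) (U x) (Z x) n))"
    "(\<lambda>x. relay_symbol C n (U x) (H x) (relay_past a \<rho> C m (H x) (U x) (Z x) n)) \<in> borel_measurable M"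
    using n by (auto intro!: relay_listens_measurable relay_symbol_measurable C)
  show ?thesis unfolding relay_input_def Let_def by measurable
qed

lemma dest_output_measurable:
  assumes C: "measurable_code C"
    and U [measurable]: "U \<in> borel_measurable M"
    and H [measurable]: "H \<in> M \<rightarrow>\<^sub>M borel \<Otimes>\<^sub>M (borel \<Otimes>\<^sub>M borel)"
    and Z: "Z \<in> M \<rightarrow>\<^sub>M seqs (blocklength C)" "Z' \<in> M \<rightarrow>\<^sub>M seqs (blocklength C)"
  shows "(\<lambda>x. dest_output a b c \<rho> C m (H x) (U x) (Z x) (Z' x)) \<in> M \<rightarrow>\<^sub>M seqs (blocklength C)"
proof -
  have eq: "dest_output a b c \<rho> C m h u z z' = (\<lambda>i\<in>{..<blocklength C}.
      snd (snd h) * of_real (\<rho> powr (c / 2)) * source_symbol C m i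
      + fst (snd h) * of_real (\<rho> powr (b / 2)) * relay_input a \<rho> C m (fst h) u z i + z' i)"
    for h u z z'
    by (simp add: dest_output_def split_beta)
  show ?thesis
    unfolding eq
  proof (rule measurable_restrict)
    fix i assume "i \<in> {..<blocklength C}"
    then have i: "i < blocklength C" by simp
    have [measurable]: "(\<lambda>x. fst (H x)) \<in> borel_measurable M" by measurable
    have [measurable]: "(\<lambda>x. relay_input a \<rho> C m (fst (H x)) (U x) (Z x) i) \<in> borel_measurable M"
      "(\<lambda>x. Z' x i) \<in> borel_measurable M"
      using i by (auto intro!: relay_input_measurable C Z seqs_component_measurable[OF Z(2)])
    show "(\<lambda>x. snd (snd (H x)) * of_real (\<rho> powr (c / 2)) * source_symbol C m i
      + fst (snd (H x)) * of_real (\<rho> powr (b / 2)) * relay_input a \<rho> C m (fst (H x)) (U x) (Z x) i + Z' x i)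
      \<in> borel_measurable M"
      by measurable
  qed
qed

section \<open>Success probability for a fixed channel\<close>

text \<open>The destination's noise is integrated innermost, so that the relay's schedule and inputs
  are constants in the inner integral.\<close>

definition success ::
  "real \<Rightarrow> real \<Rightarrow> real \<Rightarrow> real \<Rightarrow> relay_code \<Rightarrow> nat \<Rightarrow> complex \<times> complex \<times> complex \<Rightarrow> ennreal" where
  "success a b c \<rho> C m h =
     (\<integral>\<^sup>+x. \<integral>\<^sup>+z'. indicator {y. decoder C h y = m} (dest_output a b c \<rho> C m h (fst x) (snd x) z')
        \<partial>noise (blocklength C) \<partial>(relay_randomness \<Otimes>\<^sub>M noise (blocklength C)))"

text \<open>A total over messages and slots, hence \<open>num_messages C * blocklength C\<close>
  times the mean listening fraction. Of the channel it sees only \<open>h_sr\<close>; this is where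
  the relay's ignorance of the other two links enters the converse.\<close>

definition listen_time :: "real \<Rightarrow> real \<Rightarrow> relay_code \<Rightarrow> complex \<Rightarrow> ennreal" where
  "listen_time a \<rho> C h = (\<Sum>m<num_messages C. \<Sum>i<blocklength C.
     \<integral>\<^sup>+x. of_bool (listening a \<rho> C m h (fst x) (snd x) i)
        \<partial>(relay_randomness \<Otimes>\<^sub>M noise (blocklength C)))"

definition talk_time :: "real \<Rightarrow> real \<Rightarrow> relay_code \<Rightarrow> complex \<Rightarrow> ennreal" where
  "talk_time a \<rho> C h = (\<Sum>m<num_messages C. \<Sum>i<blocklength C.
     \<integral>\<^sup>+x. of_bool (\<not> listening a \<rho> C m h (fst x) (snd x) i)
        \<partial>(relay_randomness \<Otimes>\<^sub>M noise (blocklength C)))"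

lemma success_indicator_measurable:
  assumes C: "measurable_code C"
    and "H \<in> S \<rightarrow>\<^sub>M borel \<Otimes>\<^sub>M (borel \<Otimes>\<^sub>M borel)" "U \<in> borel_measurable S"
      "Z \<in> S \<rightarrow>\<^sub>M seqs (blocklength C)" "Z' \<in> S \<rightarrow>\<^sub>M seqs (blocklength C)"
  shows "(\<lambda>x. indicator {y. decoder C (H x) y = m} (dest_output a b c \<rho> C m (H x) (U x) (Z x) (Z' x)) :: ennreal)
    \<in> borel_measurable S"
proof -
  have [measurable]: "(\<lambda>x. decoder C (H x) (dest_output a b c \<rho> C m (H x) (U x) (Z x) (Z' x))) \<in> S \<rightarrow>\<^sub>M count_space UNIV"
    by (intro decoder_measurable dest_output_measurable assms)
  show ?thesis unfolding indicator_def mem_Collect_eq by measurable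
qed

lemma success_given_relay_measurable:
  assumes C: "measurable_code C"
  shows "(\<lambda>x. \<integral>\<^sup>+z'. indicator {y. decoder C h y = m} (dest_output a b c \<rho> C m h (fst x) (snd x) z') \<partial>noise (blocklength C))
    \<in> borel_measurable (relay_randomness \<Otimes>\<^sub>M noise (blocklength C))"
proof -
  have "(\<lambda>x. indicator {y. decoder C h y = m} (dest_output a b c \<rho> C m h (fst (fst x)) (snd (fst x)) (snd x)) :: ennreal)
      \<in> borel_measurable ((relay_randomness \<Otimes>\<^sub>M noise (blocklength C)) \<Otimes>\<^sub>M noise (blocklength C))"
    by (rule success_indicator_measurable[OF C, where H = "\<lambda>_. h"]) (auto simp: space_pair_measure)
  from noise.borel_measurable_nn_integral_fst[OF this] show ?thesis by simp
qed

lemma (in prob_space) nn_integral_add_double_sum: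
  fixes f :: "nat \<Rightarrow> nat \<Rightarrow> 'a \<Rightarrow> ennreal"
  assumes "\<And>m i. i < l \<Longrightarrow> f m i \<in> borel_measurable M"
  shows "(\<integral>\<^sup>+x. w + (\<Sum>m<k. \<Sum>i<l. f m i x) \<partial>M) = w + (\<Sum>m<k. \<Sum>i<l. \<integral>\<^sup>+x. f m i x \<partial>M)"
proof -
  have "(\<integral>\<^sup>+x. (\<Sum>i<l. f m i x) \<partial>M) = (\<Sum>i<l. \<integral>\<^sup>+x. f m i x \<partial>M)" for m
    using assms by (intro nn_integral_sum) auto
  moreover have "(\<integral>\<^sup>+x. (\<Sum>m<k. \<Sum>i<l. f m i x) \<partial>M) = (\<Sum>m<k. \<integral>\<^sup>+x. (\<Sum>i<l. f m i x) \<partial>M)"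
    using assms by (intro nn_integral_sum borel_measurable_sum) auto
  ultimately show ?thesis
    using assms by (subst nn_integral_add) (auto simp: emeasure_space_1 intro!: borel_measurable_sum)
qed

lemma source_power_le:
  assumes "admissible_code a \<rho> C"
  shows "(\<Sum>m<num_messages C. \<Sum>i<blocklength C. ennreal ((cmod (source_symbol C m i))\<^sup>2))
    \<le> ennreal (real (num_messages C * blocklength C))"
proof -
  have "(\<Sum>m<num_messages C. \<Sum>i<blocklength C. (cmod (source_symbol C m i))\<^sup>2)
      \<le> real (num_messages C * blocklength C)"
    using assms by (auto simp: admissible_code_def source_power_ok_def divide_simps split: if_splits)
  then show ?thesis by (simp add: ennreal_leI sum_nonneg)
qed

lemma relay_power_le:
  assumes "admissible_code a \<rho> C"
  shows "(\<Sum>m<num_messages C. \<Sum>i<blocklength C. \<integral>\<^sup>+x. ennreal ((cmod (relay_input a \<rho> C m h (fst x) (snd x) i))\<^sup>2)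
            \<partial>(relay_randomness \<Otimes>\<^sub>M noise (blocklength C)))
    \<le> ennreal (real (num_messages C * blocklength C))"
proof -
  let ?X = "(\<Sum>m<num_messages C. \<Sum>i<blocklength C. \<integral>\<^sup>+x. ennreal ((cmod (relay_input a \<rho> C m h (fst x) (snd x) i))\<^sup>2)
            \<partial>(relay_randomness \<Otimes>\<^sub>M noise (blocklength C)))"
  define K where "K = ennreal (real (num_messages C * blocklength C))"
  have "K \<noteq> 0" "K \<noteq> \<top>" using assms by (auto simp: admissible_code_def K_def)
  then have K: "inverse K * K = 1"
    using ennreal_divide_self[of K] by (simp add: divide_ennreal_def mult.commute less_top)
  have "?X / K \<le> 1"
    using assms by (simp add: admissible_code_def relay_power_ok_def split_beta' K_def)
  then have "?X / K * K \<le> 1 * K" by (intro mult_right_mono) auto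
  then have "?X \<le> K" by (simp add: divide_ennreal_def mult.assoc K)
  then show ?thesis by (simp add: K_def)
qed

lemma listen_plus_talk:
  assumes "measurable_code C"
  shows "listen_time a \<rho> C h + talk_time a \<rho> C h = ennreal (real (num_messages C * blocklength C))"
proof -
  let ?P = "relay_randomness \<Otimes>\<^sub>M noise (blocklength C)"
  have "(\<integral>\<^sup>+x. of_bool (listening a \<rho> C m h (fst x) (snd x) i) \<partial>?P)
      + (\<integral>\<^sup>+x. of_bool (\<not> listening a \<rho> C m h (fst x) (snd x) i) \<partial>?P) = 1"
    if i: "i < blocklength C" for m i
  proof -
    have [measurable]: "Measurable.pred ?P (\<lambda>x. listening a \<rho> C m h (fst x) (snd x) i)"
      using i by (intro listening_measurable[where k = "blocklength C"] assms) (auto intro: less_imp_le)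
    have "(\<integral>\<^sup>+x. of_bool (listening a \<rho> C m h (fst x) (snd x) i) \<partial>?P)
      + (\<integral>\<^sup>+x. of_bool (\<not> listening a \<rho> C m h (fst x) (snd x) i) \<partial>?P)
      = (\<integral>\<^sup>+x. of_bool (listening a \<rho> C m h (fst x) (snd x) i)
            + of_bool (\<not> listening a \<rho> C m h (fst x) (snd x) i) \<partial>?P)"
      unfolding of_bool_def by (intro nn_integral_add[symmetric]) measurable
    also have "\<dots> = (\<integral>\<^sup>+x. 1 \<partial>?P)" by (intro nn_integral_cong) auto
    also have "\<dots> = 1" by (simp add: rrn.P.emeasure_space_1)
    finally show ?thesis .
  qed
  then show ?thesis
    by (simp add: listen_time_def talk_time_def sum.distrib[symmetric] ennreal_of_nat_eq_real_of_nat flip: ennreal_mult)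
qed

text \<open>The right side equals \<open>1 / pi\<close>, the maximum of \<open>gauss 1\<close>. So
  the law of variance \<open>v\<close> dominates an output density up to a factor whose logarithm is
  \<open>ln v\<close> plus the normalised energy of \<open>y\<close>.\<close>

lemma gauss_le: "0 < v \<Longrightarrow> gauss 1 y' \<le> exp ((cmod y)\<^sup>2 / v) * v * gauss v y"
  by (simp add: gauss_def exp_minus field_simps)

lemma norm_add_sq_le: "(cmod (x + y))\<^sup>2 \<le> 2 * (cmod x)\<^sup>2 + 2 * (cmod y)\<^sup>2"
proof -
  have "(cmod (x + y))\<^sup>2 \<le> (cmod x + cmod y)\<^sup>2"
    by (intro power_mono norm_triangle_ineq) auto
  also have "\<dots> \<le> 2 * (cmod x)\<^sup>2 + 2 * (cmod y)\<^sup>2"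
    using zero_le_power2[of "cmod x - cmod y"] by (simp add: power2_eq_square algebra_simps)
  finally show ?thesis .
qed

lemma norm_add3_sq_le: "(cmod (x + y + z))\<^sup>2 \<le> 3 * (cmod x)\<^sup>2 + 3 * (cmod y)\<^sup>2 + 3 * (cmod z)\<^sup>2"
proof -
  have "cmod (x + y + z) \<le> cmod x + cmod y + cmod z"
    by (meson norm_triangle_ineq norm_triangle_le add_right_mono order_trans)
  then have "(cmod (x + y + z))\<^sup>2 \<le> (cmod x + cmod y + cmod z)\<^sup>2"
    by (intro power_mono) auto
  also have "\<dots> \<le> 3 * (cmod x)\<^sup>2 + 3 * (cmod y)\<^sup>2 + 3 * (cmod z)\<^sup>2"
    using zero_le_power2[of "cmod x - cmod y"] zero_le_power2[of "cmod x - cmod z"]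
      zero_le_power2[of "cmod y - cmod z"] by (simp add: power2_eq_square algebra_simps)
  finally show ?thesis .
qed

lemma dest_output_eq_shifted:
  "dest_output a b c \<rho> C m (h1, h2, h3) u z z' = shifted (\<lambda>i _. h3 * of_real (\<rho> powr (c / 2)) * source_symbol C m i
     + h2 * of_real (\<rho> powr (b / 2)) * relay_input a \<rho> C m h1 u z i) z' (blocklength C)"
  by (auto simp: dest_output_def shifted_const fun_eq_iff algebra_simps)

lemma scaled_norm_sq:
  "0 < \<rho> \<Longrightarrow> (cmod (h * of_real (\<rho> powr (c / 2)) * x))\<^sup>2 = (cmod h)\<^sup>2 * \<rho> powr c * (cmod x)\<^sup>2"
proof -
  assume "0 < \<rho>"
  then have "(\<rho> powr (c / 2))\<^sup>2 = \<rho> powr c" by (simp add: power2_eq_square flip: powr_add)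
  then show ?thesis by (simp add: norm_mult power_mult_distrib)
qed

text \<open>
  The relay's schedule is unknown to the destination; since it amounts to one bit per symbol,
  the message-independent output law is taken as a mixture of the two variances.
\<close>

lemma success_bound_given_relay:
  assumes C: "admissible_code a \<rho> C" and L: "0 < L" and \<rho>: "0 < \<rho>"
    and v: "1 \<le> v" "v \<le> v'" "(cmod h3)\<^sup>2 * \<rho> powr c \<le> v" "(cmod h2)\<^sup>2 * \<rho> powr b \<le> v'"
  defines "N \<equiv> blocklength C"
  shows "(\<Sum>m<num_messages C. \<integral>\<^sup>+z'. indicator {y. decoder C (h1, h2, h3) y = m}
            (dest_output a b c \<rho> C m (h1, h2, h3) u z z') \<partial>noise N)
    \<le> ennreal (exp L) + (\<Sum>m<num_messages C. \<Sum>i<N. ennreal (1 / L) *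
         (ennreal (ln (2 * v)) * of_bool (listening a \<rho> C m h1 u z i)
          + ennreal (ln (2 * v')) * of_bool (\<not> listening a \<rho> C m h1 u z i)
          + 3 * ennreal ((cmod (source_symbol C m i))\<^sup>2)
          + 3 * ennreal ((cmod (relay_input a \<rho> C m h1 u z i))\<^sup>2) + 6))"
proof -
  define x where "x m i = source_symbol C m i" for m i
  define r where "r m i = relay_input a \<rho> C m h1 u z i" for m i
  define l where "l m i \<longleftrightarrow> listening a \<rho> C m h1 u z i" for m i
  define \<xi> where "\<xi> m i = h3 * of_real (\<rho> powr (c / 2)) * x m i + h2 * of_real (\<rho> powr (b / 2)) * r m i" for m i
  define V where "V m i = (if l m i then v else v')" for m i
  \<comment> \<open>The logarithm of the density ratio; the factor 2 undoes the weight 1/2 of the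
    matching component of the mixture.\<close>
  define cost where "cost m i y = ln (2 * V m i) + (cmod y)\<^sup>2 / V m i" for m i and y :: complex
  have meas: "measurable_code C" using C by (simp add: admissible_code_def)
  have V1: "1 \<le> V m i" "v \<le> V m i" for m i using v by (auto simp: V_def)
  have [measurable]: "decoder C (h1, h2, h3) \<in> seqs N \<rightarrow>\<^sub>M count_space UNIV"
    unfolding N_def by (rule decoder_measurable[OF meas]) auto
  have eq: "dest_output a b c \<rho> C m (h1, h2, h3) u z z' = shifted (\<lambda>i _. \<xi> m i) z' N" for m z'
    unfolding \<xi>_def x_def r_def N_def by (rule dest_output_eq_shifted)
  have "(\<Sum>m<num_messages C. \<integral>\<^sup>+z'. indicator {y. decoder C (h1, h2, h3) y = m}
            (dest_output a b c \<rho> C m (h1, h2, h3) u z z') \<partial>noise N)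
    \<le> ennreal (exp L) + (\<Sum>m<num_messages C. \<integral>\<^sup>+z'. ennreal ((\<Sum>i<N. cost m i (shifted (\<lambda>i _. \<xi> m i) z' N i)) / L) \<partial>noise N)"
    unfolding eq
  proof (rule causal_success_bound[where \<kappa> = "\<lambda>i w y. ennreal ((gauss v y + gauss v' y) / 2)"
        and c = "\<lambda>m i w y. cost m i y"])
    show "(\<integral>\<^sup>+y. ennreal ((gauss v y + gauss v' y) / 2) \<partial>lborel) \<le> 1"
    proof -
      have "(\<integral>\<^sup>+y. ennreal ((gauss v y + gauss v' y) / 2) \<partial>lborel)
        = (\<integral>\<^sup>+y. ennreal (1 / 2) * (ennreal (gauss v y) + ennreal (gauss v' y)) \<partial>lborel)"
      proof (rule nn_integral_cong)
        fix y
        have "ennreal ((gauss v y + gauss v' y) / 2) = ennreal (1 / 2 * (gauss v y + gauss v' y))" by simp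
        also have "\<dots> = ennreal (1 / 2) * ennreal (gauss v y + gauss v' y)"
          using v by (intro ennreal_mult) auto
        also have "ennreal (gauss v y + gauss v' y) = ennreal (gauss v y) + ennreal (gauss v' y)"
          using v by (intro ennreal_plus) auto
        finally show "ennreal ((gauss v y + gauss v' y) / 2)
          = ennreal (1 / 2) * (ennreal (gauss v y) + ennreal (gauss v' y))" .
      qed
      also have "\<dots> = ennreal (1 / 2) * (1 + 1)"
        using v by (simp add: nn_integral_cmult nn_integral_add nn_integral_gauss)
      also have "\<dots> = ennreal ((1 / 2) * 2)" by (subst ennreal_mult) auto
      finally show ?thesis by simp
    qed
    fix m i and w :: "nat \<Rightarrow> complex" and y :: complex
    show "0 \<le> cost m i y"
      using V1[of m i] unfolding cost_def by (intro add_nonneg_nonneg) auto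
    have "gauss 1 (y - \<xi> m i) \<le> exp ((cmod y)\<^sup>2 / V m i) * V m i * gauss (V m i) y"
      using V1[of m i] by (intro gauss_le) auto
    also have "\<dots> \<le> exp ((cmod y)\<^sup>2 / V m i) * V m i * (gauss v y + gauss v' y)"
      using V1[of m i] v by (intro mult_left_mono) (auto simp: V_def)
    also have "\<dots> = exp (cost m i y) * ((gauss v y + gauss v' y) / 2)"
      using V1[of m i] by (simp add: cost_def exp_add)
    finally show "ennreal (gauss 1 (y - \<xi> m i)) \<le> ennreal (exp (cost m i y)) * ennreal ((gauss v y + gauss v' y) / 2)"
      using v by (simp add: ennreal_leI flip: ennreal_mult)
  qed (use L in \<open>auto simp: cost_def\<close>)
  also have "(\<Sum>m<num_messages C. \<integral>\<^sup>+z'. ennreal ((\<Sum>i<N. cost m i (shifted (\<lambda>i _. \<xi> m i) z' N i)) / L) \<partial>noise N)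
    \<le> (\<Sum>m<num_messages C. \<Sum>i<N. ennreal (1 / L) *
         (ennreal (ln (2 * v)) * of_bool (l m i) + ennreal (ln (2 * v')) * of_bool (\<not> l m i)
          + 3 * ennreal ((cmod (x m i))\<^sup>2) + 3 * ennreal ((cmod (r m i))\<^sup>2) + 6))"
  proof (rule sum_mono)
    fix m
    define K where "K i = ln (2 * V m i) + 3 * (cmod (x m i))\<^sup>2 + 3 * (cmod (r m i))\<^sup>2" for i
    have K0: "0 \<le> K i" for i using V1[of m i] by (auto simp: K_def)
    \<comment> \<open>Division by \<open>V m i\<close> normalises the received energy, so symbols
      and noise contribute only bounded multiples of their own energies. In a listening slot the
      relay's input is \<open>0\<close>, and the smaller variance \<open>v\<close> is
      enough.\<close>
    have le: "cost m i (y + \<xi> m i) \<le> K i + 3 * (cmod y)\<^sup>2" for i y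
    proof -
      have "(cmod (y + \<xi> m i))\<^sup>2 = (cmod (h3 * of_real (\<rho> powr (c / 2)) * x m i
           + h2 * of_real (\<rho> powr (b / 2)) * r m i + y))\<^sup>2"
        by (simp add: \<xi>_def add.commute)
      also have "\<dots> \<le> 3 * ((cmod h3)\<^sup>2 * \<rho> powr c * (cmod (x m i))\<^sup>2)
          + 3 * ((cmod h2)\<^sup>2 * \<rho> powr b * (cmod (r m i))\<^sup>2) + 3 * (cmod y)\<^sup>2"
        using norm_add3_sq_le scaled_norm_sq[OF \<rho>] by metis
      also have "\<dots> \<le> 3 * (V m i * (cmod (x m i))\<^sup>2) + 3 * (V m i * (cmod (r m i))\<^sup>2) + 3 * (V m i * (cmod y)\<^sup>2)"
      proof (intro add_mono mult_left_mono)
        show "(cmod h3)\<^sup>2 * \<rho> powr c * (cmod (x m i))\<^sup>2 \<le> V m i * (cmod (x m i))\<^sup>2"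
          using v V1[of m i] by (intro mult_right_mono) auto
        show "(cmod h2)\<^sup>2 * \<rho> powr b * (cmod (r m i))\<^sup>2 \<le> V m i * (cmod (r m i))\<^sup>2"
          using v relay_input_listening[of a \<rho> C m h1 u z i]
          by (cases "l m i") (auto simp: V_def r_def l_def intro: mult_right_mono)
        show "(cmod y)\<^sup>2 \<le> V m i * (cmod y)\<^sup>2"
          using V1[of m i] by (simp add: mult_le_cancel_right1)
      qed auto
      also have "\<dots> = (3 * (cmod (x m i))\<^sup>2 + 3 * (cmod (r m i))\<^sup>2 + 3 * (cmod y)\<^sup>2) * V m i"
        by (simp add: algebra_simps)
      finally have "(cmod (y + \<xi> m i))\<^sup>2 / V m i \<le> 3 * (cmod (x m i))\<^sup>2 + 3 * (cmod (r m i))\<^sup>2 + 3 * (cmod y)\<^sup>2"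
        using V1[of m i] by (subst pos_divide_le_eq) auto
      then show ?thesis by (simp add: cost_def K_def)
    qed
    have "(\<integral>\<^sup>+z'. ennreal ((\<Sum>i<N. cost m i (shifted (\<lambda>i _. \<xi> m i) z' N i)) / L) \<partial>noise N)
        \<le> (\<integral>\<^sup>+z'. ennreal (1 / L) * (\<Sum>i<N. ennreal (K i) + 3 * ennreal ((cmod (z' i))\<^sup>2)) \<partial>noise N)"
    proof (rule nn_integral_mono)
      fix z'
      have "(\<Sum>i<N. cost m i (shifted (\<lambda>i _. \<xi> m i) z' N i)) / L \<le> 1 / L * (\<Sum>i<N. K i + 3 * (cmod (z' i))\<^sup>2)"
        using L le by (auto simp: divide_simps shifted_const intro!: sum_mono)
      then have "ennreal ((\<Sum>i<N. cost m i (shifted (\<lambda>i _. \<xi> m i) z' N i)) / L)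
          \<le> ennreal (1 / L * (\<Sum>i<N. K i + 3 * (cmod (z' i))\<^sup>2))"
        by (rule ennreal_leI)
      also have "\<dots> = ennreal (1 / L) * (\<Sum>i<N. ennreal (K i + 3 * (cmod (z' i))\<^sup>2))"
        using L K0 by (subst sum_ennreal, simp, intro ennreal_mult sum_nonneg) auto
      also have "(\<Sum>i<N. ennreal (K i + 3 * (cmod (z' i))\<^sup>2)) = (\<Sum>i<N. ennreal (K i) + 3 * ennreal ((cmod (z' i))\<^sup>2))"
        using K0 by (simp add: ennreal_plus ennreal_mult)
      finally show "ennreal ((\<Sum>i<N. cost m i (shifted (\<lambda>i _. \<xi> m i) z' N i)) / L)
          \<le> ennreal (1 / L) * (\<Sum>i<N. ennreal (K i) + 3 * ennreal ((cmod (z' i))\<^sup>2))" .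
    qed
    also have "\<dots> = ennreal (1 / L) * (\<Sum>i<N. ennreal (K i) + 3 * (\<integral>\<^sup>+z'. ennreal ((cmod (z' i))\<^sup>2) \<partial>noise N))"
    proof -
      have comp: "(\<lambda>z. ennreal ((cmod (z i))\<^sup>2)) \<in> borel_measurable (noise N)" if "i \<in> {..<N}" for i
        using that by (intro noise_component_sq_measurable) simp
      have "(\<integral>\<^sup>+z'. ennreal (1 / L) * (\<Sum>i<N. ennreal (K i) + 3 * ennreal ((cmod (z' i))\<^sup>2)) \<partial>noise N)
          = ennreal (1 / L) * (\<Sum>i<N. \<integral>\<^sup>+z'. ennreal (K i) + 3 * ennreal ((cmod (z' i))\<^sup>2) \<partial>noise N)"
        using comp by (subst nn_integral_cmult, simp, subst nn_integral_sum) auto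
      also have "\<dots> = ennreal (1 / L) * (\<Sum>i<N. ennreal (K i) + 3 * (\<integral>\<^sup>+z'. ennreal ((cmod (z' i))\<^sup>2) \<partial>noise N))"
      proof -
        have "(\<integral>\<^sup>+z'. ennreal (K i) + 3 * ennreal ((cmod (z' i))\<^sup>2) \<partial>noise N)
            = ennreal (K i) + 3 * (\<integral>\<^sup>+z'. ennreal ((cmod (z' i))\<^sup>2) \<partial>noise N)" if "i \<in> {..<N}" for i
          using comp[OF that] by (simp add: nn_integral_cmult nn_integral_add noise.emeasure_space_1)
        then show ?thesis by (intro arg_cong[where f = "(*) _"] sum.cong refl)
      qed
      finally show ?thesis .
    qed
    also have "\<dots> \<le> ennreal (1 / L) * (\<Sum>i<N. ennreal (K i) + 3 * 2)"
      by (intro mult_left_mono sum_mono add_mono noise_second_moment) auto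
    also have "\<dots> = (\<Sum>i<N. ennreal (1 / L) * (ennreal (ln (2 * v)) * of_bool (l m i) + ennreal (ln (2 * v')) * of_bool (\<not> l m i)
          + 3 * ennreal ((cmod (x m i))\<^sup>2) + 3 * ennreal ((cmod (r m i))\<^sup>2) + 6))"
      unfolding sum_distrib_left
    proof (intro sum.cong refl)
      fix i
      have "ennreal (K i) = ennreal (ln (2 * v)) * of_bool (l m i) + ennreal (ln (2 * v')) * of_bool (\<not> l m i)
          + 3 * ennreal ((cmod (x m i))\<^sup>2) + 3 * ennreal ((cmod (r m i))\<^sup>2)"
        unfolding K_def using v by (auto simp: V_def ennreal_plus ennreal_mult)
      then show "ennreal (1 / L) * (ennreal (K i) + 3 * 2) = ennreal (1 / L) * (ennreal (ln (2 * v)) * of_bool (l m i)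
          + ennreal (ln (2 * v')) * of_bool (\<not> l m i)
          + 3 * ennreal ((cmod (x m i))\<^sup>2) + 3 * ennreal ((cmod (r m i))\<^sup>2) + 6)"
        by simp
    qed
    finally show "(\<integral>\<^sup>+z'. ennreal ((\<Sum>i<N. cost m i (shifted (\<lambda>i _. \<xi> m i) z' N i)) / L) \<partial>noise N)
      \<le> (\<Sum>i<N. ennreal (1 / L) * (ennreal (ln (2 * v)) * of_bool (l m i) + ennreal (ln (2 * v')) * of_bool (\<not> l m i)
          + 3 * ennreal ((cmod (x m i))\<^sup>2) + 3 * ennreal ((cmod (r m i))\<^sup>2) + 6))" .
  qed
  finally show ?thesis by (simp add: x_def r_def l_def add_left_mono)
qed

text \<open>The cut around the destination: what reaches it is at most \<open>ln (2 * v)\<close> in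
  each listening slot and \<open>ln (2 * v')\<close> in each talking slot, up to constants. The 12
  is made of 3 for the source's energy, 3 for the relay's energy, both by the power constraints, and
  6 for the noise.\<close>

lemma success_le_slow_talk:
  assumes C: "admissible_code a \<rho> C" and L: "0 < L" and \<rho>: "0 < \<rho>"
    and v: "1 \<le> v" "v \<le> v'" "(cmod h3)\<^sup>2 * \<rho> powr c \<le> v" "(cmod h2)\<^sup>2 * \<rho> powr b \<le> v'"
  shows "(\<Sum>m<num_messages C. success a b c \<rho> C m (h1, h2, h3))
    \<le> ennreal (exp L) + ennreal (1 / L) * (ennreal (ln (2 * v)) * listen_time a \<rho> C h1
        + ennreal (ln (2 * v')) * talk_time a \<rho> C h1
        + 12 * ennreal (real (num_messages C * blocklength C)))"
proof -
  define N where "N = blocklength C"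
  define M where "M = num_messages C"
  define P where "P = relay_randomness \<Otimes>\<^sub>M noise N"
  define K where "K = ennreal (real (M * N))"
  have P1: "emeasure P (space P) = 1" by (simp add: P_def rrn.P.emeasure_space_1)
  have meas: "measurable_code C" using C by (simp add: admissible_code_def)
  let ?l = "\<lambda>m x i. listening a \<rho> C m h1 (fst x) (snd x) i"
  let ?r = "\<lambda>m x i. (cmod (relay_input a \<rho> C m h1 (fst x) (snd x) i))\<^sup>2"
  let ?x = "\<lambda>m i. (cmod (source_symbol C m i))\<^sup>2"
  have l_meas: "(\<lambda>x. of_bool (?l m x i) :: ennreal) \<in> borel_measurable P"
    "(\<lambda>x. of_bool (\<not> ?l m x i) :: ennreal) \<in> borel_measurable P" if "i < N" for m i
  proof -
    have [measurable]: "Measurable.pred P (\<lambda>x. ?l m x i)"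
      using that unfolding P_def N_def
      by (intro listening_measurable[where k = "blocklength C"] meas) (auto intro: less_imp_le)
    show "(\<lambda>x. of_bool (?l m x i) :: ennreal) \<in> borel_measurable P"
      "(\<lambda>x. of_bool (\<not> ?l m x i) :: ennreal) \<in> borel_measurable P"
      unfolding of_bool_def by measurable
  qed
  have r_meas: "(\<lambda>x. ennreal (?r m x i)) \<in> borel_measurable P" if "i < N" for m i
  proof -
    have [measurable]: "(\<lambda>x. relay_input a \<rho> C m h1 (fst x) (snd x) i) \<in> borel_measurable P"
      using that unfolding P_def N_def
      by (intro relay_input_measurable[where k = "blocklength C"] meas) (auto intro: less_imp_le)
    show ?thesis by measurable
  qed
  have dec: "(\<lambda>x. \<integral>\<^sup>+z'. indicator {y. decoder C (h1, h2, h3) y = m}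
        (dest_output a b c \<rho> C m (h1, h2, h3) (fst x) (snd x) z') \<partial>noise N) \<in> borel_measurable P" for m
    unfolding P_def N_def by (rule success_given_relay_measurable[OF meas])
  have "(\<Sum>m<M. success a b c \<rho> C m (h1, h2, h3))
     = (\<integral>\<^sup>+x. (\<Sum>m<M. \<integral>\<^sup>+z'. indicator {y. decoder C (h1, h2, h3) y = m}
        (dest_output a b c \<rho> C m (h1, h2, h3) (fst x) (snd x) z') \<partial>noise N) \<partial>P)"
    unfolding success_def N_def[symmetric] P_def[symmetric] using dec by (simp add: nn_integral_sum)
  also have "\<dots> \<le> (\<integral>\<^sup>+x. ennreal (exp L) + (\<Sum>m<M. \<Sum>i<N. ennreal (1 / L) *
         (ennreal (ln (2 * v)) * of_bool (?l m x i) + ennreal (ln (2 * v')) * of_bool (\<not> ?l m x i)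
          + 3 * ennreal (?x m i) + 3 * ennreal (?r m x i) + 6)) \<partial>P)"
    unfolding N_def M_def by (intro nn_integral_mono success_bound_given_relay C L \<rho> v)
  also have "\<dots> = ennreal (exp L) + (\<Sum>m<M. \<Sum>i<N. ennreal (1 / L) *
         (ennreal (ln (2 * v)) * (\<integral>\<^sup>+x. of_bool (?l m x i) \<partial>P)
          + ennreal (ln (2 * v')) * (\<integral>\<^sup>+x. of_bool (\<not> ?l m x i) \<partial>P)
          + 3 * ennreal (?x m i) + 3 * (\<integral>\<^sup>+x. ennreal (?r m x i) \<partial>P) + 6))"
  proof -
    have meas_i: "(\<lambda>x. ennreal (1 / L) *
         (ennreal (ln (2 * v)) * of_bool (?l m x i) + ennreal (ln (2 * v')) * of_bool (\<not> ?l m x i)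
          + 3 * ennreal (?x m i) + 3 * ennreal (?r m x i) + 6)) \<in> borel_measurable P" if "i < N" for m i
    proof -
      note [measurable] = l_meas[OF that] r_meas[OF that]
      show ?thesis by measurable
    qed
    have int_i: "(\<integral>\<^sup>+x. ennreal (1 / L) *
         (ennreal (ln (2 * v)) * of_bool (?l m x i) + ennreal (ln (2 * v')) * of_bool (\<not> ?l m x i)
          + 3 * ennreal (?x m i) + 3 * ennreal (?r m x i) + 6) \<partial>P) = ennreal (1 / L) *
         (ennreal (ln (2 * v)) * (\<integral>\<^sup>+x. of_bool (?l m x i) \<partial>P)
          + ennreal (ln (2 * v')) * (\<integral>\<^sup>+x. of_bool (\<not> ?l m x i) \<partial>P)
          + 3 * ennreal (?x m i) + 3 * (\<integral>\<^sup>+x. ennreal (?r m x i) \<partial>P) + 6)" if "i < N" for m i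
    proof -
      note [measurable] = l_meas[OF that] r_meas[OF that]
      show ?thesis using r_meas[OF that] by (simp add: nn_integral_add nn_integral_cmult P1)
    qed
    note rrn.P.nn_integral_add_double_sum[where n = N and l = N and k = M and w = "ennreal (exp L)", folded P_def, OF meas_i]
    also have "(\<Sum>m<M. \<Sum>i<N. \<integral>\<^sup>+x. ennreal (1 / L) *
         (ennreal (ln (2 * v)) * of_bool (?l m x i) + ennreal (ln (2 * v')) * of_bool (\<not> ?l m x i)
          + 3 * ennreal (?x m i) + 3 * ennreal (?r m x i) + 6) \<partial>P)
      = (\<Sum>m<M. \<Sum>i<N. ennreal (1 / L) *
         (ennreal (ln (2 * v)) * (\<integral>\<^sup>+x. of_bool (?l m x i) \<partial>P)
          + ennreal (ln (2 * v')) * (\<integral>\<^sup>+x. of_bool (\<not> ?l m x i) \<partial>P)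
          + 3 * ennreal (?x m i) + 3 * (\<integral>\<^sup>+x. ennreal (?r m x i) \<partial>P) + 6))"
      by (intro sum.cong refl int_i) simp
    finally show ?thesis .
  qed
  also have "\<dots> = ennreal (exp L) + ennreal (1 / L) *
      (ennreal (ln (2 * v)) * listen_time a \<rho> C h1 + ennreal (ln (2 * v')) * talk_time a \<rho> C h1
       + 3 * (\<Sum>m<M. \<Sum>i<N. ennreal (?x m i)) + 3 * (\<Sum>m<M. \<Sum>i<N. \<integral>\<^sup>+x. ennreal (?r m x i) \<partial>P)
       + 6 * K)"
  proof -
    have "6 * K = (\<Sum>m<M. \<Sum>i<N. 6)"
      by (simp add: K_def ennreal_of_nat_eq_real_of_nat ennreal_mult mult_ac)
    then show ?thesis
      by (simp add: listen_time_def talk_time_def sum.distrib sum_distrib_left[symmetric] flip: N_def M_def P_def)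
  qed
  also have "\<dots> \<le> ennreal (exp L) + ennreal (1 / L) *
      (ennreal (ln (2 * v)) * listen_time a \<rho> C h1 + ennreal (ln (2 * v')) * talk_time a \<rho> C h1
       + 3 * K + 3 * K + 6 * K)"
    unfolding K_def N_def M_def P_def
    by (intro add_mono mult_left_mono order_refl source_power_le[OF C] relay_power_le[OF C]) auto
  also have "\<dots> = ennreal (exp L) + ennreal (1 / L) *
      (ennreal (ln (2 * v)) * listen_time a \<rho> C h1 + ennreal (ln (2 * v')) * talk_time a \<rho> C h1 + 12 * K)"
    by (simp add: add.assoc flip: distrib_right)
  finally show ?thesis
    unfolding M_def N_def K_def .
qed

section \<open>Relay and destination outputs as one sequence\<close>

lemma sum_lessThan_plus:
  fixes f :: "nat \<Rightarrow> 'a::comm_monoid_add"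
  shows "(\<Sum>j<n + k. f j) = (\<Sum>j<n. f j) + (\<Sum>i<k. f (n + i))"
  by (induction k) (simp_all add: add.assoc)

lemma shifted_cong_shift:
  "(\<And>i w. i < n \<Longrightarrow> s i w = s' i w) \<Longrightarrow> shifted s z n = shifted s' z n"
  by (induction n) (auto simp: Let_def)

lemma shifted_in_space: "shifted s z n \<in> PiE {..<n} (\<lambda>_. UNIV)"
  by (induction n) (auto simp: Let_def PiE_def extensional_def)

text \<open>
  A single sequence of \<open>2 N\<close> outputs: first those at the relay, in listening slots with the signal,
  otherwise pure noise; then those at the destination. The shift depends only on earlier outputs.
\<close>

definition chain_shift ::
  "real \<Rightarrow> real \<Rightarrow> real \<Rightarrow> real \<Rightarrow> relay_code \<Rightarrow> complex \<times> complex \<times> complex \<Rightarrow> real \<Rightarrow> nat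
    \<Rightarrow> nat \<Rightarrow> (nat \<Rightarrow> complex) \<Rightarrow> complex" where
  "chain_shift a b c \<rho> C h u m j w =
     (if j < blocklength C then relay_shift a \<rho> C m (fst h) u j w
      else snd (snd h) * of_real (\<rho> powr (c / 2)) * source_symbol C m (j - blocklength C)
         + fst (snd h) * of_real (\<rho> powr (b / 2)) * sent C (fst h) u w (j - blocklength C))"

lemma seq_append_upd: "(seq_append n k w y)(n + k := y k) = seq_append n (Suc k) w y"
  by (auto simp: seq_append_def fun_eq_iff)

lemma seq_append_0: "w \<in> PiE {..<n} (\<lambda>_. UNIV) \<Longrightarrow> seq_append n 0 w y = w"
  by (auto simp: seq_append_def fun_eq_iff PiE_def extensional_def)

text \<open>All relay outputs may be placed before all destination outputs, although they interleave
  in time, because the relay receives nothing from the destination. Position \<open>N + k\<close>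
  then obtains the relay's input at time \<open>k\<close> from the first \<open>k\<close> entries
  through \<open>sent\<close>.\<close>

lemma shifted_chain:
  fixes a b c \<rho> h1 h2 h3 u m z z' C
  defines "N \<equiv> blocklength C"
  defines "W \<equiv> shifted (relay_shift a \<rho> C m h1 u) z N"
    and "y \<equiv> \<lambda>i. z' i + (h3 * of_real (\<rho> powr (c / 2)) * source_symbol C m i
             + h2 * of_real (\<rho> powr (b / 2)) * relay_input a \<rho> C m h1 u z i)"
    and "s \<equiv> chain_shift a b c \<rho> C (h1, h2, h3) u m"
  assumes "k \<le> N"
  shows "shifted s (seq_append N N z z') (N + k) = seq_append N k W y"
  using assms(5)
proof (induction k)
  case 0
  have "shifted s (seq_append N N z z') N = shifted (relay_shift a \<rho> C m h1 u) (seq_append N N z z') N"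
    by (rule shifted_cong_shift) (simp add: s_def N_def chain_shift_def)
  also have "\<dots> = W"
    unfolding W_def by (rule shifted_cong) (simp add: seq_append_def)
  finally show ?case
    using shifted_in_space[of "relay_shift a \<rho> C m h1 u" z N]
    by (simp add: seq_append_0 W_def)
next
  case (Suc k)
  have "sent C h1 u (seq_append N k W y) k = sent C h1 u W k"
    by (rule sent_cong) (use Suc.prems in \<open>auto simp: seq_append_def\<close>)
  also have "\<dots> = relay_input a \<rho> C m h1 u z k"
    unfolding W_def using Suc.prems by (intro relay_input_eq_sent[symmetric]) auto
  finally have sent: "sent C h1 u (seq_append N k W y) k = relay_input a \<rho> C m h1 u z k" .
  have IH: "shifted s (seq_append N N z z') (N + k) = seq_append N k W y"
    using Suc by simp
  have z: "seq_append N N z z' (N + k) = z' k"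
    using Suc.prems by (simp add: seq_append_def)
  have sk: "s (N + k) (seq_append N k W y) = h3 * of_real (\<rho> powr (c / 2)) * source_symbol C m k
             + h2 * of_real (\<rho> powr (b / 2)) * relay_input a \<rho> C m h1 u z k"
    by (simp add: s_def chain_shift_def sent flip: N_def)
  show ?case
    unfolding add_Suc_right shifted.simps Let_def IH z sk seq_append_upd[symmetric] by (simp add: y_def)
qed

lemma chain_shift_measurable:
  assumes C: "measurable_code C" and i: "i < blocklength C + blocklength C"
  shows "chain_shift a b c \<rho> C h u m i \<in> borel_measurable (seqs i)"
proof (cases "i < blocklength C")
  case True
  have [measurable]: "(\<lambda>w. heard C (fst h) u w i) \<in> seqs i \<rightarrow>\<^sub>M seqs i"
    using True by (intro heard_measurable[where k = i and Z = "\<lambda>w. w" and U = "\<lambda>_. u" and H = "\<lambda>_. fst h"] C) auto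
  have [measurable]: "Measurable.pred (seqs i) (\<lambda>w. relay_listens C i u (fst h) (heard C (fst h) u w i))"
    using True by (intro relay_listens_measurable[where U = "\<lambda>_. u" and H = "\<lambda>_. fst h"] C) auto
  show ?thesis using True unfolding chain_shift_def relay_shift_def by simp
next
  case False
  have [measurable]: "(\<lambda>w. sent C (fst h) u w (i - blocklength C)) \<in> borel_measurable (seqs i)"
    using False i by (intro sent_measurable[where k = i and Z = "\<lambda>w. w" and U = "\<lambda>_. u" and H = "\<lambda>_. fst h"] C) auto
  show ?thesis using False unfolding chain_shift_def by simp
qed

text \<open>The cut around the source: the comparison law is conditioned on the relay's outputs, as
  if the destination saw them too. The relay's input is then known and drops out, the direct link is
  no stronger than the noise and costs a constant, and only listening slots cost
  \<open>ln v\<close>. The private randomness \<open>u\<close> is fixed so that the schedule is a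
  function of the outputs.\<close>

lemma success_bound_given_randomness:
  assumes C: "admissible_code a \<rho> C" and L: "0 < L" and \<rho>: "0 < \<rho>"
    and v: "1 \<le> v" "(cmod h1)\<^sup>2 * \<rho> powr a \<le> v" "(cmod h3)\<^sup>2 * \<rho> powr c \<le> 1"
  defines "N \<equiv> blocklength C"
  shows "(\<Sum>m<num_messages C. \<integral>\<^sup>+z. \<integral>\<^sup>+z'. indicator {y. decoder C (h1, h2, h3) y = m}
            (dest_output a b c \<rho> C m (h1, h2, h3) u z z') \<partial>noise N \<partial>noise N)
    \<le> ennreal (exp L) + (\<Sum>m<num_messages C. \<Sum>i<N. ennreal (1 / L) *
         (ennreal (ln v) * (\<integral>\<^sup>+z. of_bool (listening a \<rho> C m h1 u z i) \<partial>noise N)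
          + 4 * ennreal ((cmod (source_symbol C m i))\<^sup>2) + 8))"
proof -
  define x where "x m i = source_symbol C m i" for m i
  define l where "l m i z \<longleftrightarrow> listening a \<rho> C m h1 u z i" for m i z
  define s where "s = chain_shift a b c \<rho> C (h1, h2, h3) u"
  \<comment> \<open>The decoder still reads only the second half of the sequence; the first half is
    visible to the comparison law.\<close>
  define D where "D w = decoder C (h1, h2, h3) (\<lambda>i\<in>{..<N}. w (N + i))" for w :: "nat \<Rightarrow> complex"
  define heeds where "heeds j w \<longleftrightarrow> relay_listens C j u h1 (heard C h1 u w j)" for j w
  define rel where "rel w j = h2 * of_real (\<rho> powr (b / 2)) * sent C h1 u w (j - N)" for w j
  \<comment> \<open>Three kinds of position: a listening slot gets a wide Gaussian, a relay slot
    without listening gets its exact law and so has cost \<open>0\<close>, and a destination slot is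
    centred at the relay's contribution.\<close>
  define \<kappa> where "\<kappa> j w y = ennreal (if j < N then (if heeds j w then gauss v y else gauss 1 y)
      else gauss 1 (y - rel w j))" for j w y
  define cost where "cost j w y = (if j < N then (if heeds j w then ln v + (cmod y)\<^sup>2 / v else 0)
      else (cmod (y - rel w j))\<^sup>2)" for j w y
  have meas: "measurable_code C" using C by (simp add: admissible_code_def)
  have heeds_meas [measurable]: "Measurable.pred (seqs j) (heeds j)" if "j < N" for j
  proof -
    have "(\<lambda>w. heard C h1 u w j) \<in> seqs j \<rightarrow>\<^sub>M seqs j"
      using that unfolding N_def
      by (intro heard_measurable[where k = j and Z = "\<lambda>w. w" and U = "\<lambda>_. u" and H = "\<lambda>_. h1"] meas) auto
    then show ?thesis
      unfolding heeds_def using that unfolding N_def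
      by (intro relay_listens_measurable[where U = "\<lambda>_. u" and H = "\<lambda>_. h1"] meas) auto
  qed
  have rel_meas [measurable]: "(\<lambda>w. rel w j) \<in> borel_measurable (seqs j)" if "\<not> j < N" "j < N + N" for j
  proof -
    have [measurable]: "(\<lambda>w. sent C h1 u w (j - N)) \<in> borel_measurable (seqs j)"
      using that unfolding N_def
      by (intro sent_measurable[where k = j and Z = "\<lambda>w. w" and U = "\<lambda>_. u" and H = "\<lambda>_. h1"] meas) auto
    show ?thesis unfolding rel_def by measurable
  qed
  have \<kappa>_meas: "(\<lambda>(w, y). \<kappa> j w y) \<in> borel_measurable (seqs j \<Otimes>\<^sub>M borel)" if "j < N + N" for j
  proof (cases "j < N")
    case True
    note [measurable] = heeds_meas[OF True]
    show ?thesis using True unfolding \<kappa>_def by simp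
  next
    case False
    note [measurable] = rel_meas[OF False that]
    show ?thesis using False unfolding \<kappa>_def by simp
  qed
  have cost_meas: "(\<lambda>(w, y). cost j w y) \<in> borel_measurable (seqs j \<Otimes>\<^sub>M borel)" if "j < N + N" for j
  proof (cases "j < N")
    case True
    note [measurable] = heeds_meas[OF True]
    show ?thesis using True unfolding cost_def by simp
  next
    case False
    note [measurable] = rel_meas[OF False that]
    show ?thesis using False unfolding cost_def by simp
  qed
  have s_meas: "s m i \<in> borel_measurable (seqs i)" if "i < N + N" for m i
    using that unfolding s_def N_def by (rule chain_shift_measurable[OF meas])
  have sh_meas: "(\<lambda>z. shifted (s m) z (N + N)) \<in> seqs (N + N) \<rightarrow>\<^sub>M seqs (N + N)" for m
    using s_meas by (intro shifted_measurable) auto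
  have D_meas [measurable]: "D \<in> seqs (N + N) \<rightarrow>\<^sub>M count_space UNIV"
    unfolding D_def
  proof (rule decoder_measurable[OF meas])
    show "(\<lambda>w. \<lambda>i\<in>{..<N}. w (N + i)) \<in> seqs (N + N) \<rightarrow>\<^sub>M seqs (blocklength C)"
      unfolding N_def[symmetric]
      by (rule measurable_restrict) (auto intro: measurable_component_singleton)
  qed auto
  have chain: "shifted (s m) (seq_append N N z z') (N + N)
      = seq_append N N (shifted (relay_shift a \<rho> C m h1 u) z N) (\<lambda>i. z' i + (h3 * of_real (\<rho> powr (c / 2)) * x m i
             + h2 * of_real (\<rho> powr (b / 2)) * relay_input a \<rho> C m h1 u z i))" for m z z'
    unfolding s_def N_def x_def by (rule shifted_chain[OF order_refl])
  have w_lt: "shifted (s m) (seq_append N N z z') (N + N) j = shifted (relay_shift a \<rho> C m h1 u) z N j"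
    if "j < N" for m z z' j
    unfolding chain using that by (simp add: seq_append_def)
  have w_ge: "shifted (s m) (seq_append N N z z') (N + N) (N + i) = z' i + (h3 * of_real (\<rho> powr (c / 2)) * x m i
             + h2 * of_real (\<rho> powr (b / 2)) * relay_input a \<rho> C m h1 u z i)"
    if "i < N" for m z z' i
    unfolding chain using that by (simp add: seq_append_def)
  have D_eq: "D (shifted (s m) (seq_append N N z z') (N + N))
      = decoder C (h1, h2, h3) (dest_output a b c \<rho> C m (h1, h2, h3) u z z')" for m z z'
    unfolding D_def chain dest_output_def
    by (intro arg_cong[where f = "decoder C (h1, h2, h3)"])
      (auto simp: seq_append_def N_def x_def fun_eq_iff)
  have ind_meas: "(\<lambda>z. indicator {w. D w = m} (shifted (s m) z (N + N)) :: ennreal) \<in> borel_measurable (seqs (N + N))" for m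
  proof -
    have "(\<lambda>w. indicator {w. D w = m} w :: ennreal) \<in> borel_measurable (seqs (N + N))"
      unfolding indicator_def by measurable
    from measurable_compose[OF sh_meas this] show ?thesis .
  qed
  have "(\<Sum>m<num_messages C. \<integral>\<^sup>+z. \<integral>\<^sup>+z'. indicator {y. decoder C (h1, h2, h3) y = m}
            (dest_output a b c \<rho> C m (h1, h2, h3) u z z') \<partial>noise N \<partial>noise N)
     = (\<Sum>m<num_messages C. \<integral>\<^sup>+z. indicator {w. D w = m} (shifted (s m) z (N + N)) \<partial>noise (N + N))"
    unfolding nn_integral_noise_append[OF ind_meas] by (simp add: indicator_def D_eq)
  also have "\<dots> \<le> ennreal (exp L) + (\<Sum>m<num_messages C. \<integral>\<^sup>+z. ennreal ((\<Sum>j<N + N.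
            cost j (restrict (shifted (s m) z (N + N)) {..<j}) (shifted (s m) z (N + N) j)) / L) \<partial>noise (N + N))"
  proof (rule causal_success_bound[where \<kappa> = \<kappa>])
    fix m j :: nat and w :: "nat \<Rightarrow> complex" and y :: complex
    show "(\<integral>\<^sup>+y. \<kappa> j w y \<partial>lborel) \<le> 1"
      using v nn_integral_gauss[of v] nn_integral_gauss[of 1]
        nn_integral_lborel_shift[of "\<lambda>y. ennreal (gauss 1 y)" "- rel w j"]
      by (cases "j < N"; cases "heeds j w") (auto simp: \<kappa>_def)
    show "0 \<le> cost j w y" using v by (auto simp: cost_def)
    have "gauss 1 (y - s m j w) \<le> exp (ln v + (cmod y)\<^sup>2 / v) * gauss v y"
      using gauss_le[of v "y - s m j w" y] v by (simp add: exp_add mult.commute)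
    moreover have "gauss 1 (y - s m j w) \<le> exp ((cmod (y - rel w j))\<^sup>2) * gauss 1 (y - rel w j)"
      using gauss_le[of 1 "y - s m j w" "y - rel w j"] by simp
    moreover have "s m j w = 0" if "j < N" "\<not> heeds j w"
      using that by (simp add: s_def chain_shift_def relay_shift_def N_def heeds_def)
    ultimately show "ennreal (gauss 1 (y - s m j w)) \<le> ennreal (exp (cost j w y)) * \<kappa> j w y"
      using v by (auto simp: \<kappa>_def cost_def ennreal_leI simp flip: ennreal_mult)
  qed (use L \<kappa>_meas cost_meas s_meas in auto)
  also have "(\<Sum>m<num_messages C. \<integral>\<^sup>+z. ennreal ((\<Sum>j<N + N.
            cost j (restrict (shifted (s m) z (N + N)) {..<j}) (shifted (s m) z (N + N) j)) / L) \<partial>noise (N + N))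
     \<le> (\<Sum>m<num_messages C. \<Sum>i<N. ennreal (1 / L) *
         (ennreal (ln v) * (\<integral>\<^sup>+z. of_bool (l m i z) \<partial>noise N) + 4 * ennreal ((cmod (x m i))\<^sup>2) + 8))"
  proof (rule sum_mono)
    fix m
    define F where "F z = ennreal ((\<Sum>j<N + N.
            cost j (restrict (shifted (s m) z (N + N)) {..<j}) (shifted (s m) z (N + N) j)) / L)" for z
    have "(\<lambda>w. \<Sum>j<N + N. cost j (restrict w {..<j}) (w j)) \<in> borel_measurable (seqs (N + N))"
      using cost_meas by (rule causal_cost_measurable)
    note [measurable] = measurable_compose[OF sh_meas this]
    have F_meas: "F \<in> borel_measurable (seqs (N + N))"
      unfolding F_def by measurable
    have comp: "(\<lambda>z. ennreal ((cmod (z i))\<^sup>2)) \<in> borel_measurable (noise N)" if "i \<in> {..<N}" for i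
      using that by (intro noise_component_sq_measurable) simp
    have l_meas: "(\<lambda>z. of_bool (l m i z) :: ennreal) \<in> borel_measurable (noise N)" if "i \<in> {..<N}" for i
    proof -
      have [measurable]: "Measurable.pred (noise N) (l m i)"
        using that unfolding l_def N_def
        by (intro listening_measurable[where k = "blocklength C" and U = "\<lambda>_. u" and H = "\<lambda>_. h1"] meas) auto
      show ?thesis unfolding of_bool_def by measurable
    qed
    define A where "A i z = ennreal (ln v) * of_bool (l m i z) + 4 * ennreal ((cmod (x m i))\<^sup>2)
        + 2 * ennreal ((cmod (z i))\<^sup>2)" for i z
    have A_meas: "A i \<in> borel_measurable (noise N)" if "i \<in> {..<N}" for i
      unfolding A_def using comp[OF that] l_meas[OF that] by simp
    have cost1: "cost j (restrict (shifted (s m) (seq_append N N z z') (N + N)) {..<j}) (shifted (s m) (seq_append N N z z') (N + N) j)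
        \<le> ln v * of_bool (l m j z) + 2 * (cmod (x m j))\<^sup>2 + 2 * (cmod (z j))\<^sup>2" if j: "j < N" for j z z'
    proof -
      let ?w = "shifted (s m) (seq_append N N z z') (N + N)"
      let ?W = "shifted (relay_shift a \<rho> C m h1 u) z N"
      have "heard C h1 u (restrict ?w {..<j}) j = heard C h1 u ?W j"
        using j by (intro heard_cong) (auto simp: w_lt)
      then have heeds: "heeds j (restrict ?w {..<j}) \<longleftrightarrow> l m j z"
        using j by (simp add: heeds_def l_def listening_def relay_past_eq_heard'[of j N])
      have "?w j = shifted (relay_shift a \<rho> C m h1 u) z (Suc j) j"
        using j by (simp only: w_lt shifted_stable[of j N])
      also have "\<dots> = z j + relay_shift a \<rho> C m h1 u j (shifted (relay_shift a \<rho> C m h1 u) z j)"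
        by (simp add: Let_def)
      also have "relay_shift a \<rho> C m h1 u j (shifted (relay_shift a \<rho> C m h1 u) z j)
         = (if l m j z then h1 * of_real (\<rho> powr (a / 2)) * x m j else 0)"
        by (simp add: relay_shift_def l_def listening_def x_def relay_past_eq_heard)
      finally have wj: "?w j = z j + (if l m j z then h1 * of_real (\<rho> powr (a / 2)) * x m j else 0)" .
      show ?thesis
      proof (cases "l m j z")
        case True
        have "(cmod (?w j))\<^sup>2 \<le> 2 * (cmod (z j))\<^sup>2 + 2 * ((cmod h1)\<^sup>2 * \<rho> powr a * (cmod (x m j))\<^sup>2)"
          using norm_add_sq_le[of "z j" "h1 * of_real (\<rho> powr (a / 2)) * x m j"] True
          by (simp only: wj if_True scaled_norm_sq[OF \<rho>])
        also have "\<dots> \<le> 2 * (v * (cmod (z j))\<^sup>2) + 2 * (v * (cmod (x m j))\<^sup>2)"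
          using v by (intro add_mono mult_left_mono mult_right_mono) (auto simp: mult_le_cancel_right1)
        also have "\<dots> = (2 * (cmod (x m j))\<^sup>2 + 2 * (cmod (z j))\<^sup>2) * v" by (simp add: algebra_simps)
        finally have "(cmod (?w j))\<^sup>2 / v \<le> 2 * (cmod (x m j))\<^sup>2 + 2 * (cmod (z j))\<^sup>2"
          using v by (subst pos_divide_le_eq) auto
        then show ?thesis using True j by (simp add: cost_def heeds)
      next
        case False
        then show ?thesis using j by (simp add: cost_def heeds)
      qed
    qed
    have cost2: "cost (N + i) (restrict (shifted (s m) (seq_append N N z z') (N + N)) {..<N + i})
          (shifted (s m) (seq_append N N z z') (N + N) (N + i))
        \<le> 2 * (cmod (x m i))\<^sup>2 + 2 * (cmod (z' i))\<^sup>2" if i: "i < N" for i z z'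
    proof -
      let ?w = "shifted (s m) (seq_append N N z z') (N + N)"
      let ?W = "shifted (relay_shift a \<rho> C m h1 u) z N"
      have "sent C h1 u (restrict ?w {..<N + i}) i = sent C h1 u ?W i"
        using i by (intro sent_cong) (auto simp: w_lt)
      also have "\<dots> = relay_input a \<rho> C m h1 u z i"
        using i by (intro relay_input_eq_sent[symmetric]) auto
      finally have "?w (N + i) - rel (restrict ?w {..<N + i}) (N + i)
          = z' i + h3 * of_real (\<rho> powr (c / 2)) * x m i"
        using i by (simp add: rel_def w_ge)
      then have "cost (N + i) (restrict ?w {..<N + i}) (?w (N + i))
          \<le> 2 * (cmod (z' i))\<^sup>2 + 2 * ((cmod h3)\<^sup>2 * \<rho> powr c * (cmod (x m i))\<^sup>2)"
        using norm_add_sq_le[of "z' i" "h3 * of_real (\<rho> powr (c / 2)) * x m i"]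
        by (simp only: cost_def scaled_norm_sq[OF \<rho>]) simp
      also have "\<dots> \<le> 2 * (cmod (z' i))\<^sup>2 + 2 * (1 * (cmod (x m i))\<^sup>2)"
        using v by (intro add_mono mult_left_mono mult_right_mono) auto
      finally show ?thesis by simp
    qed
    have F_le: "F (seq_append N N z z') \<le> ennreal (1 / L) * (\<Sum>i<N. A i z + 2 * ennreal ((cmod (z' i))\<^sup>2))" for z z'
    proof -
      \<comment> \<open>Each source symbol is charged twice, at the relay and at the destination,
        hence 4 = 2 + 2.\<close>
      define B where "B i = ln v * of_bool (l m i z) + 4 * (cmod (x m i))\<^sup>2 + 2 * (cmod (z i))\<^sup>2 + 2 * (cmod (z' i))\<^sup>2" for i
      have B0: "0 \<le> B i" for i using v by (auto simp: B_def)
      have "(\<Sum>j<N + N. cost j (restrict (shifted (s m) (seq_append N N z z') (N + N)) {..<j})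
            (shifted (s m) (seq_append N N z z') (N + N) j))
          \<le> (\<Sum>j<N. ln v * of_bool (l m j z) + 2 * (cmod (x m j))\<^sup>2 + 2 * (cmod (z j))\<^sup>2)
           + (\<Sum>i<N. 2 * (cmod (x m i))\<^sup>2 + 2 * (cmod (z' i))\<^sup>2)"
        unfolding sum_lessThan_plus by (intro add_mono sum_mono cost1 cost2) auto
      also have "\<dots> = (\<Sum>i<N. B i)"
        by (simp add: B_def sum.distrib[symmetric] algebra_simps)
      finally have "F (seq_append N N z z') \<le> ennreal (1 / L * (\<Sum>i<N. B i))"
        unfolding F_def using L by (intro ennreal_leI) (simp add: divide_right_mono)
      also have "\<dots> = ennreal (1 / L) * (\<Sum>i<N. ennreal (B i))"
        using L B0 by (subst sum_ennreal, simp, intro ennreal_mult sum_nonneg) auto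
      also have "(\<Sum>i<N. ennreal (B i)) = (\<Sum>i<N. A i z + 2 * ennreal ((cmod (z' i))\<^sup>2))"
        using v by (intro sum.cong refl) (auto simp: A_def B_def ennreal_plus ennreal_mult)
      finally show ?thesis .
    qed
    have "(\<integral>\<^sup>+z. F z \<partial>noise (N + N)) = (\<integral>\<^sup>+z. \<integral>\<^sup>+z'. F (seq_append N N z z') \<partial>noise N \<partial>noise N)"
      by (rule nn_integral_noise_append[OF F_meas])
    also have "\<dots> \<le> (\<integral>\<^sup>+z. \<integral>\<^sup>+z'. ennreal (1 / L) * (\<Sum>i<N. A i z + 2 * ennreal ((cmod (z' i))\<^sup>2)) \<partial>noise N \<partial>noise N)"
      by (intro nn_integral_mono F_le)
    also have "\<dots> = (\<integral>\<^sup>+z. ennreal (1 / L) * (\<Sum>i<N. A i z + 2 * (\<integral>\<^sup>+z'. ennreal ((cmod (z' i))\<^sup>2) \<partial>noise N)) \<partial>noise N)"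
    proof (rule nn_integral_cong)
      fix z
      have "(\<integral>\<^sup>+z'. A i z + 2 * ennreal ((cmod (z' i))\<^sup>2) \<partial>noise N)
          = A i z + 2 * (\<integral>\<^sup>+z'. ennreal ((cmod (z' i))\<^sup>2) \<partial>noise N)" if "i \<in> {..<N}" for i
        using comp[OF that] by (simp add: nn_integral_cmult nn_integral_add noise.emeasure_space_1)
      then have "(\<Sum>i<N. \<integral>\<^sup>+z'. A i z + 2 * ennreal ((cmod (z' i))\<^sup>2) \<partial>noise N)
          = (\<Sum>i<N. A i z + 2 * (\<integral>\<^sup>+z'. ennreal ((cmod (z' i))\<^sup>2) \<partial>noise N))"
        by (intro sum.cong refl)
      then show "(\<integral>\<^sup>+z'. ennreal (1 / L) * (\<Sum>i<N. A i z + 2 * ennreal ((cmod (z' i))\<^sup>2)) \<partial>noise N)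
          = ennreal (1 / L) * (\<Sum>i<N. A i z + 2 * (\<integral>\<^sup>+z'. ennreal ((cmod (z' i))\<^sup>2) \<partial>noise N))"
        using comp by (subst nn_integral_cmult, simp, subst nn_integral_sum) auto
    qed
    also have "\<dots> \<le> (\<integral>\<^sup>+z. ennreal (1 / L) * (\<Sum>i<N. A i z + 2 * 2) \<partial>noise N)"
      by (intro nn_integral_mono mult_left_mono sum_mono add_mono noise_second_moment) auto
    also have "\<dots> = ennreal (1 / L) * (\<Sum>i<N. (\<integral>\<^sup>+z. A i z \<partial>noise N) + 4)"
    proof -
      have "(\<integral>\<^sup>+z. A i z + 2 * 2 \<partial>noise N) = (\<integral>\<^sup>+z. A i z \<partial>noise N) + 4" if "i \<in> {..<N}" for i
        using A_meas[OF that] by (simp add: nn_integral_add noise.emeasure_space_1)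
      then have "(\<Sum>i<N. \<integral>\<^sup>+z. A i z + 2 * 2 \<partial>noise N) = (\<Sum>i<N. (\<integral>\<^sup>+z. A i z \<partial>noise N) + 4)"
        by (intro sum.cong refl)
      then show ?thesis
        using A_meas by (subst nn_integral_cmult, simp, subst nn_integral_sum) auto
    qed
    also have "\<dots> \<le> ennreal (1 / L) * (\<Sum>i<N. ennreal (ln v) * (\<integral>\<^sup>+z. of_bool (l m i z) \<partial>noise N)
        + 4 * ennreal ((cmod (x m i))\<^sup>2) + 8)"
    proof (intro mult_left_mono sum_mono)
      fix i assume i: "i \<in> {..<N}"
      have "(\<integral>\<^sup>+z. A i z \<partial>noise N) = ennreal (ln v) * (\<integral>\<^sup>+z. of_bool (l m i z) \<partial>noise N)
        + 4 * ennreal ((cmod (x m i))\<^sup>2) + 2 * (\<integral>\<^sup>+z. ennreal ((cmod (z i))\<^sup>2) \<partial>noise N)"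
        unfolding A_def using comp[OF i] l_meas[OF i]
        by (simp add: nn_integral_cmult nn_integral_add noise.emeasure_space_1)
      also have "\<dots> \<le> ennreal (ln v) * (\<integral>\<^sup>+z. of_bool (l m i z) \<partial>noise N)
        + 4 * ennreal ((cmod (x m i))\<^sup>2) + 2 * 2"
        using i by (intro add_mono mult_left_mono noise_second_moment) auto
      finally show "(\<integral>\<^sup>+z. A i z \<partial>noise N) + 4 \<le> ennreal (ln v) * (\<integral>\<^sup>+z. of_bool (l m i z) \<partial>noise N)
        + 4 * ennreal ((cmod (x m i))\<^sup>2) + 8"
        by (drule_tac add_right_mono[where c = 4]) (simp add: add.assoc)
    qed auto
    finally show "(\<integral>\<^sup>+z. ennreal ((\<Sum>j<N + N.
            cost j (restrict (shifted (s m) z (N + N)) {..<j}) (shifted (s m) z (N + N) j)) / L) \<partial>noise (N + N))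
        \<le> (\<Sum>i<N. ennreal (1 / L) * (ennreal (ln v) * (\<integral>\<^sup>+z. of_bool (l m i z) \<partial>noise N)
            + 4 * ennreal ((cmod (x m i))\<^sup>2) + 8))"
      by (simp add: F_def sum_distrib_left)
  qed
  finally show ?thesis by (simp add: x_def l_def add_left_mono)
qed

text \<open>Averages the preceding bound over the private randomness. Here 12 consists of 4 for the
  source's energy and 4 for the noise at each of the two receivers.\<close>

lemma success_le_slow_listen:
  assumes C: "admissible_code a \<rho> C" and L: "0 < L" and \<rho>: "0 < \<rho>"
    and v: "1 \<le> v" "(cmod h1)\<^sup>2 * \<rho> powr a \<le> v" "(cmod h3)\<^sup>2 * \<rho> powr c \<le> 1"
  shows "(\<Sum>m<num_messages C. success a b c \<rho> C m (h1, h2, h3))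
    \<le> ennreal (exp L) + ennreal (1 / L) * (ennreal (ln v) * listen_time a \<rho> C h1
        + 12 * ennreal (real (num_messages C * blocklength C)))"
proof -
  define N where "N = blocklength C"
  define M where "M = num_messages C"
  define K where "K = ennreal (real (M * N))"
  have meas: "measurable_code C" using C by (simp add: admissible_code_def)
  let ?l = "\<lambda>m u z i. listening a \<rho> C m h1 u z i"
  let ?x = "\<lambda>m i. (cmod (source_symbol C m i))\<^sup>2"
  let ?g = "\<lambda>m u z. \<integral>\<^sup>+z'. indicator {y. decoder C (h1, h2, h3) y = m}
        (dest_output a b c \<rho> C m (h1, h2, h3) u z z') \<partial>noise N"
  have g_meas: "(\<lambda>x. ?g m (fst x) (snd x)) \<in> borel_measurable (relay_randomness \<Otimes>\<^sub>M noise N)" for m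
    unfolding N_def by (rule success_given_relay_measurable[OF meas])
  have l_meas: "(\<lambda>x. of_bool (?l m (fst x) (snd x) i) :: ennreal) \<in> borel_measurable (relay_randomness \<Otimes>\<^sub>M noise N)"
    if "i < N" for m i
  proof -
    have [measurable]: "Measurable.pred (relay_randomness \<Otimes>\<^sub>M noise N) (\<lambda>x. ?l m (fst x) (snd x) i)"
      using that unfolding N_def
      by (intro listening_measurable[where k = "blocklength C"] meas) (auto intro: less_imp_le)
    show ?thesis unfolding of_bool_def by measurable
  qed
  have l_meas': "(\<lambda>u. \<integral>\<^sup>+z. of_bool (?l m u z i) \<partial>noise N) \<in> borel_measurable relay_randomness"
    if "i < N" for m i
    using noise.borel_measurable_nn_integral_fst[OF l_meas[OF that, of m]] by simp
  have "(\<Sum>m<M. success a b c \<rho> C m (h1, h2, h3)) = (\<Sum>m<M. \<integral>\<^sup>+u. \<integral>\<^sup>+z. ?g m u z \<partial>noise N \<partial>relay_randomness)"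
    unfolding success_def N_def[symmetric]
    using noise.nn_integral_fst[OF g_meas] by simp
  also have "\<dots> = (\<integral>\<^sup>+u. (\<Sum>m<M. \<integral>\<^sup>+z. ?g m u z \<partial>noise N) \<partial>relay_randomness)"
    using noise.borel_measurable_nn_integral_fst[OF g_meas] by (simp add: nn_integral_sum)
  also have "\<dots> \<le> (\<integral>\<^sup>+u. ennreal (exp L) + (\<Sum>m<M. \<Sum>i<N. ennreal (1 / L) *
         (ennreal (ln v) * (\<integral>\<^sup>+z. of_bool (?l m u z i) \<partial>noise N) + 4 * ennreal (?x m i) + 8)) \<partial>relay_randomness)"
    unfolding M_def N_def by (intro nn_integral_mono success_bound_given_randomness C L \<rho> v)
  also have "\<dots> = ennreal (exp L) + (\<Sum>m<M. \<Sum>i<N. \<integral>\<^sup>+u. ennreal (1 / L) *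
         (ennreal (ln v) * (\<integral>\<^sup>+z. of_bool (?l m u z i) \<partial>noise N) + 4 * ennreal (?x m i) + 8) \<partial>relay_randomness)"
    using l_meas' by (intro rr.nn_integral_add_double_sum) simp
  also have "\<dots> = ennreal (exp L) + (\<Sum>m<M. \<Sum>i<N. ennreal (1 / L) *
         (ennreal (ln v) * (\<integral>\<^sup>+x. of_bool (?l m (fst x) (snd x) i) \<partial>(relay_randomness \<Otimes>\<^sub>M noise N)) + 4 * ennreal (?x m i) + 8))"
  proof (intro arg_cong2[where f = "(+)"] refl sum.cong)
    fix m i assume "i \<in> {..<N}"
    then have i: "i < N" by simp
    have "(\<integral>\<^sup>+u. \<integral>\<^sup>+z. of_bool (?l m u z i) \<partial>noise N \<partial>relay_randomness)
        = (\<integral>\<^sup>+x. of_bool (?l m (fst x) (snd x) i) \<partial>(relay_randomness \<Otimes>\<^sub>M noise N))"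
      using noise.nn_integral_fst[OF l_meas[OF i, of m]] by simp
    then show "(\<integral>\<^sup>+u. ennreal (1 / L) *
         (ennreal (ln v) * (\<integral>\<^sup>+z. of_bool (?l m u z i) \<partial>noise N) + 4 * ennreal (?x m i) + 8) \<partial>relay_randomness)
      = ennreal (1 / L) *
         (ennreal (ln v) * (\<integral>\<^sup>+x. of_bool (?l m (fst x) (snd x) i) \<partial>(relay_randomness \<Otimes>\<^sub>M noise N)) + 4 * ennreal (?x m i) + 8)"
      using l_meas'[OF i, of m] rr.emeasure_space_1 by (simp add: nn_integral_cmult nn_integral_add)
  qed
  also have "\<dots> = ennreal (exp L) + ennreal (1 / L) *
      (ennreal (ln v) * listen_time a \<rho> C h1 + 4 * (\<Sum>m<M. \<Sum>i<N. ennreal (?x m i)) + 8 * K)"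
  proof -
    have "8 * K = (\<Sum>m<M. \<Sum>i<N. 8)"
      by (simp add: K_def ennreal_of_nat_eq_real_of_nat ennreal_mult mult_ac)
    then show ?thesis
      by (simp add: listen_time_def sum.distrib sum_distrib_left[symmetric] flip: N_def M_def)
  qed
  also have "\<dots> \<le> ennreal (exp L) + ennreal (1 / L) *
      (ennreal (ln v) * listen_time a \<rho> C h1 + 4 * K + 8 * K)"
    unfolding K_def N_def M_def
    by (intro add_mono mult_left_mono order_refl source_power_le[OF C]) auto
  also have "\<dots> = ennreal (exp L) + ennreal (1 / L) * (ennreal (ln v) * listen_time a \<rho> C h1 + 12 * K)"
    by (simp add: add.assoc flip: distrib_right)
  finally show ?thesis
    unfolding M_def N_def K_def .
qed

section \<open>Averaging over the fading\<close>

lemma sets_fading [measurable_cong]: "sets fading = sets (borel \<Otimes>\<^sub>M (borel \<Otimes>\<^sub>M borel))"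
  unfolding fading_def by (intro sets_pair_measure_cong sets_complex_gaussian)

lemma space_fading [simp]: "space fading = UNIV"
  by (simp add: fading_def space_pair_measure)

interpretation cg2: pair_prob_space complex_gaussian complex_gaussian
  by standard

interpretation cg3: pair_prob_space complex_gaussian "complex_gaussian \<Otimes>\<^sub>M complex_gaussian"
  by standard

lemma prob_space_fading: "prob_space fading"
  unfolding fading_def by (rule cg3.prob_space_axioms)

interpretation fad: prob_space fading
  by (rule prob_space_fading)

definition channel_randomness ::
  "relay_code \<Rightarrow> ((complex \<times> complex \<times> complex) \<times> real \<times> (nat \<Rightarrow> complex) \<times> (nat \<Rightarrow> complex)) measure" where
  "channel_randomness C =
     fading \<Otimes>\<^sub>M (relay_randomness \<Otimes>\<^sub>M (noise (blocklength C) \<Otimes>\<^sub>M noise (blocklength C)))"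

lemma prob_space_channel_randomness: "prob_space (channel_randomness C)"
  unfolding channel_randomness_def
  by (intro prob_space_pair prob_space_fading prob_space_relay_randomness prob_space_noise)

lemma decoded_measurable:
  assumes C: "measurable_code C"
  shows "(\<lambda>(h, u, z, z'). decoder C h (dest_output a b c \<rho> C m h u z z'))
     \<in> channel_randomness C \<rightarrow>\<^sub>M count_space UNIV"
  unfolding channel_randomness_def split_beta'
  by (intro decoder_measurable dest_output_measurable C) auto

definition error_event ::
  "real \<Rightarrow> real \<Rightarrow> real \<Rightarrow> real \<Rightarrow> relay_code \<Rightarrow> nat \<Rightarrow>
    ((complex \<times> complex \<times> complex) \<times> real \<times> (nat \<Rightarrow> complex) \<times> (nat \<Rightarrow> complex)) set" where
  "error_event a b c \<rho> C m = {x \<in> space (channel_randomness C).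
     case x of (h, u, z, z') \<Rightarrow> decoder C h (dest_output a b c \<rho> C m h u z z') \<noteq> m}"

lemma error_prob_eq:
  "error_prob a b c \<rho> C
    = (\<Sum>m<num_messages C. measure (channel_randomness C) (error_event a b c \<rho> C m)) / real (num_messages C)"
proof -
  have "{(h, u, z, z'). (h, u, z, z') \<in> space (channel_randomness C) \<and>
      decoder C h (dest_output a b c \<rho> C m h u z z') \<noteq> m} = error_event a b c \<rho> C m" for m
    by (auto simp: error_event_def)
  then show ?thesis unfolding error_prob_def channel_randomness_def[symmetric] by (simp only:)
qed

lemma emeasure_success:
  assumes C: "measurable_code C"
  shows "emeasure (channel_randomness C) {x \<in> space (channel_randomness C).
       case x of (h, u, z, z') \<Rightarrow> decoder C h (dest_output a b c \<rho> C m h u z z') = m}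
     = (\<integral>\<^sup>+h. success a b c \<rho> C m h \<partial>fading)"
proof -
  let ?N = "noise (blocklength C)"
  let ?R = "relay_randomness"
  interpret NN: prob_space "?N \<Otimes>\<^sub>M ?N"
    by (intro prob_space_pair noise.prob_space_axioms)
  interpret RNN: prob_space "?R \<Otimes>\<^sub>M (?N \<Otimes>\<^sub>M ?N)"
    by (intro prob_space_pair noise.prob_space_axioms rr.prob_space_axioms)
  define I where "I h u z z' = (indicator {y. decoder C h y = m} (dest_output a b c \<rho> C m h u z z') :: ennreal)" for h u z z'
  note I_meas = success_indicator_measurable[OF C, where m = m and a = a and b = b and c = c and \<rho> = \<rho>, folded I_def]
  have I4: "(\<lambda>x. I (fst x) (fst (snd x)) (fst (snd (snd x))) (snd (snd (snd x)))) \<in> borel_measurable (channel_randomness C)"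
    unfolding channel_randomness_def by (rule I_meas) measurable
  have "{x \<in> space (channel_randomness C).
       case x of (h, u, z, z') \<Rightarrow> decoder C h (dest_output a b c \<rho> C m h u z z') = m} \<in> sets (channel_randomness C)"
    using decoded_measurable[OF C, of a b c \<rho> m] unfolding split_beta' by measurable
  then have "emeasure (channel_randomness C) {x \<in> space (channel_randomness C).
       case x of (h, u, z, z') \<Rightarrow> decoder C h (dest_output a b c \<rho> C m h u z z') = m}
     = (\<integral>\<^sup>+x. indicator {x \<in> space (channel_randomness C).
       case x of (h, u, z, z') \<Rightarrow> decoder C h (dest_output a b c \<rho> C m h u z z') = m} x \<partial>channel_randomness C)"
    by simp
  also have "\<dots> = (\<integral>\<^sup>+x. I (fst x) (fst (snd x)) (fst (snd (snd x))) (snd (snd (snd x))) \<partial>channel_randomness C)"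
    by (intro nn_integral_cong) (auto simp: I_def indicator_def)
  also have "\<dots> = (\<integral>\<^sup>+h. \<integral>\<^sup>+x. I h (fst x) (fst (snd x)) (snd (snd x)) \<partial>(?R \<Otimes>\<^sub>M (?N \<Otimes>\<^sub>M ?N)) \<partial>fading)"
    using RNN.nn_integral_fst[OF I4[unfolded channel_randomness_def]] by (simp add: channel_randomness_def)
  also have "\<dots> = (\<integral>\<^sup>+h. success a b c \<rho> C m h \<partial>fading)"
  proof (rule nn_integral_cong)
    fix h :: "complex \<times> complex \<times> complex"
    have I3: "(\<lambda>x. I h (fst x) (fst (snd x)) (snd (snd x))) \<in> borel_measurable (?R \<Otimes>\<^sub>M (?N \<Otimes>\<^sub>M ?N))"
      by (rule I_meas[where H = "\<lambda>_. h"]) (auto simp: space_pair_measure)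
    have I2: "(\<lambda>x. I h u (fst x) (snd x)) \<in> borel_measurable (?N \<Otimes>\<^sub>M ?N)" for u
      by (rule I_meas[where H = "\<lambda>_. h" and U = "\<lambda>_. u"]) (auto simp: space_pair_measure)
    have I3': "(\<lambda>x. I h (fst (fst x)) (snd (fst x)) (snd x)) \<in> borel_measurable ((?R \<Otimes>\<^sub>M ?N) \<Otimes>\<^sub>M ?N)"
      by (rule I_meas[where H = "\<lambda>_. h"]) (auto simp: space_pair_measure)
    have "(\<integral>\<^sup>+x. I h (fst x) (fst (snd x)) (snd (snd x)) \<partial>(?R \<Otimes>\<^sub>M (?N \<Otimes>\<^sub>M ?N)))
       = (\<integral>\<^sup>+u. \<integral>\<^sup>+x. I h u (fst x) (snd x) \<partial>(?N \<Otimes>\<^sub>M ?N) \<partial>?R)"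
      using NN.nn_integral_fst[OF I3] by simp
    also have "\<dots> = (\<integral>\<^sup>+u. \<integral>\<^sup>+z. \<integral>\<^sup>+z'. I h u z z' \<partial>?N \<partial>?N \<partial>?R)"
      using noise.nn_integral_fst[OF I2] by simp
    also have "\<dots> = (\<integral>\<^sup>+x. \<integral>\<^sup>+z'. I h (fst x) (snd x) z' \<partial>?N \<partial>(?R \<Otimes>\<^sub>M ?N))"
      using noise.nn_integral_fst[OF noise.borel_measurable_nn_integral_fst[OF I3']] by simp
    finally show "(\<integral>\<^sup>+x. I h (fst x) (fst (snd x)) (snd (snd x)) \<partial>(?R \<Otimes>\<^sub>M (?N \<Otimes>\<^sub>M ?N))) = success a b c \<rho> C m h"
      by (simp add: success_def I_def)
  qed
  finally show ?thesis .
qed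

lemma success_measurable:
  assumes C: "measurable_code C"
  shows "success a b c \<rho> C m \<in> borel_measurable fading"
proof -
  let ?N = "noise (blocklength C)"
  let ?P = "relay_randomness \<Otimes>\<^sub>M ?N"
  define I where "I h u z z' = (indicator {y. decoder C h y = m} (dest_output a b c \<rho> C m h u z z') :: ennreal)" for h u z z'
  have "(\<lambda>x. I (fst (fst x)) (fst (snd (fst x))) (snd (snd (fst x))) (snd x))
      \<in> borel_measurable ((fading \<Otimes>\<^sub>M ?P) \<Otimes>\<^sub>M ?N)"
    unfolding I_def by (rule success_indicator_measurable[OF C]) auto
  from noise.borel_measurable_nn_integral_fst[OF this]
  have "(\<lambda>x. \<integral>\<^sup>+z'. I (fst x) (fst (snd x)) (snd (snd x)) z' \<partial>?N) \<in> borel_measurable (fading \<Otimes>\<^sub>M ?P)"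
    by simp
  from rrn.P.borel_measurable_nn_integral_fst[OF this] show ?thesis
    by (simp add: success_def[abs_def] I_def)
qed

lemma success_le_1: "success a b c \<rho> C m h \<le> 1"
proof -
  let ?N = "noise (blocklength C)"
  let ?P = "relay_randomness \<Otimes>\<^sub>M ?N"
  have "success a b c \<rho> C m h \<le> (\<integral>\<^sup>+x. \<integral>\<^sup>+z'. 1 \<partial>?N \<partial>?P)"
    unfolding success_def by (intro nn_integral_mono) (auto simp: indicator_def)
  also have "\<dots> = 1" by (simp add: noise.emeasure_space_1 rrn.P.emeasure_space_1)
  finally show ?thesis .
qed

text \<open>Turns failure on an event into a loss of the average. In the converse \<open>f\<close>
  is the success probability summed over the messages, \<open>K\<close> their number, and
  \<open>R\<close> an event of weak links on which the share \<open>e\<close> is lost.\<close>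

lemma (in prob_space) nn_integral_le_deficit:
  assumes f: "\<And>x. f x \<le> ennreal K" "\<And>x. x \<in> R \<Longrightarrow> f x \<le> ennreal (K * (1 - e))"
    and R: "R \<in> events" "q \<le> prob R" and K: "0 \<le> K" "0 \<le> e" "e \<le> 1"
  shows "(\<integral>\<^sup>+x. f x \<partial>M) \<le> ennreal (K * (1 - e * q))"
proof -
  have "(\<integral>\<^sup>+x. f x \<partial>M) \<le> (\<integral>\<^sup>+x. ennreal (K * (1 - e)) * indicator R x + ennreal K * indicator (space M - R) x \<partial>M)"
    by (intro nn_integral_mono) (auto simp: indicator_def f)
  also have "\<dots> = ennreal (K * (1 - e)) * emeasure M R + ennreal K * emeasure M (space M - R)"
    using R by (subst nn_integral_add) (auto simp: nn_integral_cmult_indicator)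
  also have "\<dots> = ennreal (K * (1 - e) * prob R + K * (1 - prob R))"
    using R K by (simp add: emeasure_eq_measure prob_compl ennreal_mult ennreal_plus)
  also have "K * (1 - e) * prob R + K * (1 - prob R) = K * (1 - e * prob R)"
    by (simp add: algebra_simps)
  also have "ennreal (K * (1 - e * prob R)) \<le> ennreal (K * (1 - e * q))"
    using K R by (intro ennreal_leI mult_left_mono) (auto intro: mult_left_mono)
  finally show ?thesis .
qed

lemma listen_time_real:
  assumes C: "admissible_code a \<rho> C"
  obtains t where "0 \<le> t" "t \<le> 1"
    "listen_time a \<rho> C h = ennreal (real (num_messages C * blocklength C) * t)"
    "talk_time a \<rho> C h = ennreal (real (num_messages C * blocklength C) * (1 - t))"
proof -
  define K where "K = real (num_messages C * blocklength C)"
  have K: "K > 0" using C by (simp add: K_def admissible_code_def)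
  have sum: "listen_time a \<rho> C h + talk_time a \<rho> C h = ennreal K"
    unfolding K_def using C by (intro listen_plus_talk) (simp add: admissible_code_def)
  then have "listen_time a \<rho> C h < \<top>" "talk_time a \<rho> C h < \<top>"
    by (metis ennreal_add_eq_top ennreal_neq_top top.not_eq_extremum)+
  then obtain x y where xy: "x \<ge> 0" "listen_time a \<rho> C h = ennreal x" "y \<ge> 0" "talk_time a \<rho> C h = ennreal y"
    by (metis ennreal_enn2real enn2real_nonneg)
  with sum have "x + y = K" using K by (simp flip: ennreal_plus)
  with xy K have "0 \<le> x / K" "x / K \<le> 1" "listen_time a \<rho> C h = ennreal (K * (x / K))"
    "talk_time a \<rho> C h = ennreal (K * (1 - x / K))"
    by (auto simp: algebra_simps)
  then show thesis using that unfolding K_def by blast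
qed

lemma ennreal_affine:
  assumes "0 \<le> w" "0 \<le> i" "0 \<le> x" "0 \<le> y" "0 \<le> x'" "0 \<le> y'" "0 \<le> k"
  shows "ennreal w + ennreal i * (ennreal x * ennreal y + ennreal x' * ennreal y' + 12 * ennreal k)
    = ennreal (w + i * (x * y + x' * y' + 12 * k))"
  using assms by (simp add: ennreal_plus ennreal_mult)

text \<open>The mean listening fraction \<open>t\<close> is determined by \<open>h1\<close> alone.
  The listening bound grows with \<open>t\<close> and the talking bound falls, so for
  \<open>t \<le> t0\<close> the code fails on weak direct links, and otherwise on weak R-D links.
  Either event has probability at least \<open>exp (-2) * \<rho> powr (-\<beta>)\<close>, the first
  one because \<open>c \<le> \<beta>\<close>.\<close>

lemma inner_success_le:
  assumes C: "admissible_code a \<rho> C" and \<rho>: "1 < \<rho>" and c: "0 \<le> c" "c \<le> \<beta>" and L: "0 < L"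
    and t0: "0 \<le> t0" "t0 \<le> 1" and e: "0 \<le> e" "e \<le> 1"
    and listen: "exp L / real (num_messages C) + real (blocklength C) / L * (t0 * ln (1 + \<rho> powr a) + 12) \<le> 1 - e"
    and talk: "exp L / real (num_messages C) + real (blocklength C) / L *
       (t0 * ln (2 * (1 + \<rho> powr c)) + (1 - t0) * ln (2 * (1 + \<rho> powr c + \<rho> powr (b - \<beta>))) + 12) \<le> 1 - e"
    and h1: "(cmod h1)\<^sup>2 \<le> 1"
  shows "(\<integral>\<^sup>+h. (\<Sum>m<num_messages C. success a b c \<rho> C m (h1, h)) \<partial>(complex_gaussian \<Otimes>\<^sub>M complex_gaussian))
    \<le> ennreal (real (num_messages C) * (1 - e * (exp (-2) * \<rho> powr (-\<beta>))))"
proof -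
  define M where "M = real (num_messages C)"
  define N where "N = real (blocklength C)"
  have MN: "M > 0" "N > 0" using C by (auto simp: M_def N_def admissible_code_def)
  obtain t where t: "0 \<le> t" "t \<le> 1"
    "listen_time a \<rho> C h1 = ennreal (M * N * t)" "talk_time a \<rho> C h1 = ennreal (M * N * (1 - t))"
    using listen_time_real[OF C] unfolding M_def N_def of_nat_mult by blast
  have one: "(\<Sum>m<num_messages C. success a b c \<rho> C m (h1, h)) \<le> ennreal M" for h
  proof -
    have "(\<Sum>m<num_messages C. success a b c \<rho> C m (h1, h)) \<le> (\<Sum>m<num_messages C. 1)"
      by (intro sum_mono success_le_1)
    then show ?thesis by (simp add: M_def ennreal_of_nat_eq_real_of_nat)
  qed
  note S_ge = complex_gaussian_small_ball_ge
  have prob_Times: "measure (complex_gaussian \<Otimes>\<^sub>M complex_gaussian) (A \<times> B)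
      = measure complex_gaussian A * measure complex_gaussian B"
    if "A \<in> sets borel" "B \<in> sets borel" for A B
    using that by (simp add: measure_Times cg.prob_space_axioms)
  have \<beta>1: "\<rho> powr (-\<beta>) \<le> 1" "\<rho> powr (-\<beta>) \<le> \<rho> powr (-c)" "\<rho> powr (-c) \<le> 1"
    using \<rho> c powr_mono[of "-\<beta>" 0 \<rho>] powr_mono[of "-c" 0 \<rho>] powr_mono[of "-\<beta>" "-c" \<rho>] by auto
  show ?thesis
  proof (cases "t \<le> t0")
    case True
    have "(\<Sum>m<num_messages C. success a b c \<rho> C m (h1, h)) \<le> ennreal (M * (1 - e))"
      if "h \<in> UNIV \<times> punctured_ball (\<rho> powr (-c))" for h
    proof -
      obtain h2 h3 where "h = (h2, h3)" by (cases h)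
      with that have h: "h = (h2, h3)" "(cmod h3)\<^sup>2 \<le> \<rho> powr (-c)" by (auto simp: punctured_ball_def)
      have "(cmod h3)\<^sup>2 * \<rho> powr c \<le> \<rho> powr (-c) * \<rho> powr c"
        using h by (intro mult_right_mono) auto
      also have "\<dots> = 1" using \<rho> by (simp flip: powr_add)
      finally have h3: "(cmod h3)\<^sup>2 * \<rho> powr c \<le> 1" .
      have "(cmod h1)\<^sup>2 * \<rho> powr a \<le> 1 * \<rho> powr a"
        using h1 by (intro mult_right_mono) auto
      then have h1a: "(cmod h1)\<^sup>2 * \<rho> powr a \<le> 1 + \<rho> powr a" by simp
      have "(\<Sum>m<num_messages C. success a b c \<rho> C m (h1, h2, h3))
         \<le> ennreal (exp L) + ennreal (1 / L) * (ennreal (ln (1 + \<rho> powr a)) * ennreal (M * N * t) + 12 * ennreal (M * N))"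
        using success_le_slow_listen[OF C L, of "1 + \<rho> powr a" h1 h3 c b h2] \<rho> h3 h1a t
        by (simp add: M_def N_def)
      also have "\<dots> = ennreal (exp L + 1 / L * (ln (1 + \<rho> powr a) * (M * N * t) + 12 * (M * N)))"
        using ennreal_affine[of "exp L" "1 / L" "ln (1 + \<rho> powr a)" "M * N * t" 0 0 "M * N"] L MN t \<rho>
        by simp
      also have "exp L + 1 / L * (ln (1 + \<rho> powr a) * (M * N * t) + 12 * (M * N))
          = M * (exp L / M + N / L * (t * ln (1 + \<rho> powr a) + 12))"
        using MN by (simp add: field_simps)
      also have "\<dots> \<le> M * (exp L / M + N / L * (t0 * ln (1 + \<rho> powr a) + 12))"
        using True MN L by (intro mult_left_mono add_left_mono add_right_mono mult_right_mono) auto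
      also have "\<dots> \<le> M * (1 - e)"
        using listen MN by (intro mult_left_mono) (auto simp: M_def N_def)
      finally show ?thesis by (simp add: h ennreal_leI)
    qed
    moreover have "exp (-2) * \<rho> powr (-\<beta>) \<le> measure (complex_gaussian \<Otimes>\<^sub>M complex_gaussian) (UNIV \<times> punctured_ball (\<rho> powr (-c)))"
    proof -
      have "exp (-2) * \<rho> powr (-\<beta>) \<le> exp (-1) * \<rho> powr (-c)"
        using \<beta>1 by (intro mult_mono) auto
      also have "\<dots> \<le> measure complex_gaussian (punctured_ball (\<rho> powr (-c)))"
        using S_ge[of "\<rho> powr (-c)"] \<beta>1 by (simp add: mult.commute)
      finally show ?thesis using cg.prob_space by (simp add: prob_Times)
    qed
    ultimately show ?thesis
      using MN e one unfolding M_def[symmetric]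
      by (intro cg2.P.nn_integral_le_deficit[where R = "UNIV \<times> punctured_ball (\<rho> powr (-c))"]) auto
  next
    case False
    let ?v = "1 + \<rho> powr c" and ?v' = "1 + \<rho> powr c + \<rho> powr (b - \<beta>)"
    have "(\<Sum>m<num_messages C. success a b c \<rho> C m (h1, h)) \<le> ennreal (M * (1 - e))"
      if "h \<in> punctured_ball (\<rho> powr (-\<beta>)) \<times> punctured_ball 1" for h
    proof -
      obtain h2 h3 where "h = (h2, h3)" by (cases h)
      with that have h: "h = (h2, h3)" "(cmod h2)\<^sup>2 \<le> \<rho> powr (-\<beta>)" "(cmod h3)\<^sup>2 \<le> 1"
        by (auto simp: punctured_ball_def)
      have h3: "(cmod h3)\<^sup>2 * \<rho> powr c \<le> ?v"
        using h mult_right_mono[of "(cmod h3)\<^sup>2" 1 "\<rho> powr c"] by simp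
      have "(cmod h2)\<^sup>2 * \<rho> powr b \<le> \<rho> powr (-\<beta>) * \<rho> powr b"
        using h by (intro mult_right_mono) auto
      also have "\<dots> = \<rho> powr (b - \<beta>)" using \<rho> by (simp flip: powr_add)
      finally have h2: "(cmod h2)\<^sup>2 * \<rho> powr b \<le> ?v'" using \<rho> by (simp add: add_nonneg_nonneg add_increasing)
      have lnv: "0 \<le> ln (2 * ?v)" "ln (2 * ?v) \<le> ln (2 * ?v')"
        using powr_ge_zero[of \<rho> c] powr_ge_zero[of \<rho> "b - \<beta>"] by (simp_all add: add_pos_nonneg)
      have "(\<Sum>m<num_messages C. success a b c \<rho> C m (h1, h2, h3))
         \<le> ennreal (exp L) + ennreal (1 / L) * (ennreal (ln (2 * ?v)) * ennreal (M * N * t)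
            + ennreal (ln (2 * ?v')) * ennreal (M * N * (1 - t)) + 12 * ennreal (M * N))"
        using success_le_slow_talk[OF C L, of ?v ?v' h3 c h2 b h1] \<rho> h3 h2 t
        by (simp add: M_def N_def)
      also have "\<dots> = ennreal (exp L + 1 / L * (ln (2 * ?v) * (M * N * t) + ln (2 * ?v') * (M * N * (1 - t)) + 12 * (M * N)))"
        using L MN t lnv by (intro ennreal_affine) auto
      also have "exp L + 1 / L * (ln (2 * ?v) * (M * N * t) + ln (2 * ?v') * (M * N * (1 - t)) + 12 * (M * N))
          = M * (exp L / M + N / L * (t * ln (2 * ?v) + (1 - t) * ln (2 * ?v') + 12))"
        using MN by (simp add: field_simps)
      also have "\<dots> \<le> M * (exp L / M + N / L * (t0 * ln (2 * ?v) + (1 - t0) * ln (2 * ?v') + 12))"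
      proof (intro mult_left_mono add_left_mono add_right_mono)
        have "(t - t0) * ln (2 * ?v) \<le> (t - t0) * ln (2 * ?v')"
          using False lnv by (intro mult_left_mono) auto
        then show "t * ln (2 * ?v) + (1 - t) * ln (2 * ?v') \<le> t0 * ln (2 * ?v) + (1 - t0) * ln (2 * ?v')"
          by (simp add: algebra_simps)
      qed (use MN L in auto)
      also have "\<dots> \<le> M * (1 - e)"
        using talk MN by (intro mult_left_mono) (auto simp: M_def N_def)
      finally show ?thesis by (simp add: h ennreal_leI)
    qed
    moreover have "exp (-2) * \<rho> powr (-\<beta>) \<le> measure (complex_gaussian \<Otimes>\<^sub>M complex_gaussian) (punctured_ball (\<rho> powr (-\<beta>)) \<times> punctured_ball 1)"
    proof -
      have "exp (-2) * \<rho> powr (-\<beta>) = (\<rho> powr (-\<beta>) * exp (-1)) * (1 * exp (-1))"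
        by (simp flip: exp_add)
      also have "\<dots> \<le> measure complex_gaussian (punctured_ball (\<rho> powr (-\<beta>))) * measure complex_gaussian (punctured_ball 1)"
        using \<beta>1 by (intro mult_mono S_ge) auto
      finally show ?thesis by (simp add: prob_Times)
    qed
    ultimately show ?thesis
      using MN e one unfolding M_def[symmetric]
      by (intro cg2.P.nn_integral_le_deficit[where R = "punctured_ball (\<rho> powr (-\<beta>)) \<times> punctured_ball 1"]) auto
  qed
qed

text \<open>Adds the S-R link, restricted to the typical event
  \<open>(cmod h1)\<^sup>2 \<le> 1\<close>, to \<open>inner_success_le\<close>. The constant
  \<open>exp (-3)\<close> leaves room for one factor \<open>exp (-1)\<close> per link.\<close>

lemma error_prob_ge:
  assumes C: "admissible_code a \<rho> C" and \<rho>: "1 < \<rho>" and c: "0 \<le> c" "c \<le> \<beta>" and L: "0 < L"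
    and t0: "0 \<le> t0" "t0 \<le> 1" and e: "0 \<le> e" "e \<le> 1"
    and listen: "exp L / real (num_messages C) + real (blocklength C) / L * (t0 * ln (1 + \<rho> powr a) + 12) \<le> 1 - e"
    and talk: "exp L / real (num_messages C) + real (blocklength C) / L *
       (t0 * ln (2 * (1 + \<rho> powr c)) + (1 - t0) * ln (2 * (1 + \<rho> powr c + \<rho> powr (b - \<beta>))) + 12) \<le> 1 - e"
  shows "e * exp (-3) * \<rho> powr (-\<beta>) \<le> error_prob a b c \<rho> C"
proof -
  define M where "M = num_messages C"
  have M: "M > 0" using C by (simp add: M_def admissible_code_def)
  have meas: "measurable_code C" using C by (simp add: admissible_code_def)
  let ?q = "exp (-2) * \<rho> powr (-\<beta>)"
  interpret CR: prob_space "channel_randomness C" by (rule prob_space_channel_randomness)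
  define ok where "ok m = CR.prob {x \<in> space (channel_randomness C).
       case x of (h, u, z, z') \<Rightarrow> decoder C h (dest_output a b c \<rho> C m h u z z') = m}" for m
  have "\<rho> powr (-\<beta>) \<le> 1" using \<rho> c powr_mono[of "-\<beta>" 0 \<rho>] by auto
  then have q: "0 \<le> ?q" "?q \<le> 1"
    using mult_mono[of "exp (-2)" 1 "\<rho> powr (-\<beta>)" 1] by auto
  have S_meas: "(\<lambda>h. \<Sum>m<M. success a b c \<rho> C m h) \<in> borel_measurable fading"
    by (intro borel_measurable_sum success_measurable meas)
  have "(\<Sum>m<M. ennreal (ok m)) = (\<Sum>m<M. \<integral>\<^sup>+h. success a b c \<rho> C m h \<partial>fading)"
    unfolding ok_def by (simp add: emeasure_success[OF meas] flip: CR.emeasure_eq_measure)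
  also have "\<dots> = (\<integral>\<^sup>+h. (\<Sum>m<M. success a b c \<rho> C m h) \<partial>fading)"
    using success_measurable[OF meas] by (intro nn_integral_sum[symmetric]) auto
  also have "\<dots> = (\<integral>\<^sup>+h1. \<integral>\<^sup>+h. (\<Sum>m<M. success a b c \<rho> C m (h1, h)) \<partial>(complex_gaussian \<Otimes>\<^sub>M complex_gaussian) \<partial>complex_gaussian)"
    using S_meas unfolding fading_def by (intro cg2.P.nn_integral_fst[symmetric]) auto
  also have "\<dots> \<le> ennreal (real M * (1 - (e * ?q) * exp (-1)))"
  proof (rule cg.nn_integral_le_deficit[where R = "punctured_ball 1"])
    fix h1
    have "(\<Sum>m<M. success a b c \<rho> C m (h1, h)) \<le> ennreal (real M)" for h
    proof -
      have "(\<Sum>m<M. success a b c \<rho> C m (h1, h)) \<le> (\<Sum>m<M. 1)"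
        by (intro sum_mono success_le_1)
      then show ?thesis by (simp add: ennreal_of_nat_eq_real_of_nat)
    qed
    then have "(\<integral>\<^sup>+h. (\<Sum>m<M. success a b c \<rho> C m (h1, h)) \<partial>(complex_gaussian \<Otimes>\<^sub>M complex_gaussian))
        \<le> (\<integral>\<^sup>+h. ennreal (real M) \<partial>(complex_gaussian \<Otimes>\<^sub>M complex_gaussian))"
      by (intro nn_integral_mono)
    then show "(\<integral>\<^sup>+h. (\<Sum>m<M. success a b c \<rho> C m (h1, h)) \<partial>(complex_gaussian \<Otimes>\<^sub>M complex_gaussian)) \<le> ennreal (real M)"
      by (simp add: cg2.P.emeasure_space_1)
    assume "h1 \<in> punctured_ball 1"
    then show "(\<integral>\<^sup>+h. (\<Sum>m<M. success a b c \<rho> C m (h1, h)) \<partial>(complex_gaussian \<Otimes>\<^sub>M complex_gaussian))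
        \<le> ennreal (real M * (1 - e * ?q))"
      unfolding M_def using assms by (intro inner_success_le[OF C \<rho> c L t0 e listen talk]) (auto simp: punctured_ball_def)
  next
    show "exp (-1) \<le> cg.prob (punctured_ball 1)"
      using complex_gaussian_small_ball_ge[of 1] by simp
    show "0 \<le> e * ?q" "e * ?q \<le> 1" using e q mult_mono[of e 1 ?q 1] by auto
  qed auto
  finally have "(\<Sum>m<M. ok m) \<le> real M * (1 - (e * ?q) * exp (-1))"
  proof -
    assume le: "(\<Sum>m<M. ennreal (ok m)) \<le> ennreal (real M * (1 - (e * ?q) * exp (-1)))"
    have "(e * ?q) * exp (-1) \<le> 1 * 1"
      using e q mult_mono[of e 1 ?q 1] by (intro mult_mono) auto
    then have "0 \<le> real M * (1 - (e * ?q) * exp (-1))" by (intro mult_nonneg_nonneg) auto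
    with le show ?thesis
      by (simp add: ok_def sum_ennreal ennreal_le_iff)
  qed
  moreover have "error_prob a b c \<rho> C = (\<Sum>m<M. 1 - ok m) / real M"
  proof -
    have "CR.prob (error_event a b c \<rho> C m) = 1 - ok m" for m
    proof -
      have "{x \<in> space (channel_randomness C).
          case x of (h, u, z, z') \<Rightarrow> decoder C h (dest_output a b c \<rho> C m h u z z') = m} \<in> CR.events"
        using decoded_measurable[OF meas, of a b c \<rho> m] unfolding split_beta' by measurable
      from CR.prob_neg[OF this] show ?thesis by (simp add: ok_def error_event_def split_beta')
    qed
    then show ?thesis by (simp add: error_prob_eq M_def)
  qed
  ultimately have "real M * ((e * ?q) * exp (-1)) \<le> real M * error_prob a b c \<rho> C"
  proof -
    assume "(\<Sum>m<M. ok m) \<le> real M * (1 - (e * ?q) * exp (-1))"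
      and eq: "error_prob a b c \<rho> C = (\<Sum>m<M. 1 - ok m) / real M"
    moreover have "real M * error_prob a b c \<rho> C = real M - (\<Sum>m<M. ok m)"
      using M unfolding eq by (simp add: sum_subtractf)
    ultimately show ?thesis by (simp add: right_diff_distrib)
  qed
  then have "(e * ?q) * exp (-1) \<le> error_prob a b c \<rho> C"
    using M by (simp only: mult_le_cancel_left_pos of_nat_0_less_iff)
  moreover have "(e * ?q) * exp (-1) = e * (exp (-2) * exp (-1)) * \<rho> powr (-\<beta>)" by (simp only: mult_ac)
  ultimately show ?thesis by (simp flip: exp_add)
qed

section \<open>Converse\<close>

definition dmt :: "real \<Rightarrow> real \<Rightarrow> real \<Rightarrow> real" where
  "dmt p c r = p - r - r * (r - c) / (p - r)"

text \<open>The first claim amounts to \<open>0 < (p - c) * (p - 2 * r)\<close>, and this is where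
  \<open>r < p / 2\<close> is decisive. It says that the failure caused by short listening, of
  exponent \<open>c\<close>, is more likely than the one caused by long listening.\<close>

lemma dmt_bounds:
  assumes "0 \<le> c" "c < r" "r < p / 2"
  shows "c < dmt p c r" "dmt p c r < p - r"
proof -
  have pr: "0 < p - r" "0 < r * (r - c)" using assms by auto
  then show "dmt p c r < p - r" by (simp add: dmt_def)
  have "0 < (p - c) * (p - 2 * r)" using assms by (intro mult_pos_pos) auto
  then have "c * (p - r) < (p - r) * (p - r) - r * (r - c)" by (simp add: algebra_simps)
  then have "c < ((p - r) * (p - r) - r * (r - c)) / (p - r)"
    using pr by (subst pos_less_divide_eq) auto
  then show "c < dmt p c r" using pr by (simp add: dmt_def diff_divide_distrib)
qed

text \<open>The equation characterises \<open>dmt\<close>: with listening fraction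
  \<open>r / p\<close> and R-D exponent \<open>dmt p c r\<close> the talking bound meets the rate
  exactly.\<close>

lemma dmt_talk_exponent:
  assumes pcr: "0 \<le> c" "c < r" "r < p / 2"
  shows "r \<le> p - dmt p c r" "r / p * c + (1 - r / p) * (p - dmt p c r) = r"
proof -
  have p: "0 < p" "0 < r" "r < p" using pcr by auto
  have eq: "p - dmt p c r = r + r * (r - c) / (p - r)" by (simp add: dmt_def)
  have "0 \<le> r * (r - c) / (p - r)" using pcr p by auto
  then show "r \<le> p - dmt p c r" by (simp add: eq)
  have "r * c + (p - r) * (r + r * (r - c) / (p - r)) = r * p"
    using p by (simp add: distrib_left) (simp add: algebra_simps)
  then have "(r * c + (p - r) * (p - dmt p c r)) / p = r" using p by (simp add: eq)
  then show "r / p * c + (1 - r / p) * (p - dmt p c r) = r"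
    using p by (simp add: add_divide_distrib diff_divide_distrib left_diff_distrib)
qed

text \<open>The right side exceeds the left by \<open>(p - s) * (D - \<alpha> - \<beta> - \<gamma>)
  + \<alpha> * \<beta> + (p - 2 * s) * \<gamma>\<close>, a sum of nonnegative terms. The margin on
  the left is used with \<open>s\<close> as the rate exponent at finite SNR for the outage, and with
  \<open>s = r\<close> for the random code.\<close>

lemma dmt_outage_slack:
  assumes "0 \<le> \<alpha>" "0 \<le> \<beta>" "0 \<le> \<gamma>" "\<alpha> + \<beta> + \<gamma> \<le> D" "s \<le> p / 2" "0 < p - s"
  shows "(p - s) * (dmt p c s - D) \<le> (p - \<alpha> - s) * (p - \<beta> - s) - s * (s - c + \<gamma>)"
proof -
  have "(p - s) * (\<alpha> + \<beta> + \<gamma>) \<le> (p - s) * D"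
    using assms by (intro mult_left_mono) auto
  moreover have "(p - s) * dmt p c s = (p - s) * (p - s) - s * (s - c)"
    unfolding dmt_def by (subst right_diff_distrib) (use assms in simp)
  moreover have "0 \<le> \<alpha> * \<beta>" "0 \<le> (p - 2 * s) * \<gamma>" using assms by auto
  ultimately show ?thesis by (simp add: algebra_simps)
qed

lemma tendsto_div_ln: "((\<lambda>\<rho>::real. k / ln \<rho>) \<longlongrightarrow> 0) at_top"
  by real_asymp

lemma ln_1_plus_powr_le:
  fixes \<rho> q :: real
  assumes "1 < \<rho>" "0 \<le> q"
  shows "ln (1 + \<rho> powr q) \<le> 1 + q * ln \<rho>"
proof -
  have "1 \<le> \<rho> powr q" using assms powr_mono[of 0 q \<rho>] by simp
  then have "ln (1 + \<rho> powr q) \<le> ln (2 * \<rho> powr q)" by (subst ln_le_cancel_iff) auto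
  also have "\<dots> = ln 2 + q * ln \<rho>" using assms by (simp add: ln_mult ln_powr)
  finally show ?thesis using ln_2_less_1 by linarith
qed

text \<open>The crude estimate \<open>ln (3 * k) \<le> 3 * k - 1\<close> yields the constants 5 for
  \<open>k = 2\<close> and 2 for \<open>k = 1\<close>.\<close>

lemma ln_sum_powr_le:
  fixes \<rho> c q k :: real
  assumes "1 < \<rho>" "0 \<le> c" "c \<le> q" "0 < k"
  shows "ln (k * (1 + \<rho> powr c + \<rho> powr q)) \<le> 3 * k - 1 + q * ln \<rho>"
proof -
  have "1 \<le> \<rho> powr q" "\<rho> powr c \<le> \<rho> powr q" "0 < \<rho> powr c"
    using assms powr_mono[of 0 q \<rho>] powr_mono[of c q \<rho>] by auto
  then have "k * (1 + \<rho> powr c + \<rho> powr q) \<le> k * (3 * \<rho> powr q)" "0 < 1 + \<rho> powr c + \<rho> powr q"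
    using assms by (intro mult_left_mono, linarith, simp, linarith)
  then have "ln (k * (1 + \<rho> powr c + \<rho> powr q)) \<le> ln ((3 * k) * \<rho> powr q)"
    using assms by (intro iffD2[OF ln_le_cancel_iff] mult_pos_pos) (auto simp: mult_ac)
  also have "\<dots> = ln (3 * k) + q * ln \<rho>" using assms by (subst ln_mult) (auto simp: ln_powr)
  also have "ln (3 * k) \<le> 3 * k - 1" using assms by (intro ln_le_minus_one) auto
  finally show ?thesis by simp
qed

text \<open>Instantiates \<open>error_prob_ge\<close> with a margin on both sides:
  \<open>\<beta>\<close> exceeds \<open>dmt p c r\<close> by \<open>\<epsilon>\<close>, and at most
  half of what this gains in the talking bound is spent on moving the listening threshold below
  \<open>r / p\<close>. The cap on \<open>\<epsilon>\<close> ensures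
  \<open>c \<le> p - \<beta>\<close>.\<close>

lemma converse:
  assumes pcr: "0 \<le> c" "c < r" "r < p / 2"
    and adm: "\<And>\<rho>. 1 < \<rho> \<Longrightarrow> admissible_code p \<rho> (\<C> \<rho>)"
    and mux: "achieves_multiplexing_gain \<C> r" and \<epsilon>: "0 < \<epsilon>" "\<epsilon> \<le> r - c"
  shows "\<exists>\<kappa>>0. eventually (\<lambda>\<rho>. \<kappa> * \<rho> powr (- (dmt p c r + \<epsilon>)) \<le> error_prob p p c \<rho> (\<C> \<rho>)) at_top"
proof -
  define \<beta> where "\<beta> = dmt p c r + \<epsilon>"
  define q where "q = p - \<beta>"
  \<comment> \<open>Raising \<open>\<beta>\<close> by \<open>\<epsilon>\<close> lowers the talking
    bound by \<open>2 * e0\<close>. Lowering the threshold to \<open>t0\<close> raises it again by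
    at most \<open>e0\<close> and lowers the listening bound by exactly \<open>e0\<close>, so both
    end at or below \<open>X = r - e0\<close>.\<close>
  define e0 where "e0 = (1 - r / p) * \<epsilon> / 2"
  define t0 where "t0 = r / p - e0 / p"
  define X where "X = r - e0"
  \<comment> \<open>Half of the gap between the limiting Markov ratio
    \<open>X / (r - e0 / 2)\<close> and 1.\<close>
  define e where "e = (1 - X / (r - e0 / 2)) / 2"
  have p: "0 < p" "0 < r" "r < p" using pcr by auto
  have rp: "0 < r / p" "r / p < 1" using p by auto
  have "(1 - r / p) * \<epsilon> \<le> 1 * \<epsilon>" using rp \<epsilon> by (intro mult_right_mono) auto
  then have "e0 \<le> \<epsilon> / 2" by (simp add: e0_def)
  with \<epsilon> pcr have "e0 < r" by linarith
  moreover have "0 < e0" using rp \<epsilon> by (simp add: e0_def)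
  ultimately have e0: "0 < e0" "e0 < r" by auto
  have c\<beta>: "c \<le> \<beta>" using dmt_bounds(1)[OF pcr] \<epsilon> by (simp add: \<beta>_def)
  have cq: "c \<le> q" using dmt_talk_exponent(1)[OF pcr] \<epsilon> by (simp add: q_def \<beta>_def)
  have qp: "q \<le> p" using c\<beta> pcr by (simp add: q_def)
  have t0: "0 \<le> t0" "t0 \<le> 1"
    using e0 rp p by (auto simp: t0_def diff_divide_distrib[symmetric] divide_le_eq)
  have t0p: "t0 * p = X" using p by (simp add: t0_def X_def left_diff_distrib)
  have t0cq: "t0 * c + (1 - t0) * q \<le> X"
  proof -
    have "r / p * c + (1 - r / p) * (q + \<epsilon>) = r"
      using dmt_talk_exponent(2)[OF pcr] by (simp add: q_def \<beta>_def)
    moreover have "(e0 / p) * (q - c) \<le> e0"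
    proof -
      have "(e0 / p) * (q - c) \<le> (e0 / p) * p"
        using qp pcr e0 p by (intro mult_left_mono) auto
      then show ?thesis using p by simp
    qed
    moreover have "(1 - r / p) * \<epsilon> = 2 * e0" by (simp add: e0_def)
    moreover have "t0 * c + (1 - t0) * q = r / p * c + (1 - r / p) * (q + \<epsilon>) - (1 - r / p) * \<epsilon> + (e0 / p) * (q - c)"
      unfolding t0_def by (simp only: ring_distribs)
    ultimately show ?thesis by (simp add: X_def)
  qed
  have X0: "0 < X" "X < r - e0 / 2" using e0 by (auto simp: X_def)
  have e: "0 < e" "e \<le> 1" using X0 by (auto simp: e_def field_simps)
  define R where "R \<rho> = rate (\<C> \<rho>)" for \<rho>
  have R: "((\<lambda>\<rho>. R \<rho> / ln \<rho>) \<longlongrightarrow> r) at_top"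
    using mux by (simp add: achieves_multiplexing_gain_def R_def)
  \<comment> \<open>The 17 is 12 from the energies plus 5 from the logarithms of sums of
    powers.\<close>
  have "((\<lambda>\<rho>. \<rho> powr (- (e0 / 2)) + (X + 17 / ln \<rho>) / (R \<rho> / ln \<rho> - e0 / 2)) \<longlongrightarrow> 0 + (X + 0) / (r - e0 / 2)) at_top"
    using e0 X0 by (intro tendsto_intros R tendsto_div_ln tendsto_neg_powr filterlim_ident) auto
  then have ev1: "eventually (\<lambda>\<rho>. \<rho> powr (- (e0 / 2)) + (X + 17 / ln \<rho>) / (R \<rho> / ln \<rho> - e0 / 2) < 1 - e) at_top"
  proof (rule order_tendstoD)
    have "1 - e = (1 + X / (r - e0 / 2)) / 2" by (simp add: e_def field_simps)
    moreover have "X / (r - e0 / 2) < 1" using X0 by simp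
    ultimately show "0 + (X + 0) / (r - e0 / 2) < 1 - e" by simp
  qed
  have ev2: "eventually (\<lambda>\<rho>. e0 / 2 < R \<rho> / ln \<rho>) at_top"
    using R by (rule order_tendstoD) (use e0 in auto)
  have "eventually (\<lambda>\<rho>. e * exp (-3) * \<rho> powr (-\<beta>) \<le> error_prob p p c \<rho> (\<C> \<rho>)) at_top"
    using ev1 ev2 eventually_gt_at_top[of 1]
  proof eventually_elim
    case (elim \<rho>)
    define M where "M = real (num_messages (\<C> \<rho>))"
    define N where "N = real (blocklength (\<C> \<rho>))"
    \<comment> \<open>The threshold per symbol lies \<open>e0 / 2 * ln \<rho>\<close> below the
      rate, so that \<open>exp (N * G) / M\<close> vanishes, but still asymptotically above the mean
      cost \<open>X * ln \<rho>\<close>, so that Markov's ratio stays below 1.\<close>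
    define G where "G = R \<rho> - e0 / 2 * ln \<rho>"
    have C: "admissible_code p \<rho> (\<C> \<rho>)" using adm elim by simp
    have MN: "0 < M" "1 \<le> N" using C by (auto simp: M_def N_def admissible_code_def)
    have ln: "0 < ln \<rho>" using elim by simp
    have G: "0 < G" using elim ln by (simp add: G_def field_simps)
    have "exp (N * G) / M = exp (N * R \<rho> - ln M - N * (e0 / 2) * ln \<rho>)"
      using MN by (simp add: G_def exp_diff right_diff_distrib mult.assoc)
    also have "N * R \<rho> = ln M" using MN by (simp add: R_def rate_def M_def N_def)
    also have "exp (ln M - ln M - N * (e0 / 2) * ln \<rho>) \<le> exp (- (e0 / 2) * ln \<rho>)"
      using MN e0 ln mult_right_mono[of 1 N "e0 / 2 * ln \<rho>"] by simp
    also have "\<dots> = \<rho> powr (- (e0 / 2))" using elim by (simp add: powr_def)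
    finally have exp_le: "exp (N * G) / M \<le> \<rho> powr (- (e0 / 2))" .
    have bound: "exp (N * G) / M + N / (N * G) * Y \<le> 1 - e" if "Y \<le> X * ln \<rho> + 17" for Y
    proof -
      have "N / (N * G) * Y = Y / G" using MN by simp
      also have "\<dots> \<le> (X * ln \<rho> + 17) / G" using that G by (intro divide_right_mono) auto
      also have "\<dots> = (X + 17 / ln \<rho>) / (R \<rho> / ln \<rho> - e0 / 2)"
      proof -
        have "X * ln \<rho> + 17 = (X + 17 / ln \<rho>) * ln \<rho>" "G = (R \<rho> / ln \<rho> - e0 / 2) * ln \<rho>"
          using ln by (auto simp: G_def field_simps)
        then show ?thesis using ln by simp
      qed
      finally show ?thesis using exp_le elim by linarith
    qed
    have "e * exp (-3) * \<rho> powr (-\<beta>) \<le> error_prob p p c \<rho> (\<C> \<rho>)"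
    proof (rule error_prob_ge[OF C _ pcr(1) c\<beta> _ t0 _ e(2), where L = "N * G"])
      have "t0 * ln (1 + \<rho> powr p) \<le> t0 * (1 + p * ln \<rho>)"
        using t0 p elim by (intro mult_left_mono ln_1_plus_powr_le) auto
      also have "\<dots> = t0 + X * ln \<rho>" by (simp add: t0p[symmetric] algebra_simps)
      finally show "exp (N * G) / real (num_messages (\<C> \<rho>))
          + real (blocklength (\<C> \<rho>)) / (N * G) * (t0 * ln (1 + \<rho> powr p) + 12) \<le> 1 - e"
        using t0 unfolding M_def[symmetric] N_def[symmetric] by (intro bound) auto
      have "0 < 1 + \<rho> powr c" by (simp add: add_pos_nonneg)
      then have "ln (2 * (1 + \<rho> powr c)) = ln 2 + ln (1 + \<rho> powr c)"
        by (subst ln_mult) auto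
      also have "\<dots> \<le> 1 + (1 + c * ln \<rho>)"
        using ln_1_plus_powr_le[of \<rho> c] elim pcr ln_2_less_1 by (intro add_mono) auto
      finally have "t0 * ln (2 * (1 + \<rho> powr c)) \<le> t0 * (5 + c * ln \<rho>)"
        using t0 by (intro mult_left_mono) auto
      moreover have "(1 - t0) * ln (2 * (1 + \<rho> powr c + \<rho> powr q)) \<le> (1 - t0) * (5 + q * ln \<rho>)"
        using t0 ln_sum_powr_le[of \<rho> c q 2] elim pcr cq by (intro mult_left_mono) auto
      moreover have "t0 * (5 + c * ln \<rho>) + (1 - t0) * (5 + q * ln \<rho>) = 5 + (t0 * c + (1 - t0) * q) * ln \<rho>"
        by (simp add: algebra_simps)
      moreover have "(t0 * c + (1 - t0) * q) * ln \<rho> \<le> X * ln \<rho>"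
        using t0cq ln by (intro mult_right_mono) auto
      ultimately show "exp (N * G) / real (num_messages (\<C> \<rho>)) + real (blocklength (\<C> \<rho>)) / (N * G) *
          (t0 * ln (2 * (1 + \<rho> powr c)) + (1 - t0) * ln (2 * (1 + \<rho> powr c + \<rho> powr (p - \<beta>))) + 12) \<le> 1 - e"
        unfolding M_def[symmetric] N_def[symmetric] q_def[symmetric] by (intro bound) linarith
      show "0 < N * G" using MN G by simp
    qed (use elim e in auto)
    then show ?case .
  qed
  then show ?thesis using e unfolding \<beta>_def by (intro exI[of _ "e * exp (-3)"]) auto
qed

section \<open>From polynomial bounds to exponents\<close>

lemma snr_exponent_le:
  assumes "0 < \<kappa>" "1 < \<rho>" "\<kappa> * \<rho> powr (-d) \<le> P"
  shows "snr_exponent P \<rho> \<le> ereal (d - ln \<kappa> / ln \<rho>)"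
proof -
  have P: "0 < \<kappa> * \<rho> powr (-d)" using assms by simp
  then have "0 < P" using assms by linarith
  have "ln \<kappa> - d * ln \<rho> = ln (\<kappa> * \<rho> powr (-d))"
    using assms by (subst ln_mult) (auto simp: ln_powr)
  also have "\<dots> \<le> ln P" using assms P \<open>0 < P\<close> by (subst ln_le_cancel_iff) auto
  finally have "- ln P \<le> d * ln \<rho> - ln \<kappa>" by simp
  then have "- ln P / ln \<rho> \<le> (d * ln \<rho> - ln \<kappa>) / ln \<rho>" using assms by (intro divide_right_mono) auto
  also have "\<dots> = d - ln \<kappa> / ln \<rho>" using assms by (simp add: diff_divide_distrib)
  finally show ?thesis using \<open>0 < P\<close> by (simp add: snr_exponent_def)
qed

lemma snr_exponent_ge:
  assumes "0 \<le> P" "0 < K" "1 < \<rho>" "P \<le> K * \<rho> powr (-d)"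
  shows "ereal (d - ln K / ln \<rho>) \<le> snr_exponent P \<rho>"
proof (cases "P = 0")
  case True
  then show ?thesis by (simp add: snr_exponent_def)
next
  case False
  have "ln P \<le> ln (K * \<rho> powr (-d))" using assms False by (subst ln_le_cancel_iff) auto
  also have "\<dots> = ln K - d * ln \<rho>"
    using assms by (subst ln_mult) (auto simp: ln_powr)
  finally have "(d * ln \<rho> - ln K) / ln \<rho> \<le> - ln P / ln \<rho>" using assms by (intro divide_right_mono) auto
  moreover have "(d * ln \<rho> - ln K) / ln \<rho> = d - ln K / ln \<rho>" using assms by (simp add: diff_divide_distrib)
  ultimately show ?thesis using False by (simp add: snr_exponent_def)
qed

text \<open>A constant factor moves the exponent by \<open>ln K / ln \<rho>\<close>, which vanishes.
  The cap \<open>e_max\<close> lets the bounds be supplied for small \<open>\<epsilon>\<close>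
  only.\<close>

lemma snr_exponent_tendsto:
  fixes P :: "real \<Rightarrow> real"
  assumes P: "\<And>\<rho>. 0 \<le> P \<rho>" and e_max: "0 < e_max"
    and lower: "\<And>\<epsilon>. 0 < \<epsilon> \<Longrightarrow> \<epsilon> \<le> e_max \<Longrightarrow> \<exists>\<kappa>>0. eventually (\<lambda>\<rho>. \<kappa> * \<rho> powr (- (d + \<epsilon>)) \<le> P \<rho>) at_top"
    and upper: "\<And>\<epsilon>. 0 < \<epsilon> \<Longrightarrow> \<epsilon> \<le> e_max \<Longrightarrow> \<exists>K>0. eventually (\<lambda>\<rho>. P \<rho> \<le> K * \<rho> powr (- (d - \<epsilon>))) at_top"
  shows "((\<lambda>\<rho>. snr_exponent (P \<rho>) \<rho>) \<longlongrightarrow> ereal d) at_top"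
proof (rule order_tendstoI)
  fix x :: ereal assume "x < ereal d"
  then obtain y where y: "x < ereal y" "y < d"
    by (metis ereal_dense2 ereal_less(2) less_ereal.simps(1))
  define \<epsilon> where "\<epsilon> = min e_max ((d - y) / 2)"
  have \<epsilon>: "0 < \<epsilon>" "\<epsilon> \<le> e_max" "y < d - \<epsilon>" using y e_max by (auto simp: \<epsilon>_def min_def field_simps)
  from upper[OF \<epsilon>(1,2)] obtain K where K: "K > 0" "eventually (\<lambda>\<rho>. P \<rho> \<le> K * \<rho> powr (- (d - \<epsilon>))) at_top" by blast
  have "((\<lambda>\<rho>. d - \<epsilon> - ln K / ln \<rho>) \<longlongrightarrow> d - \<epsilon> - 0) at_top"
    by (intro tendsto_intros tendsto_div_ln)
  then have "eventually (\<lambda>\<rho>. y < d - \<epsilon> - ln K / ln \<rho>) at_top"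
    by (rule order_tendstoD) (use \<epsilon> in auto)
  with K(2) eventually_gt_at_top[of 1]
  show "eventually (\<lambda>\<rho>. x < snr_exponent (P \<rho>) \<rho>) at_top"
  proof eventually_elim
    case (elim \<rho>)
    have "x < ereal (d - \<epsilon> - ln K / ln \<rho>)" using y(1) elim(3) by (meson ereal_less_eq(3) less_imp_le order_less_le_trans)
    also have "\<dots> \<le> snr_exponent (P \<rho>) \<rho>" using elim P K by (intro snr_exponent_ge) auto
    finally show ?case .
  qed
next
  fix x :: ereal assume "ereal d < x"
  then obtain y where y: "ereal y < x" "d < y"
    by (metis ereal_dense2 less_ereal.simps(1))
  define \<epsilon> where "\<epsilon> = min e_max ((y - d) / 2)"
  have \<epsilon>: "0 < \<epsilon>" "\<epsilon> \<le> e_max" "d + \<epsilon> < y" using y e_max by (auto simp: \<epsilon>_def min_def field_simps)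
  from lower[OF \<epsilon>(1,2)] obtain K where K: "K > 0" "eventually (\<lambda>\<rho>. K * \<rho> powr (- (d + \<epsilon>)) \<le> P \<rho>) at_top" by blast
  have "((\<lambda>\<rho>. d + \<epsilon> - ln K / ln \<rho>) \<longlongrightarrow> d + \<epsilon> - 0) at_top"
    by (intro tendsto_intros tendsto_div_ln)
  then have "eventually (\<lambda>\<rho>. d + \<epsilon> - ln K / ln \<rho> < y) at_top"
    by (rule order_tendstoD) (use \<epsilon> in auto)
  with K(2) eventually_gt_at_top[of 1]
  show "eventually (\<lambda>\<rho>. snr_exponent (P \<rho>) \<rho> < x) at_top"
  proof eventually_elim
    case (elim \<rho>)
    have "snr_exponent (P \<rho>) \<rho> \<le> ereal (d + \<epsilon> - ln K / ln \<rho>)" using elim K by (intro snr_exponent_le) auto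
    also have "\<dots> < x" using y(1) elim(3) by (meson ereal_less_eq(3) less_imp_le order_le_less_trans)
    finally show ?case .
  qed
qed

section \<open>Exponents of fading events\<close>

text \<open>Given \<open>h3\<close>, the combined gain \<open>h2 + w * h3\<close> is a translate of
  \<open>h2\<close>. A bound for \<open>B\<close> that is uniform over translates therefore makes up
  for the dependence between the combined gain and \<open>h3\<close>.\<close>

lemma measure_fading_box:
  fixes w :: complex
  assumes [measurable]: "A \<in> sets borel" "B \<in> sets borel" "C \<in> sets borel"
    and B: "\<And>v. measure complex_gaussian {x. x + v \<in> B} \<le> b"
  shows "{(h1, h2, h3). h1 \<in> A \<and> h2 + w * h3 \<in> B \<and> h3 \<in> C} \<in> sets fading"
    and "measure fading {(h1, h2, h3). h1 \<in> A \<and> h2 + w * h3 \<in> B \<and> h3 \<in> C}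
      \<le> measure complex_gaussian A * b * measure complex_gaussian C"
proof -
  let ?G = "complex_gaussian"
  let ?S = "{(h2, h3). h2 + w * h3 \<in> B \<and> h3 \<in> C}"
  have b: "0 \<le> b" using B[of 0] measure_nonneg[of ?G] by (rule order_trans[rotated])
  have "{x \<in> space (?G \<Otimes>\<^sub>M ?G). fst x + w * snd x \<in> B \<and> snd x \<in> C} \<in> sets (?G \<Otimes>\<^sub>M ?G)"
    by measurable
  also have "{x \<in> space (?G \<Otimes>\<^sub>M ?G). fst x + w * snd x \<in> B \<and> snd x \<in> C} = ?S"
    by (auto simp: space_pair_measure)
  finally have S: "?S \<in> sets (?G \<Otimes>\<^sub>M ?G)" .
  have eq: "{(h1, h2, h3). h1 \<in> A \<and> h2 + w * h3 \<in> B \<and> h3 \<in> C} = A \<times> ?S" by auto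
  show "{(h1, h2, h3). h1 \<in> A \<and> h2 + w * h3 \<in> B \<and> h3 \<in> C} \<in> sets fading"
    unfolding eq fading_def using S by (intro pair_measureI) auto
  have "emeasure (?G \<Otimes>\<^sub>M ?G) ?S = (\<integral>\<^sup>+y. emeasure ?G ((\<lambda>x. (x, y)) -` ?S) \<partial>?G)"
    by (rule cg2.emeasure_pair_measure_alt2[OF S])
  also have "\<dots> \<le> (\<integral>\<^sup>+y. ennreal b * indicator C y \<partial>?G)"
  proof (rule nn_integral_mono)
    fix y
    have "emeasure ?G {x. x + w * y \<in> B} \<le> ennreal b"
      using B[of "w * y"] by (simp add: cg.emeasure_eq_measure ennreal_leI)
    moreover have "(\<lambda>x. (x, y)) -` ?S = (if y \<in> C then {x. x + w * y \<in> B} else {})" by auto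
    ultimately show "emeasure ?G ((\<lambda>x. (x, y)) -` ?S) \<le> ennreal b * indicator C y"
      by (auto simp: indicator_def)
  qed
  also have "\<dots> = ennreal (b * measure ?G C)"
    using b by (simp add: nn_integral_cmult_indicator cg.emeasure_eq_measure ennreal_mult)
  finally have le: "emeasure (?G \<Otimes>\<^sub>M ?G) ?S \<le> ennreal (b * measure ?G C)" .
  have "emeasure fading (A \<times> ?S) = emeasure ?G A * emeasure (?G \<Otimes>\<^sub>M ?G) ?S"
    unfolding fading_def using S by (intro cg2.P.emeasure_pair_measure_Times) auto
  also have "\<dots> \<le> ennreal (measure ?G A) * ennreal (b * measure ?G C)"
    using le by (simp add: cg.emeasure_eq_measure mult_left_mono)
  also have "\<dots> = ennreal (measure ?G A * b * measure ?G C)"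
    using b by (simp add: ennreal_mult mult.assoc)
  finally show "measure fading {(h1, h2, h3). h1 \<in> A \<and> h2 + w * h3 \<in> B \<and> h3 \<in> C}
      \<le> measure ?G A * b * measure ?G C"
    unfolding eq fad.emeasure_eq_measure using b by (subst (asm) ennreal_le_iff) auto
qed

text \<open>
  A union bound over a grid of fading exponents of mesh \<open>D / n\<close>.
\<close>

lemma fading_exponents_cover:
  fixes w :: complex and D \<rho> :: real and n :: nat
  assumes \<rho>: "1 < \<rho>" and D: "0 \<le> D" and n: "0 < n"
  obtains B where "B \<in> sets fading"
    "measure fading B \<le> real ((n + 1) ^ 3) * \<rho> powr (- (D - 3 * D / real n))"
    "\<And>h1 h2 h3. (h1, h2, h3) \<notin> B \<Longrightarrow> \<exists>\<alpha> \<beta> \<gamma>. 0 \<le> \<alpha> \<and> 0 \<le> \<beta> \<and> 0 \<le> \<gamma> \<and> \<alpha> + \<beta> + \<gamma> \<le> D \<and>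
        \<rho> powr (-\<alpha>) \<le> (cmod h1)\<^sup>2 \<and> \<rho> powr (-\<beta>) \<le> (cmod (h2 + w * h3))\<^sup>2 \<and> \<rho> powr (-\<gamma>) \<le> (cmod h3)\<^sup>2"
proof -
  define \<delta> where "\<delta> = D / real n"
  have \<delta>: "0 \<le> \<delta>" "real n * \<delta> = D" using D n by (auto simp: \<delta>_def)
  \<comment> \<open>Index \<open>0\<close> imposes no constraint, so the cells also contain gains
    above 1, and the bound \<rho> powr 0 = 1 is trivial there.\<close>
  define S where "S i = (if i = 0 then UNIV else {x :: complex. (cmod x)\<^sup>2 \<le> \<rho> powr (- (real i * \<delta>))})" for i :: nat
  have S_meas [measurable]: "S i \<in> sets borel" for i unfolding S_def by auto
  have S_le: "measure complex_gaussian {x. x + v \<in> S i} \<le> \<rho> powr (- (real i * \<delta>))" for v i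
    using complex_gaussian_small_ball[of "\<rho> powr (- (real i * \<delta>))" v] cg.prob_space \<rho>
    by (cases "i = 0") (auto simp: S_def)
  define X where "X = (\<lambda>(i, j, k). {(h1, h2, h3). h1 \<in> S i \<and> h2 + w * h3 \<in> S j \<and> h3 \<in> S k})"
  \<comment> \<open>A cell index is one below the first grid exponent that the gain attains. Over
    three links this turns \<open>n\<close> into \<open>n - 3\<close>, which is the loss
    \<open>3 * D / n\<close> in the exponent.\<close>
  define I where "I = {(i, j, k). i \<le> n \<and> j \<le> n \<and> k \<le> n \<and> n - 3 \<le> i + j + k}"
  define B where "B = (\<Union>x\<in>I. X x)"
  have "I \<subseteq> {..n} \<times> {..n} \<times> {..n}" by (auto simp: I_def)
  then have fin: "finite I" by (rule finite_subset) auto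
  have "card I \<le> card ({..n} \<times> {..n} \<times> {..n})"
    using \<open>I \<subseteq> {..n} \<times> {..n} \<times> {..n}\<close> by (intro card_mono) auto
  then have card: "card I \<le> (n + 1) ^ 3"
    by (simp add: card_cartesian_product power3_eq_cube algebra_simps)
  have X_meas: "X x \<in> sets fading" for x
  proof -
    obtain i j k where x: "x = (i, j, k)" by (cases x)
    show ?thesis
      unfolding x X_def prod.case by (rule measure_fading_box(1)[OF S_meas S_meas S_meas S_le])
  qed
  have X_le: "measure fading (X x) \<le> \<rho> powr (- (D - 3 * D / real n))" if "x \<in> I" for x
  proof -
    obtain i j k where x: "x = (i, j, k)" by (cases x)
    have "measure fading (X x) \<le> measure complex_gaussian (S i) * \<rho> powr (- (real j * \<delta>)) * measure complex_gaussian (S k)"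
      unfolding x X_def using measure_fading_box(2)[OF S_meas S_meas S_meas S_le] by simp
    also have "\<dots> \<le> \<rho> powr (- (real i * \<delta>)) * \<rho> powr (- (real j * \<delta>)) * \<rho> powr (- (real k * \<delta>))"
      using S_le[of 0 i] S_le[of 0 k] by (intro mult_mono) auto
    also have "\<dots> = \<rho> powr (- (real (i + j + k) * \<delta>))"
      by (simp add: algebra_simps flip: powr_add)
    also have "\<dots> \<le> \<rho> powr (- (D - 3 * D / real n))"
    proof (intro powr_mono)
      have "real n - 3 \<le> real (i + j + k)" using that by (auto simp: I_def x)
      then have "(real n - 3) * \<delta> \<le> real (i + j + k) * \<delta>" using \<delta> by (intro mult_right_mono)
      moreover have "(real n - 3) * \<delta> = D - 3 * D / real n"
        using n by (simp add: \<delta>_def field_simps)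
      ultimately show "- (real (i + j + k) * \<delta>) \<le> - (D - 3 * D / real n)" by linarith
    qed (use \<rho> in auto)
    finally show ?thesis .
  qed
  have "measure fading B \<le> (\<Sum>x\<in>I. measure fading (X x))"
    unfolding B_def using fin X_meas by (intro fad.finite_measure_subadditive_finite) auto
  also have "\<dots> \<le> real (card I) * \<rho> powr (- (D - 3 * D / real n))"
    using sum_mono[OF X_le] by simp
  also have "\<dots> \<le> real ((n + 1) ^ 3) * \<rho> powr (- (D - 3 * D / real n))"
    by (intro mult_right_mono of_nat_mono card) auto
  finally have B_le: "measure fading B \<le> real ((n + 1) ^ 3) * \<rho> powr (- (D - 3 * D / real n))" .
  \<comment> \<open>The least grid exponent attained by a squared gain, cut off at \<open>n\<close>
    because a gain may be arbitrarily small; minimality places the gain in the cell just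
    below.\<close>
  define f where "f x = (LEAST i. i = n \<or> \<rho> powr (- (real i * \<delta>)) \<le> x)" for x
  have f: "f x \<le> n" "f x < n \<Longrightarrow> \<rho> powr (- (real (f x) * \<delta>)) \<le> x" for x
  proof -
    show "f x \<le> n" unfolding f_def by (rule Least_le) simp
    show "\<rho> powr (- (real (f x) * \<delta>)) \<le> x" if "f x < n"
      using LeastI[of "\<lambda>i. i = n \<or> \<rho> powr (- (real i * \<delta>)) \<le> x" n] that unfolding f_def by auto
  qed
  have f_S: "y \<in> S (f ((cmod y)\<^sup>2) - 1)" for y
  proof (cases "f ((cmod y)\<^sup>2) - 1 = 0")
    case True
    then show ?thesis by (simp add: S_def)
  next
    case False
    then have "f ((cmod y)\<^sup>2) - 1 < f ((cmod y)\<^sup>2)" by simp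
    from not_less_Least[OF this[unfolded f_def]] show ?thesis
      using False unfolding f_def[symmetric] S_def by auto
  qed
  show thesis
  proof (rule that[of B])
    show "B \<in> sets fading" unfolding B_def using fin X_meas by auto
    show "measure fading B \<le> real ((n + 1) ^ 3) * \<rho> powr (- (D - 3 * D / real n))" by (rule B_le)
    fix h1 h2 h3 assume notB: "(h1, h2, h3) \<notin> B"
    let ?i = "f ((cmod h1)\<^sup>2)" and ?j = "f ((cmod (h2 + w * h3))\<^sup>2)" and ?k = "f ((cmod h3)\<^sup>2)"
    have "(h1, h2, h3) \<in> X (?i - 1, ?j - 1, ?k - 1)"
      using f_S by (simp add: X_def)
    with notB have "(?i - 1, ?j - 1, ?k - 1) \<notin> I" by (auto simp: B_def)
    moreover have "?i - 1 \<le> n" "?j - 1 \<le> n" "?k - 1 \<le> n"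
      using f(1) by (meson diff_le_self order_trans)+
    ultimately have "\<not> n - 3 \<le> ?i - 1 + (?j - 1) + (?k - 1)" by (simp add: I_def)
    then have lt: "?i + ?j + ?k < n" by linarith
    have "(real ?i + real ?j + real ?k) * \<delta> \<le> real n * \<delta>"
      using lt \<delta> by (intro mult_right_mono) auto
    then show "\<exists>\<alpha> \<beta> \<gamma>. 0 \<le> \<alpha> \<and> 0 \<le> \<beta> \<and> 0 \<le> \<gamma> \<and> \<alpha> + \<beta> + \<gamma> \<le> D \<and>
        \<rho> powr (-\<alpha>) \<le> (cmod h1)\<^sup>2 \<and> \<rho> powr (-\<beta>) \<le> (cmod (h2 + w * h3))\<^sup>2 \<and> \<rho> powr (-\<gamma>) \<le> (cmod h3)\<^sup>2"
      using f(2) lt \<delta>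
      by (intro exI[of _ "real ?i * \<delta>"] exI[of _ "real ?j * \<delta>"] exI[of _ "real ?k * \<delta>"])
        (auto simp: distrib_right)
  qed
qed

lemma ln_1_plus_ge:
  fixes \<rho> x y q \<alpha> :: real
  assumes "1 < \<rho>" "\<rho> powr (-\<alpha>) \<le> x" "0 \<le> y"
  shows "(q - \<alpha>) * ln \<rho> \<le> ln (1 + y + x * \<rho> powr q)"
proof -
  have "\<rho> powr (q - \<alpha>) = \<rho> powr (-\<alpha>) * \<rho> powr q" by (simp flip: powr_add)
  also have "\<dots> \<le> x * \<rho> powr q" using assms by (intro mult_right_mono) auto
  finally have le: "\<rho> powr (q - \<alpha>) \<le> 1 + y + x * \<rho> powr q" using assms by simp
  have "(q - \<alpha>) * ln \<rho> = ln (\<rho> powr (q - \<alpha>))" using assms by (simp add: ln_powr)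
  also have "\<dots> \<le> ln (1 + y + x * \<rho> powr q)"
  proof -
    have "0 < \<rho> powr (q - \<alpha>)" using assms by simp
    then show ?thesis using le by (intro iffD2[OF ln_le_cancel_iff]) linarith+
  qed
  finally show ?thesis .
qed

lemma tendsto_dmt:
  assumes "(s \<longlongrightarrow> r) F" "r < p"
  shows "((\<lambda>x. dmt p c (s x)) \<longlongrightarrow> dmt p c r) F"
  unfolding dmt_def using assms by (intro tendsto_intros) auto

text \<open>The outage event lies in the exceptional set of the cover with \<open>w = 0\<close>. The
  true rate enters as \<open>s = R \<rho> / ln \<rho>\<close>, and continuity of \<open>dmt\<close>
  carries \<open>D < dmt p c r\<close> over to \<open>s\<close> for large \<rho>.\<close>

lemma ddf_outage_prob_le:
  assumes pcr: "0 \<le> c" "c < r" "r < p / 2" and D: "0 \<le> D" "D < dmt p c r"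
    and R: "((\<lambda>\<rho>. R \<rho> / ln \<rho>) \<longlongrightarrow> r) at_top" and n: "0 < n"
  shows "eventually (\<lambda>\<rho>. ddf_outage_prob p p c \<rho> (R \<rho>) \<le> real ((n + 1) ^ 3) * \<rho> powr (- (D - 3 * D / real n))) at_top"
proof -
  have rp: "r < p" "0 < r" using pcr by auto
  have "eventually (\<lambda>\<rho>. D < dmt p c (R \<rho> / ln \<rho>)) at_top"
    using tendsto_dmt[OF R rp(1)] D by (intro order_tendstoD)
  moreover have "eventually (\<lambda>\<rho>. R \<rho> / ln \<rho> < p / 2) at_top" "eventually (\<lambda>\<rho>. 0 < R \<rho> / ln \<rho>) at_top"
    "eventually (\<lambda>\<rho>. R \<rho> / ln \<rho> < p - D) at_top"
    using pcr rp dmt_bounds[OF pcr] D by (rule_tac order_tendstoD[OF R]; simp)+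
  ultimately show ?thesis using eventually_gt_at_top[of 1]
  proof eventually_elim
    case (elim \<rho>)
    define s where "s = R \<rho> / ln \<rho>"
    have ln: "0 < ln \<rho>" using elim by simp
    have Rs: "R \<rho> = s * ln \<rho>" using ln by (simp add: s_def)
    have s: "0 < s" "s < p / 2" "s < p - D" "D < dmt p c s" using elim by (auto simp: s_def)
    obtain B where B: "B \<in> sets fading"
      "measure fading B \<le> real ((n + 1) ^ 3) * \<rho> powr (- (D - 3 * D / real n))"
      "\<And>h1 h2 h3. (h1, h2, h3) \<notin> B \<Longrightarrow> \<exists>\<alpha> \<beta> \<gamma>. 0 \<le> \<alpha> \<and> 0 \<le> \<beta> \<and> 0 \<le> \<gamma> \<and> \<alpha> + \<beta> + \<gamma> \<le> D \<and>
        \<rho> powr (-\<alpha>) \<le> (cmod h1)\<^sup>2 \<and> \<rho> powr (-\<beta>) \<le> (cmod (h2 + 0 * h3))\<^sup>2 \<and> \<rho> powr (-\<gamma>) \<le> (cmod h3)\<^sup>2"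
      using fading_exponents_cover[OF _ D(1) n, of \<rho> 0] elim by blast
    have "{h \<in> space fading. ddf_outage p p c \<rho> (R \<rho>) h} \<subseteq> B"
    proof (safe, rule ccontr)
      fix h1 h2 h3 assume out: "ddf_outage p p c \<rho> (R \<rho>) (h1, h2, h3)" and "(h1, h2, h3) \<notin> B"
      from B(3)[OF this(2)] obtain \<alpha> \<beta> \<gamma> where abc: "0 \<le> \<alpha>" "0 \<le> \<beta>" "0 \<le> \<gamma>" "\<alpha> + \<beta> + \<gamma> \<le> D"
        "\<rho> powr (-\<alpha>) \<le> (cmod h1)\<^sup>2" "\<rho> powr (-\<beta>) \<le> (cmod h2)\<^sup>2" "\<rho> powr (-\<gamma>) \<le> (cmod h3)\<^sup>2" by auto
      define relay where "relay = ln (1 + (cmod h1)\<^sup>2 * \<rho> powr p)"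
      define direct where "direct = ln (1 + (cmod h3)\<^sup>2 * \<rho> powr c)"
      define both where "both = ln (1 + (cmod h3)\<^sup>2 * \<rho> powr c + (cmod h2)\<^sup>2 * \<rho> powr p)"
      define t where "t = R \<rho> / relay"
      \<comment> \<open>The longest listening fraction compatible with the exponent \<alpha>.
        Replacing \<open>t\<close> by it only lowers the mutual information, because
        \<open>direct \<le> both\<close>.\<close>
      define \<tau> where "\<tau> = s / (p - \<alpha>)"
      have "(p - \<alpha>) * ln \<rho> \<le> relay" "(c - \<gamma>) * ln \<rho> \<le> direct" "(p - \<beta>) * ln \<rho> \<le> both"
        using ln_1_plus_ge[of \<rho> \<alpha> "(cmod h1)\<^sup>2" 0 p] ln_1_plus_ge[of \<rho> \<gamma> "(cmod h3)\<^sup>2" 0 c]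
          ln_1_plus_ge[of \<rho> \<beta> "(cmod h2)\<^sup>2" "(cmod h3)\<^sup>2 * \<rho> powr c" p] abc elim
        by (auto simp: relay_def direct_def both_def)
      note ge = this
      have p\<alpha>: "s < p - \<alpha>" using s abc by linarith
      have "0 < (p - \<alpha>) * ln \<rho>" using p\<alpha> s ln by simp
      with ge(1) have relay0: "0 < relay" by linarith
      have "t \<le> s * ln \<rho> / ((p - \<alpha>) * ln \<rho>)"
        unfolding t_def Rs using ge(1) relay0 s p\<alpha> ln by (intro divide_left_mono mult_pos_pos) auto
      then have t: "t \<le> \<tau>" using ln by (simp add: \<tau>_def)
      have \<tau>: "0 < \<tau>" "\<tau> < 1" using p\<alpha> s by (auto simp: \<tau>_def)
      have "1 + (cmod h3)\<^sup>2 * \<rho> powr c \<le> 1 + (cmod h3)\<^sup>2 * \<rho> powr c + (cmod h2)\<^sup>2 * \<rho> powr p"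
        "0 < 1 + (cmod h3)\<^sup>2 * \<rho> powr c" by (auto simp: add_pos_nonneg)
      then have db: "direct \<le> both" unfolding direct_def both_def by (intro iffD2[OF ln_le_cancel_iff]) linarith+
      \<comment> \<open>The condition for no outage at listening fraction \<open>\<tau>\<close>,
        cleared of the denominator; rearranged, it is \<open>dmt_outage_slack\<close> with a
        nonnegative margin.\<close>
      have "s * (p - \<alpha>) \<le> s * (c - \<gamma>) + (p - \<alpha> - s) * (p - \<beta>)"
      proof -
        have "0 \<le> (p - s) * (dmt p c s - D)" using s by (intro mult_nonneg_nonneg) auto
        also have "\<dots> \<le> (p - \<alpha> - s) * (p - \<beta> - s) - s * (s - c + \<gamma>)"
          using abc s by (intro dmt_outage_slack) auto
        finally show ?thesis by (simp add: algebra_simps)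
      qed
      then have "s \<le> (s * (c - \<gamma>) + (p - \<alpha> - s) * (p - \<beta>)) / (p - \<alpha>)"
        using p\<alpha> s by (subst pos_le_divide_eq) auto
      also have "\<dots> = \<tau> * (c - \<gamma>) + (1 - \<tau>) * (p - \<beta>)"
        using p\<alpha> s by (simp add: \<tau>_def add_divide_distrib diff_divide_distrib[symmetric])
          (simp add: field_simps)
      finally have "s * ln \<rho> \<le> (\<tau> * (c - \<gamma>) + (1 - \<tau>) * (p - \<beta>)) * ln \<rho>"
        using ln by (intro mult_right_mono) auto
      also have "\<dots> = \<tau> * ((c - \<gamma>) * ln \<rho>) + (1 - \<tau>) * ((p - \<beta>) * ln \<rho>)" by (simp add: algebra_simps)
      also have "\<dots> \<le> \<tau> * direct + (1 - \<tau>) * both"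
        using \<tau> ge by (intro add_mono mult_left_mono) auto
      also have "\<dots> = both - \<tau> * (both - direct)" by (simp add: algebra_simps)
      also have "\<dots> \<le> both - t * (both - direct)"
        using t db by (intro diff_left_mono mult_right_mono) auto
      also have "\<dots> = t * direct + (1 - t) * both" by (simp add: algebra_simps)
      finally have "R \<rho> \<le> t * direct + (1 - t) * both" by (simp add: Rs)
      moreover have "t \<le> 1" using t \<tau> by simp
      ultimately show False
        using out by (simp add: ddf_outage_def Let_def t_def direct_def both_def relay_def)
    qed
    then have "ddf_outage_prob p p c \<rho> (R \<rho>) \<le> measure fading B"
      unfolding ddf_outage_prob_def using B(1) by (intro fad.finite_measure_mono)
    with B(2) show ?case by simp
  qed
qed

text \<open>A box of channels inside the outage event: S-R and S-D coefficients of modulus at most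
  1, and a squared R-D coefficient at most \<open>\<rho> powr (-\<beta>)\<close>. On it the
  listening fraction is at least \<open>t0 \<rho>\<close>, which tends to \<open>r / p\<close>, and
  \<open>dmt_talk_exponent\<close> puts the mutual information below the rate.\<close>

lemma ddf_outage_prob_ge:
  assumes pcr: "0 \<le> c" "c < r" "r < p / 2" and \<epsilon>: "0 < \<epsilon>" "\<epsilon> \<le> r - c"
    and R: "((\<lambda>\<rho>. R \<rho> / ln \<rho>) \<longlongrightarrow> r) at_top"
  shows "eventually (\<lambda>\<rho>. exp (-3) * \<rho> powr (- (dmt p c r + \<epsilon>)) \<le> ddf_outage_prob p p c \<rho> (R \<rho>)) at_top"
proof -
  define \<beta> where "\<beta> = dmt p c r + \<epsilon>"
  define q where "q = p - \<beta>"
  have p: "0 < p" "0 < r" "r < p" using pcr by auto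
  have rp: "0 < r / p" "r / p < 1" using p by auto
  have \<beta>: "0 \<le> \<beta>" using dmt_bounds(1)[OF pcr] \<epsilon> pcr by (simp add: \<beta>_def)
  have cq: "c \<le> q" using dmt_talk_exponent(1)[OF pcr] \<epsilon> by (simp add: q_def \<beta>_def)
  have "0 < (1 - r / p) * \<epsilon>" using rp \<epsilon> by simp
  then have cqr: "r / p * c + (1 - r / p) * q < r"
    using dmt_talk_exponent(2)[OF pcr] by (simp add: q_def \<beta>_def right_diff_distrib distrib_left)
  define s where "s \<rho> = R \<rho> / ln \<rho>" for \<rho>
  \<comment> \<open>The term \<open>1 / ln \<rho>\<close> allows for
    \<open>ln (1 + \<rho> powr p)\<close> exceeding \<open>p * ln \<rho>\<close> by up to 1; the
    terms \<open>5 / ln \<rho>\<close> below absorb constants in the same way.\<close>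
  define t0 where "t0 \<rho> = s \<rho> / (p + 1 / ln \<rho>)" for \<rho>
  have s: "(s \<longlongrightarrow> r) at_top" using R by (simp add: s_def[abs_def])
  have "(t0 \<longlongrightarrow> r / (p + 0)) at_top"
    unfolding t0_def using p by (intro tendsto_intros s tendsto_div_ln) auto
  then have t0: "(t0 \<longlongrightarrow> r / p) at_top" by simp
  have "((\<lambda>\<rho>. t0 \<rho> * (c + 5 / ln \<rho>) + (1 - t0 \<rho>) * (q + 5 / ln \<rho>)) \<longlongrightarrow> r / p * (c + 0) + (1 - r / p) * (q + 0)) at_top"
    by (intro tendsto_intros t0 tendsto_div_ln)
  from tendsto_diff[OF this s]
  have "eventually (\<lambda>\<rho>. t0 \<rho> * (c + 5 / ln \<rho>) + (1 - t0 \<rho>) * (q + 5 / ln \<rho>) - s \<rho> < 0) at_top"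
    by (rule order_tendstoD) (use cqr in auto)
  moreover have "((\<lambda>\<rho>. c + 5 / ln \<rho> - s \<rho>) \<longlongrightarrow> c + 0 - r) at_top"
    by (intro tendsto_intros s tendsto_div_ln)
  then have "eventually (\<lambda>\<rho>. c + 5 / ln \<rho> - s \<rho> < 0) at_top"
    by (rule order_tendstoD) (use pcr in auto)
  moreover have "eventually (\<lambda>\<rho>. 0 < t0 \<rho>) at_top" "eventually (\<lambda>\<rho>. t0 \<rho> < 1) at_top"
    using rp by (auto intro!: order_tendstoD[OF t0])
  moreover have "eventually (\<lambda>\<rho>. 0 < s \<rho>) at_top" using p by (auto intro!: order_tendstoD[OF s])
  ultimately show ?thesis using eventually_gt_at_top[of 1]
  proof eventually_elim
    case (elim \<rho>)
    have ln: "0 < ln \<rho>" using elim by simp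
    have Rs: "R \<rho> = s \<rho> * ln \<rho>" using ln by (simp add: s_def)
    note S_ge = complex_gaussian_small_ball_ge
    have sub: "punctured_ball 1 \<times> (punctured_ball (\<rho> powr (-\<beta>)) \<times> punctured_ball 1) \<subseteq> {h \<in> space fading. ddf_outage p p c \<rho> (R \<rho>) h}"
    proof safe
      fix h1 h2 h3 assume h: "h1 \<in> punctured_ball 1" "h2 \<in> punctured_ball (\<rho> powr (-\<beta>))" "h3 \<in> punctured_ball 1"
      define relay where "relay = ln (1 + (cmod h1)\<^sup>2 * \<rho> powr p)"
      define direct where "direct = ln (1 + (cmod h3)\<^sup>2 * \<rho> powr c)"
      define both where "both = ln (1 + (cmod h3)\<^sup>2 * \<rho> powr c + (cmod h2)\<^sup>2 * \<rho> powr p)"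
      define t where "t = R \<rho> / relay"
      have "0 < (cmod h1)\<^sup>2 * \<rho> powr p" using h elim by (auto simp: punctured_ball_def)
      then have relay0: "0 < relay" by (simp add: relay_def)
      have h1: "(cmod h1)\<^sup>2 * \<rho> powr p \<le> \<rho> powr p" and h3: "(cmod h3)\<^sup>2 * \<rho> powr c \<le> \<rho> powr c"
        using h by (auto simp: punctured_ball_def intro!: mult_left_le_one_le)
      have "(cmod h2)\<^sup>2 * \<rho> powr p \<le> \<rho> powr (-\<beta>) * \<rho> powr p"
        using h by (intro mult_right_mono) (auto simp: punctured_ball_def)
      also have "\<dots> = \<rho> powr q" by (simp add: q_def flip: powr_add)
      finally have h2: "(cmod h2)\<^sup>2 * \<rho> powr p \<le> \<rho> powr q" .
      have "relay \<le> ln (1 + \<rho> powr p)"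
        unfolding relay_def using h1 by (intro iffD2[OF ln_le_cancel_iff]) (auto simp: add_pos_nonneg)
      also have "\<dots> \<le> 1 + p * ln \<rho>" using elim p by (intro ln_1_plus_powr_le) auto
      also have "\<dots> = (p + 1 / ln \<rho>) * ln \<rho>" using ln by (simp add: field_simps)
      finally have relay: "relay \<le> (p + 1 / ln \<rho>) * ln \<rho>" .
      have "t0 \<rho> = R \<rho> / ((p + 1 / ln \<rho>) * ln \<rho>)" using ln by (simp add: t0_def Rs)
      also have "\<dots> \<le> t"
        unfolding t_def using relay relay0 elim ln by (intro divide_left_mono) (auto simp: Rs intro!: mult_pos_pos order_less_le_trans[OF relay0])
      finally have t: "t0 \<rho> \<le> t" .
      have "direct \<le> ln (1 + \<rho> powr c)"
        unfolding direct_def using h3 by (intro iffD2[OF ln_le_cancel_iff]) (auto simp: add_pos_nonneg)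
      also have "\<dots> \<le> 1 + c * ln \<rho>" using elim pcr by (intro ln_1_plus_powr_le) auto
      also have "\<dots> \<le> (c + 5 / ln \<rho>) * ln \<rho>" using ln by (simp add: field_simps)
      finally have direct: "direct \<le> (c + 5 / ln \<rho>) * ln \<rho>" .
      have "0 < 1 + (cmod h3)\<^sup>2 * \<rho> powr c" "0 \<le> (cmod h2)\<^sup>2 * \<rho> powr p" by (auto simp: add_pos_nonneg)
      then have "both \<le> ln (1 + \<rho> powr c + \<rho> powr q)"
        unfolding both_def using h3 h2 by (intro iffD2[OF ln_le_cancel_iff]) linarith+
      also have "\<dots> \<le> 2 + q * ln \<rho>" using ln_sum_powr_le[of \<rho> c q 1] elim pcr cq by simp
      also have "\<dots> \<le> (q + 5 / ln \<rho>) * ln \<rho>" using ln by (simp add: field_simps)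
      finally have both: "both \<le> (q + 5 / ln \<rho>) * ln \<rho>" .
      \<comment> \<open>Settles the case \<open>t > 1\<close>, in which only the direct link
        remains; it is in outage because \<open>c < r\<close>.\<close>
      have "(c + 5 / ln \<rho>) * ln \<rho> < s \<rho> * ln \<rho>"
        using elim ln by (intro mult_strict_right_mono) auto
      with direct have "direct < R \<rho>" by (simp add: Rs)
      moreover have "t * direct + (1 - t) * both < R \<rho>" if "t \<le> 1"
      proof -
        have "t * direct + (1 - t) * both \<le> t * ((c + 5 / ln \<rho>) * ln \<rho>) + (1 - t) * ((q + 5 / ln \<rho>) * ln \<rho>)"
          using direct both that t elim by (intro add_mono mult_left_mono) auto
        also have "\<dots> = (q + 5 / ln \<rho> - t * (q - c)) * ln \<rho>" by (simp add: algebra_simps)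
        also have "\<dots> \<le> (q + 5 / ln \<rho> - t0 \<rho> * (q - c)) * ln \<rho>"
          using t cq ln by (intro mult_right_mono diff_left_mono) auto
        also have "q + 5 / ln \<rho> - t0 \<rho> * (q - c) = t0 \<rho> * (c + 5 / ln \<rho>) + (1 - t0 \<rho>) * (q + 5 / ln \<rho>)"
        proof -
          have "q + k - t0 \<rho> * (q - c) = t0 \<rho> * (c + k) + (1 - t0 \<rho>) * (q + k)" for k
            by (simp add: algebra_simps)
          then show ?thesis .
        qed
        also have "\<dots> * ln \<rho> < s \<rho> * ln \<rho>" using elim ln by (intro mult_strict_right_mono) auto
        finally show ?thesis by (simp add: Rs)
      qed
      ultimately have "t > 1 \<and> direct < R \<rho> \<or> t \<le> 1 \<and> t * direct + (1 - t) * both < R \<rho>"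
        by linarith
      then show "ddf_outage p p c \<rho> (R \<rho>) (h1, h2, h3)"
        by (simp add: ddf_outage_def Let_def t_def direct_def both_def relay_def)
    qed auto
    have "\<rho> powr (-\<beta>) \<le> 1" using elim \<beta> powr_mono[of "-\<beta>" 0 \<rho>] by simp
    then have "(1 * exp (-1)) * ((\<rho> powr (-\<beta>) * exp (-1)) * (1 * exp (-1)))
        \<le> measure complex_gaussian (punctured_ball 1) * (measure complex_gaussian (punctured_ball (\<rho> powr (-\<beta>))) * measure complex_gaussian (punctured_ball 1))"
      by (intro mult_mono S_ge) auto
    also have "\<dots> = measure fading (punctured_ball 1 \<times> (punctured_ball (\<rho> powr (-\<beta>)) \<times> punctured_ball 1))"
      unfolding fading_def by (simp add: measure_Times cg.prob_space_axioms cg2.P.prob_space_axioms)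
    also have "\<dots> \<le> ddf_outage_prob p p c \<rho> (R \<rho>)"
      unfolding ddf_outage_prob_def
    proof (rule fad.finite_measure_mono[OF sub])
      show "{h \<in> space fading. ddf_outage p p c \<rho> (R \<rho>) h} \<in> sets fading"
        unfolding ddf_outage_def Let_def split_beta' by measurable
    qed
    also have "(1 * exp (-1)) * ((\<rho> powr (-\<beta>) * exp (-1)) * (1 * exp (-1))) = (exp (-1) * exp (-1) * exp (-1)) * \<rho> powr (-\<beta>)"
      by (simp only: mult_ac mult_1)
    finally show ?case by (simp add: \<beta>_def flip: exp_add)
  qed
qed

section \<open>Random codebooks on a grid\<close>

text \<open>A finite alphabet in a square of side 1/2, so that every symbol meets the power
  constraint by itself. Uniform codebooks over it make the random-coding average a finite
  sum.\<close>

definition grid :: "nat \<Rightarrow> complex set" where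
  "grid Q = (\<lambda>(a, b). Complex (real a / (2 * real Q)) (real b / (2 * real Q))) ` ({..<Q} \<times> {..<Q})"

lemma finite_grid: "finite (grid Q)"
  by (simp add: grid_def)

lemma inj_grid:
  "0 < Q \<Longrightarrow> inj_on (\<lambda>(a, b). Complex (real a / (2 * real Q)) (real b / (2 * real Q))) A"
  by (auto simp: inj_on_def)

lemma card_grid: "0 < Q \<Longrightarrow> card (grid Q) = Q * Q"
  unfolding grid_def by (subst card_image[OF inj_grid]) (auto simp: card_cartesian_product)

lemma norm_grid_le: "x \<in> grid Q \<Longrightarrow> cmod x \<le> 1"
proof -
  assume "x \<in> grid Q"
  then obtain a b where x: "x = Complex (real a / (2 * real Q)) (real b / (2 * real Q))" and ab: "a < Q" "b < Q"
    by (auto simp: grid_def)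
  have "\<bar>Re x\<bar> \<le> 1 / 2" "\<bar>Im x\<bar> \<le> 1 / 2" using ab by (auto simp: x field_simps)
  then show ?thesis using cmod_le[of x] by linarith
qed

lemma card_nats_near:
  fixes u :: real
  assumes "0 \<le> u"
  shows "real (card {a. a < Q \<and> \<bar>real a - real a0\<bar> \<le> u}) \<le> 2 * u + 1"
proof -
  have "int ` {a. a < Q \<and> \<bar>real a - real a0\<bar> \<le> u} \<subseteq> {\<lceil>real a0 - u\<rceil>..\<lfloor>real a0 + u\<rfloor>}"
  proof
    fix j assume "j \<in> int ` {a. a < Q \<and> \<bar>real a - real a0\<bar> \<le> u}"
    then obtain a where "j = int a" "\<bar>real a - real a0\<bar> \<le> u" by auto
    then have "real a0 - u \<le> real_of_int j" "real_of_int j \<le> real a0 + u" by auto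
    then show "j \<in> {\<lceil>real a0 - u\<rceil>..\<lfloor>real a0 + u\<rfloor>}"
      unfolding atLeastAtMost_iff ceiling_le_iff le_floor_iff by simp
  qed
  then have "card (int ` {a. a < Q \<and> \<bar>real a - real a0\<bar> \<le> u}) \<le> card {\<lceil>real a0 - u\<rceil>..\<lfloor>real a0 + u\<rfloor>}"
    by (intro card_mono) auto
  also have "card (int ` {a. a < Q \<and> \<bar>real a - real a0\<bar> \<le> u}) = card {a. a < Q \<and> \<bar>real a - real a0\<bar> \<le> u}"
    by (intro card_image) auto
  finally have "real (card {a. a < Q \<and> \<bar>real a - real a0\<bar> \<le> u}) \<le> real (nat (\<lfloor>real a0 + u\<rfloor> - \<lceil>real a0 - u\<rceil> + 1))"
    by simp
  also have "\<dots> \<le> 2 * u + 1" using assms by linarith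
  finally show ?thesis .
qed

text \<open>Bounds the share of alphabet points that noise of size \<open>\<tau>\<close> can confuse
  with a given point at gain \<open>g\<close>, that is, those within distance
  \<open>2 * \<tau> / g\<close>. The cap \<open>G\<close> reflects the spacing of the grid, below
  which the count cannot shrink. The case \<open>g = 0\<close> is separate because division by zero
  would give \<open>0\<close>.\<close>

definition clash_frac :: "real \<Rightarrow> real \<Rightarrow> real \<Rightarrow> real" where
  "clash_frac \<tau> G g = (if g = 0 then 1 else min 1 ((9 * \<tau> / min g G)\<^sup>2))"

lemma clash_frac_bounds: "0 \<le> clash_frac \<tau> G g" "clash_frac \<tau> G g \<le> 1"
  by (auto simp: clash_frac_def)

lemma clash_frac_measurable [measurable]: "clash_frac \<tau> G \<in> borel_measurable borel"
  unfolding clash_frac_def by measurable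

lemma clash_frac_le:
  assumes "0 < x" "x \<le> g" "x \<le> G" "0 \<le> \<tau>"
  shows "clash_frac \<tau> G g \<le> 81 * \<tau>\<^sup>2 / x\<^sup>2"
proof -
  have "(9 * \<tau> / min g G)\<^sup>2 \<le> (9 * \<tau> / x)\<^sup>2"
    using assms by (intro power_mono divide_left_mono) auto
  then show ?thesis using assms by (simp add: clash_frac_def power_divide power_mult_distrib min.coboundedI2)
qed

text \<open>Each coordinate leaves at most \<open>2 * u + 1\<close> indices with
  \<open>u = 4 * Q * \<tau> / g\<close>. The summand 1 is absorbed through
  \<open>G \<le> \<tau> * Q\<close>, which turns the factor 8 into the 9 of
  \<open>clash_frac\<close>.\<close>

lemma card_clash_symbols:
  assumes x: "x \<in> grid Q" and Q: "G \<le> \<tau> * real Q" "0 < G" and g: "0 \<le> g" and \<tau>: "0 < \<tau>"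
  shows "real (card {y \<in> grid Q. g * cmod (x - y) \<le> 2 * \<tau>}) \<le> clash_frac \<tau> G g * real (card (grid Q))"
proof -
  have Q0: "0 < Q" using x by (auto simp: grid_def)
  have le1: "real (card {y \<in> grid Q. g * cmod (x - y) \<le> 2 * \<tau>}) \<le> real (card (grid Q))"
    using finite_grid by (intro of_nat_mono card_mono) auto
  show ?thesis
  proof (cases "g = 0")
    case True
    then show ?thesis using le1 by (simp add: clash_frac_def)
  next
    case False
    with g have g: "0 < g" by simp
    obtain a0 b0 where x: "x = Complex (real a0 / (2 * real Q)) (real b0 / (2 * real Q))"
      using x by (auto simp: grid_def)
    define u where "u = 4 * real Q * \<tau> / g"
    define A where "A c = {a. a < Q \<and> \<bar>real a - real c\<bar> \<le> u}" for c
    have "{y \<in> grid Q. g * cmod (x - y) \<le> 2 * \<tau>}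
        \<subseteq> (\<lambda>(a, b). Complex (real a / (2 * real Q)) (real b / (2 * real Q))) ` (A a0 \<times> A b0)"
    proof
      fix y assume "y \<in> {y \<in> grid Q. g * cmod (x - y) \<le> 2 * \<tau>}"
      then obtain a b where y: "y = Complex (real a / (2 * real Q)) (real b / (2 * real Q))"
        and ab: "a < Q" "b < Q" and le: "g * cmod (x - y) \<le> 2 * \<tau>"
        by (auto simp: grid_def)
      have near: "\<bar>s - t\<bar> \<le> u" if "\<bar>t / (2 * real Q) - s / (2 * real Q)\<bar> \<le> cmod (x - y)" for s t
      proof -
        have "\<bar>t / (2 * real Q) - s / (2 * real Q)\<bar> = \<bar>s - t\<bar> / (2 * real Q)"
          by (simp add: diff_divide_distrib[symmetric] abs_minus_commute)
        with that have "\<bar>s - t\<bar> \<le> cmod (x - y) * (2 * real Q)" using Q0 by (simp add: divide_le_eq)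
        also have "cmod (x - y) \<le> 2 * \<tau> / g" using le g by (simp add: field_simps)
        finally show ?thesis using Q0 by (simp add: u_def mult_ac)
      qed
      have "\<bar>real a - real a0\<bar> \<le> u" by (rule near) (use abs_Re_le_cmod[of "x - y"] in \<open>simp add: x y\<close>)
      moreover have "\<bar>real b - real b0\<bar> \<le> u" by (rule near) (use abs_Im_le_cmod[of "x - y"] in \<open>simp add: x y\<close>)
      ultimately show "y \<in> (\<lambda>(a, b). Complex (real a / (2 * real Q)) (real b / (2 * real Q))) ` (A a0 \<times> A b0)"
        using ab by (auto simp: y A_def)
    qed
    then have "card {y \<in> grid Q. g * cmod (x - y) \<le> 2 * \<tau>} \<le> card (A a0 \<times> A b0)"
      by (rule surj_card_le[rotated]) (auto simp: A_def)
    then have "real (card {y \<in> grid Q. g * cmod (x - y) \<le> 2 * \<tau>}) \<le> real (card (A a0)) * real (card (A b0))"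
      by (simp add: card_cartesian_product flip: of_nat_mult)
    also have "\<dots> \<le> (2 * u + 1) * (2 * u + 1)"
      using g \<tau> unfolding A_def by (intro mult_mono card_nats_near) (auto simp: u_def)
    also have "\<dots> \<le> (9 * \<tau> / min g G * real Q) * (9 * \<tau> / min g G * real Q)"
    proof -
      have m: "0 < min g G" "min g G \<le> g" "min g G \<le> G" using g Q by auto
      have "2 * u = 8 * \<tau> / g * real Q" by (simp add: u_def)
      also have "\<dots> \<le> 8 * \<tau> / min g G * real Q"
        using m \<tau> by (intro mult_right_mono divide_left_mono) auto
      finally have "2 * u \<le> 8 * \<tau> / min g G * real Q" .
      moreover have "1 \<le> \<tau> / min g G * real Q" using m Q by (simp add: divide_simps)
      ultimately have "2 * u + 1 \<le> 8 * \<tau> / min g G * real Q + \<tau> / min g G * real Q" by (rule add_mono)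
      also have "\<dots> = 9 * \<tau> / min g G * real Q" by (simp add: add_divide_distrib[symmetric] flip: distrib_right)
      finally show ?thesis using g \<tau> by (intro mult_mono) (auto simp: u_def intro!: mult_nonneg_nonneg divide_nonneg_nonneg order_trans[OF _ less_imp_le[OF m(1)]])
    qed
    also have "\<dots> = (9 * \<tau> / min g G)\<^sup>2 * real (card (grid Q))"
      using Q0 by (simp add: card_grid power2_eq_square mult_ac)
    finally show ?thesis
      using le1 False by (auto simp: clash_frac_def min_def)
  qed
qed

text \<open>The coordinates of a uniform word are independent, so the shares multiply over the first
  \<open>k\<close> positions.\<close>

lemma card_clash_words:
  fixes n k :: nat
  assumes s: "s \<in> PiE {..<n} (\<lambda>_. grid Q)" and Q: "G \<le> \<tau> * real Q" "0 < G"
    and g: "\<And>i. 0 \<le> g i" and \<tau>: "0 < \<tau>" and k: "k \<le> n"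
  shows "real (card {s' \<in> PiE {..<n} (\<lambda>_. grid Q). \<forall>i<k. g i * cmod (s i - s' i) \<le> 2 * \<tau>})
     \<le> (\<Prod>i<k. clash_frac \<tau> G (g i)) * real (card (PiE {..<n} (\<lambda>_. grid Q)))"
proof -
  define Y where "Y i = (if i < k then {y \<in> grid Q. g i * cmod (s i - y) \<le> 2 * \<tau>} else grid Q)" for i
  have "{s' \<in> PiE {..<n} (\<lambda>_. grid Q). \<forall>i<k. g i * cmod (s i - s' i) \<le> 2 * \<tau>} = PiE {..<n} Y"
  proof (intro set_eqI iffI)
    fix x assume "x \<in> PiE {..<n} Y"
    then have ext: "x \<in> extensional {..<n}" by (simp add: PiE_def)
    have x: "x i \<in> Y i" if "i < n" for i
      using \<open>x \<in> PiE {..<n} Y\<close> that by (auto simp: PiE_def)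
    have "x i \<in> grid Q" if "i < n" for i using x[OF that] by (auto simp: Y_def split: if_splits)
    moreover have "g i * cmod (s i - x i) \<le> 2 * \<tau>" if "i < k" for i
    proof -
      have "i < n" using that k by simp
      from x[OF this] show ?thesis using that by (auto simp: Y_def)
    qed
    ultimately show "x \<in> {s' \<in> PiE {..<n} (\<lambda>_. grid Q). \<forall>i<k. g i * cmod (s i - s' i) \<le> 2 * \<tau>}"
      using ext by (auto simp: PiE_def)
  qed (use k in \<open>auto simp: Y_def PiE_def\<close>)
  then have "real (card {s' \<in> PiE {..<n} (\<lambda>_. grid Q). \<forall>i<k. g i * cmod (s i - s' i) \<le> 2 * \<tau>})
      = (\<Prod>i<n. real (card (Y i)))"
    by (simp add: card_PiE)
  also have "\<dots> \<le> (\<Prod>i<n. (if i < k then clash_frac \<tau> G (g i) else 1) * real (card (grid Q)))"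
  proof (intro prod_mono conjI)
    fix i assume "i \<in> {..<n}"
    then have "s i \<in> grid Q" using s by auto
    from card_clash_symbols[OF this Q g \<tau>]
    show "real (card (Y i)) \<le> (if i < k then clash_frac \<tau> G (g i) else 1) * real (card (grid Q))"
      by (auto simp: Y_def)
  qed auto
  also have "\<dots> = (\<Prod>i<n. if i < k then clash_frac \<tau> G (g i) else 1) * real (card (PiE {..<n} (\<lambda>_. grid Q)))"
    by (simp add: prod.distrib card_PiE)
  also have "(\<Prod>i<n. if i < k then clash_frac \<tau> G (g i) else 1) = (\<Prod>i<k. clash_frac \<tau> G (g i))"
  proof -
    have "{..<n} \<inter> {i. i < k} = {..<k}" using k by auto
    then show ?thesis by (simp add: prod.If_cases)
  qed
  finally show ?thesis .
qed

text \<open>In a uniform codebook the word of \<open>m'\<close> is independent of all others: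
  removing and reinserting it is a bijection, so the words \<open>f m'\<close> can be counted with
  \<open>f m\<close> fixed.\<close>

lemma card_codebooks_pair:
  assumes W: "finite W" and I: "finite I" "m \<in> I" "m' \<in> I" "m \<noteq> m'"
    and P: "\<And>s. s \<in> W \<Longrightarrow> real (card {s' \<in> W. P s s'}) \<le> q * real (card W)"
  shows "real (card {f \<in> PiE I (\<lambda>_. W). P (f m) (f m')}) \<le> q * real (card (PiE I (\<lambda>_. W)))"
proof -
  define J where "J = I - {m'}"
  have J: "I = insert m' J" "m' \<notin> J" "finite J" "m \<in> J" using I by (auto simp: J_def)
  have inj: "inj_on (\<lambda>(y, g). g(m' := y)) (W \<times> PiE J (\<lambda>_. W))"
    using inj_combinator[OF J(2), of "\<lambda>_. W"] by simp
  have img: "PiE I (\<lambda>_. W) = (\<lambda>(y, g). g(m' := y)) ` (W \<times> PiE J (\<lambda>_. W))"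
    unfolding J(1) by (rule PiE_insert_eq)
  have "{f \<in> PiE I (\<lambda>_. W). P (f m) (f m')}
      = (\<lambda>(y, g). g(m' := y)) ` {(y, g). g \<in> PiE J (\<lambda>_. W) \<and> y \<in> W \<and> P (g m) y}"
    unfolding img using I by auto
  then have "card {f \<in> PiE I (\<lambda>_. W). P (f m) (f m')} = card {(y, g). g \<in> PiE J (\<lambda>_. W) \<and> y \<in> W \<and> P (g m) y}"
    by (auto intro!: card_image inj_on_subset[OF inj])
  also have "{(y, g). g \<in> PiE J (\<lambda>_. W) \<and> y \<in> W \<and> P (g m) y} = prod.swap ` (SIGMA g:PiE J (\<lambda>_. W). {y \<in> W. P (g m) y})"
    by auto
  also have "card \<dots> = card (SIGMA g:PiE J (\<lambda>_. W). {y \<in> W. P (g m) y})"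
    by (intro card_image) auto
  also have "\<dots> = (\<Sum>g\<in>PiE J (\<lambda>_. W). card {y \<in> W. P (g m) y})"
    using W J by (intro card_SigmaI finite_PiE) auto
  finally have "real (card {f \<in> PiE I (\<lambda>_. W). P (f m) (f m')}) = (\<Sum>g\<in>PiE J (\<lambda>_. W). real (card {y \<in> W. P (g m) y}))"
    by simp
  also have "\<dots> \<le> (\<Sum>g\<in>PiE J (\<lambda>_. W). q * real (card W))"
    using J by (intro sum_mono P) auto
  also have "\<dots> = q * real (card (W \<times> PiE J (\<lambda>_. W)))"
    by (simp add: card_cartesian_product)
  also have "card (W \<times> PiE J (\<lambda>_. W)) = card (PiE I (\<lambda>_. W))"
    unfolding img by (rule card_image[OF inj, symmetric])
  finally show ?thesis .
qed

section \<open>A repetition scheme for the relay\<close>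

text \<open>
  The relay listens for \<open>k h_sr\<close> symbols and then repeats the source's codeword, so that the
  destination faces a single time-varying gain.
\<close>

definition dest_gain ::
  "real \<Rightarrow> real \<Rightarrow> real \<Rightarrow> (complex \<Rightarrow> nat) \<Rightarrow> complex \<times> complex \<times> complex \<Rightarrow> nat \<Rightarrow> complex" where
  "dest_gain b c \<rho> k h i =
     snd (snd h) * of_real (\<rho> powr (c / 2))
     + (if i < k (fst h) then 0 else fst (snd h) * of_real (\<rho> powr (b / 2)))"

text \<open>A threshold test on the listened slots in place of a likelihood decision: when the noise
  stays below \<open>\<tau>\<close> the true message always passes, so only distances between
  codewords matter.\<close>

definition relay_guess ::
  "real \<Rightarrow> real \<Rightarrow> real \<Rightarrow> (complex \<Rightarrow> nat) \<Rightarrow> nat \<Rightarrow> (nat \<Rightarrow> nat \<Rightarrow> complex) \<Rightarrow> nat \<Rightarrow> complex \<Rightarrow> (nat \<Rightarrow> complex) \<Rightarrow> nat" where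
  "relay_guess a \<rho> \<tau> k M f i h y = (LEAST m. m = M \<or>
     (\<forall>j<i. j < k h \<longrightarrow> cmod (y j - h * of_real (\<rho> powr (a / 2)) * f m j) \<le> \<tau>))"

text \<open>The guess \<open>M\<close> is not a message and stands for a decoding failure.\<close>

definition repetition_code ::
  "real \<Rightarrow> real \<Rightarrow> real \<Rightarrow> real \<Rightarrow> real \<Rightarrow> (complex \<Rightarrow> nat) \<Rightarrow> (complex \<times> complex \<times> complex) set
    \<Rightarrow> nat \<Rightarrow> nat \<Rightarrow> (nat \<Rightarrow> nat \<Rightarrow> complex) \<Rightarrow> relay_code" where
  "repetition_code a b c \<rho> \<tau> k bad N M f =
     \<lparr>blocklength = N, num_messages = M, source_symbol = f,
      relay_listens = (\<lambda>i u h y. i < k h),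
      relay_symbol = (\<lambda>i u h y. let m = relay_guess a \<rho> \<tau> k M f i h y in if m < M then f m i else 0),
      decoder = (\<lambda>h y. if h \<in> bad then M else (LEAST m. m = M \<or>
        (\<forall>i<N. cmod (y i - dest_gain b c \<rho> k h i * f m i) \<le> \<tau>)))\<rparr>"

lemma repetition_code_simps [simp]:
  "blocklength (repetition_code a b c \<rho> \<tau> k bad N M f) = N"
  "num_messages (repetition_code a b c \<rho> \<tau> k bad N M f) = M"
  "source_symbol (repetition_code a b c \<rho> \<tau> k bad N M f) = f"
  "relay_listens (repetition_code a b c \<rho> \<tau> k bad N M f) i u h y \<longleftrightarrow> i < k h"
  "relay_symbol (repetition_code a b c \<rho> \<tau> k bad N M f) i u h y
     = (if relay_guess a \<rho> \<tau> k M f i h y < M then f (relay_guess a \<rho> \<tau> k M f i h y) i else 0)"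
  "decoder (repetition_code a b c \<rho> \<tau> k bad N M f) h' y = (if h' \<in> bad then M else (LEAST m. m = M \<or>
        (\<forall>i<N. cmod (y i - dest_gain b c \<rho> k h' i * f m i) \<le> \<tau>)))"
  by (simp_all add: repetition_code_def Let_def)

lemma dest_gain_measurable:
  assumes [measurable]: "k \<in> borel \<rightarrow>\<^sub>M count_space UNIV" "H \<in> S \<rightarrow>\<^sub>M borel \<Otimes>\<^sub>M (borel \<Otimes>\<^sub>M borel)"
  shows "(\<lambda>x. dest_gain b c \<rho> k (H x) i) \<in> borel_measurable S"
  unfolding dest_gain_def by measurable

lemma measurable_repetition_code:
  assumes k [measurable]: "k \<in> borel \<rightarrow>\<^sub>M count_space UNIV"
    and bad [measurable]: "bad \<in> sets (borel \<Otimes>\<^sub>M (borel \<Otimes>\<^sub>M borel))"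
  shows "measurable_code (repetition_code a b c \<rho> \<tau> k bad N M f)"
  unfolding measurable_code_def repetition_code_simps
proof (intro conjI allI impI)
  fix i
  let ?S = "borel \<Otimes>\<^sub>M (borel \<Otimes>\<^sub>M seqs i) :: (real \<times> complex \<times> (nat \<Rightarrow> complex)) measure"
  show "(\<lambda>(u, h, y). i < k h) \<in> ?S \<rightarrow>\<^sub>M count_space UNIV"
    unfolding split_beta' by measurable
  have guess: "(\<lambda>x. relay_guess a \<rho> \<tau> k M f i (fst (snd x)) (snd (snd x))) \<in> ?S \<rightarrow>\<^sub>M count_space UNIV"
    unfolding relay_guess_def
  proof (rule measurable_Least)
    fix m
    have 1: "Measurable.pred ?S (\<lambda>x. j < k (fst (snd x)) \<longrightarrow>
        cmod (snd (snd x) j - fst (snd x) * of_real (\<rho> powr (a / 2)) * f m j) \<le> \<tau>)" if "j \<in> {..<i}" for j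
    proof -
      have [measurable]: "(\<lambda>x. snd (snd x) j) \<in> borel_measurable ?S"
        using that by (intro seqs_component_measurable[of _ _ i]) auto
      show ?thesis by measurable
    qed
    have "Measurable.pred ?S (\<lambda>x. \<forall>j\<in>{..<i}. j < k (fst (snd x)) \<longrightarrow>
        cmod (snd (snd x) j - fst (snd x) * of_real (\<rho> powr (a / 2)) * f m j) \<le> \<tau>)"
      by (rule pred_intros_finite(3)[OF _ 1]) auto
    then have "Measurable.pred ?S (\<lambda>x. \<forall>j<i. j < k (fst (snd x)) \<longrightarrow>
        cmod (snd (snd x) j - fst (snd x) * of_real (\<rho> powr (a / 2)) * f m j) \<le> \<tau>)"
      unfolding Ball_def lessThan_iff .
    then show "Measurable.pred ?S (\<lambda>x. m = M \<or> (\<forall>j<i. j < k (fst (snd x)) \<longrightarrow>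
        cmod (snd (snd x) j - fst (snd x) * of_real (\<rho> powr (a / 2)) * f m j) \<le> \<tau>))"
      by (cases "m = M") simp_all
  qed
  have "(\<lambda>m. if m < M then f m i else 0) \<in> borel_measurable (count_space UNIV)" by simp
  from measurable_compose[OF guess this]
  show "(\<lambda>(u, h, y). if relay_guess a \<rho> \<tau> k M f i h y < M then f (relay_guess a \<rho> \<tau> k M f i h y) i else 0)
      \<in> borel_measurable ?S"
    by (simp add: split_beta')
next
  let ?S = "(borel \<Otimes>\<^sub>M (borel \<Otimes>\<^sub>M borel)) \<Otimes>\<^sub>M seqs N :: ((complex \<times> complex \<times> complex) \<times> (nat \<Rightarrow> complex)) measure"
  have "(\<lambda>x. LEAST m. m = M \<or> (\<forall>i<N. cmod (snd x i - dest_gain b c \<rho> k (fst x) i * f m i) \<le> \<tau>)) \<in> ?S \<rightarrow>\<^sub>M count_space UNIV"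
  proof (rule measurable_Least)
    fix m
    have 1: "Measurable.pred ?S (\<lambda>x. cmod (snd x i - dest_gain b c \<rho> k (fst x) i * f m i) \<le> \<tau>)" if "i \<in> {..<N}" for i
    proof -
      have [measurable]: "(\<lambda>x. snd x i) \<in> borel_measurable ?S"
        using that by (intro seqs_component_measurable[of _ _ N]) auto
      have [measurable]: "(\<lambda>x. dest_gain b c \<rho> k (fst x) i) \<in> borel_measurable ?S"
        by (intro dest_gain_measurable) auto
      show ?thesis by measurable
    qed
    have "Measurable.pred ?S (\<lambda>x. \<forall>i\<in>{..<N}. cmod (snd x i - dest_gain b c \<rho> k (fst x) i * f m i) \<le> \<tau>)"
      by (rule pred_intros_finite(3)[OF _ 1]) auto
    then have "Measurable.pred ?S (\<lambda>x. \<forall>i<N. cmod (snd x i - dest_gain b c \<rho> k (fst x) i * f m i) \<le> \<tau>)"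
      unfolding Ball_def lessThan_iff .
    moreover have "Measurable.pred ?S (\<lambda>x. m = M)" by (rule measurable_const) simp
    ultimately show "Measurable.pred ?S (\<lambda>x. m = M \<or> (\<forall>i<N. cmod (snd x i - dest_gain b c \<rho> k (fst x) i * f m i) \<le> \<tau>))"
      by (rule pred_intros_logic(5)[rotated])
  qed
  note least = this
  have "{x \<in> space ?S. fst x \<in> bad} \<in> sets ?S" by measurable
  moreover have "(\<lambda>x. M) \<in> ?S \<rightarrow>\<^sub>M count_space UNIV" by (rule measurable_const) simp
  ultimately show "(\<lambda>(h, y). if h \<in> bad then M else (LEAST m. m = M \<or>
        (\<forall>i<N. cmod (y i - dest_gain b c \<rho> k h i * f m i) \<le> \<tau>))) \<in> ?S \<rightarrow>\<^sub>M count_space UNIV"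
    unfolding split_beta' using least by (intro measurable_If)
qed

lemma admissible_repetition_code:
  assumes k: "k \<in> borel \<rightarrow>\<^sub>M count_space UNIV" and bad: "bad \<in> sets (borel \<Otimes>\<^sub>M (borel \<Otimes>\<^sub>M borel))"
    and NM: "0 < N" "0 < M" and f: "\<And>m i. m < M \<Longrightarrow> i < N \<Longrightarrow> cmod (f m i) \<le> 1"
  shows "admissible_code a \<rho> (repetition_code a b c \<rho> \<tau> k bad N M f)"
proof -
  let ?C = "repetition_code a b c \<rho> \<tau> k bad N M f"
  let ?P = "relay_randomness \<Otimes>\<^sub>M noise N"
  have f2: "(cmod (f m i))\<^sup>2 \<le> 1" if "m < M" "i < N" for m i
    using f[OF that] by (simp add: power_le_one)
  have "(\<Sum>m<M. \<Sum>i<N. (cmod (f m i))\<^sup>2) \<le> (\<Sum>m<M. \<Sum>i<N. 1)"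
    by (intro sum_mono f2) auto
  then have "source_power_ok ?C"
    using NM by (simp add: source_power_ok_def)
  moreover have "relay_power_ok a \<rho> ?C"
    unfolding relay_power_ok_def repetition_code_simps
  proof
    fix h
    have "(cmod (relay_input a \<rho> ?C m h u z i))\<^sup>2 \<le> 1" if "i < N" for m u z i
      using that f2 by (simp add: relay_input_def Let_def)
    then have "(\<Sum>m<M. \<Sum>i<N. \<integral>\<^sup>+(u, z). ennreal ((cmod (relay_input a \<rho> ?C m h u z i))\<^sup>2) \<partial>?P)
        \<le> (\<Sum>m<M. \<Sum>i<N. \<integral>\<^sup>+x. 1 \<partial>?P)"
      by (intro sum_mono nn_integral_mono) (auto simp: ennreal_le_1)
    also have "\<dots> = ennreal (real M * real N)"
      by (simp add: rrn.P.emeasure_space_1 ennreal_of_nat_eq_real_of_nat ennreal_mult)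
    finally have le: "(\<Sum>m<M. \<Sum>i<N. \<integral>\<^sup>+(u, z). ennreal ((cmod (relay_input a \<rho> ?C m h u z i))\<^sup>2) \<partial>?P)
        \<le> ennreal (real M * real N)" .
    have "ennreal (real M * real N) \<noteq> 0" "ennreal (real M * real N) \<noteq> \<top>" using NM by auto
    then have "ennreal (real M * real N) / ennreal (real M * real N) = 1"
      by (simp add: ennreal_divide_self less_top)
    with divide_right_mono_ennreal[OF le, of "ennreal (real M * real N)"]
    show "(\<Sum>m<M. \<Sum>i<N. \<integral>\<^sup>+(u, z). ennreal ((cmod (relay_input a \<rho> ?C m h u z i))\<^sup>2) \<partial>?P)
        / ennreal (real M * real N) \<le> 1" by simp
  qed
  ultimately show ?thesis
    using NM measurable_repetition_code[OF k bad] by (simp add: admissible_code_def)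
qed

section \<open>Error probability of the repetition scheme\<close>

text \<open>A necessary condition for two codewords to pass the same threshold test. The noise has
  been eliminated, so the event concerns only the fading and the codebook; \<open>dest_clash\<close>
  is its counterpart at the destination.\<close>

definition relay_clash ::
  "real \<Rightarrow> real \<Rightarrow> real \<Rightarrow> (complex \<Rightarrow> nat) \<Rightarrow> complex \<Rightarrow> (nat \<Rightarrow> complex) \<Rightarrow> (nat \<Rightarrow> complex) \<Rightarrow> bool" where
  "relay_clash a \<rho> \<tau> k h s s' \<longleftrightarrow> (\<forall>j<k h. cmod (h * of_real (\<rho> powr (a / 2))) * cmod (s j - s' j) \<le> 2 * \<tau>)"

definition dest_clash ::
  "real \<Rightarrow> real \<Rightarrow> real \<Rightarrow> real \<Rightarrow> (complex \<Rightarrow> nat) \<Rightarrow> nat \<Rightarrow> complex \<times> complex \<times> complex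
    \<Rightarrow> (nat \<Rightarrow> complex) \<Rightarrow> (nat \<Rightarrow> complex) \<Rightarrow> bool" where
  "dest_clash b c \<rho> \<tau> k N h s s' \<longleftrightarrow> (\<forall>i<N. cmod (dest_gain b c \<rho> k h i) * cmod (s i - s' i) \<le> 2 * \<tau>)"

lemma gain_clash:
  assumes "cmod (y - g * x) \<le> \<tau>" "cmod (y - g * x') \<le> \<tau>"
  shows "cmod g * cmod (x - x') \<le> 2 * \<tau>"
proof -
  have "cmod g * cmod (x - x') = cmod ((y - g * x') - (y - g * x))"
    by (simp add: norm_mult[symmetric] right_diff_distrib)
  also have "\<dots> \<le> cmod (y - g * x') + cmod (y - g * x)" by (rule norm_triangle_ineq4)
  finally show ?thesis using assms by linarith
qed

lemma Least_decode:
  fixes m M :: nat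
  assumes "m < M" "P m" "\<And>m'. m' < M \<Longrightarrow> P m' \<Longrightarrow> m' = m"
  shows "(LEAST m. m = M \<or> P m) = m"
proof (rule Least_equality)
  show "m = M \<or> P m" using assms(2) by simp
  fix y assume y: "y = M \<or> P y"
  show "m \<le> y"
  proof (cases "y < M")
    case True
    with y have "P y" by simp
    from assms(3)[OF True this] show ?thesis by simp
  next
    case False
    with assms(1) show ?thesis by simp
  qed
qed

text \<open>The deterministic core: with small noise and no clash every threshold test accepts the
  sent message and no other. The relay's guess is right in every slot from \<open>k h1\<close> on,
  so its input equals the source's symbol, and then the same argument applies at the destination. If
  \<open>k h1 = N\<close> the relay never transmits, so its clashes count only for
  \<open>k h1 < N\<close>.\<close>

lemma repetition_code_correct:
  assumes m: "m < M" and h: "(h1, h2, h3) \<notin> bad" and kN: "k h1 \<le> N"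
    and z: "\<And>i. i < N \<Longrightarrow> cmod (z i) \<le> \<tau>" "\<And>i. i < N \<Longrightarrow> cmod (z' i) \<le> \<tau>"
    and relay: "\<And>m'. m' < M \<Longrightarrow> m' \<noteq> m \<Longrightarrow> k h1 < N \<Longrightarrow> \<not> relay_clash a \<rho> \<tau> k h1 (f m) (f m')"
    and dest: "\<And>m'. m' < M \<Longrightarrow> m' \<noteq> m \<Longrightarrow> \<not> dest_clash b c \<rho> \<tau> k N (h1, h2, h3) (f m) (f m')"
  defines "C \<equiv> repetition_code a b c \<rho> \<tau> k bad N M f"
  shows "decoder C (h1, h2, h3) (dest_output a b c \<rho> C m (h1, h2, h3) u z z') = m"
proof -
  have C: "blocklength C = N" "source_symbol C = f" "\<And>i u h y. relay_listens C i u h y \<longleftrightarrow> i < k h"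
    "\<And>i u h y. relay_symbol C i u h y
     = (if relay_guess a \<rho> \<tau> k M f i h y < M then f (relay_guess a \<rho> \<tau> k M f i h y) i else 0)"
    by (simp_all add: C_def)
  have dec: "decoder C (h1, h2, h3) y = (LEAST m. m = M \<or>
        (\<forall>i<N. cmod (y i - dest_gain b c \<rho> k (h1, h2, h3) i * f m i) \<le> \<tau>))" for y
    unfolding C_def repetition_code_simps using h by (simp only: if_False)
  have past: "relay_past a \<rho> C m h1 u z i j = (if j < k h1 then h1 * of_real (\<rho> powr (a / 2)) * f m j + z j else 0)"
    if "j < i" for i j
    using that
  proof (induction i)
    case (Suc i)
    then show ?case by (cases "j = i") (simp_all add: Let_def C)
  qed simp
  have guess: "relay_guess a \<rho> \<tau> k M f i h1 (relay_past a \<rho> C m h1 u z i) = m" if i: "k h1 \<le> i" "i < N" for i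
    unfolding relay_guess_def
  proof (rule Least_decode[OF m])
    show "\<forall>j<i. j < k h1 \<longrightarrow> cmod (relay_past a \<rho> C m h1 u z i j - h1 * of_real (\<rho> powr (a / 2)) * f m j) \<le> \<tau>"
    proof (intro allI impI)
      fix j assume j: "j < i" "j < k h1"
      then have "j < N" using kN by simp
      then show "cmod (relay_past a \<rho> C m h1 u z i j - h1 * of_real (\<rho> powr (a / 2)) * f m j) \<le> \<tau>"
        unfolding past[OF j(1)] using j z(1)[of j] by simp
    qed
    fix m' assume m': "m' < M"
      and ok: "\<forall>j<i. j < k h1 \<longrightarrow> cmod (relay_past a \<rho> C m h1 u z i j - h1 * of_real (\<rho> powr (a / 2)) * f m' j) \<le> \<tau>"
    have "relay_clash a \<rho> \<tau> k h1 (f m) (f m')"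
      unfolding relay_clash_def
    proof (intro allI impI)
      fix j assume j: "j < k h1"
      then have ji: "j < i" "j < N" using i kN by simp_all
      have "cmod (relay_past a \<rho> C m h1 u z i j - h1 * of_real (\<rho> powr (a / 2)) * f m j) \<le> \<tau>"
        unfolding past[OF ji(1)] using j z(1)[of j] ji by simp
      from gain_clash[OF this ok[rule_format, OF ji(1) j]]
      show "cmod (h1 * of_real (\<rho> powr (a / 2))) * cmod (f m j - f m' j) \<le> 2 * \<tau>" .
    qed
    then show "m' = m" using relay[OF m'] i by (meson order_le_less_trans)
  qed
  have input: "relay_input a \<rho> C m h1 u z i = (if i < k h1 then 0 else f m i)" if "i < N" for i
    using that guess[of i] m by (cases "i < k h1") (simp_all add: relay_input_def Let_def C)
  have out: "dest_output a b c \<rho> C m (h1, h2, h3) u z z' i = dest_gain b c \<rho> k (h1, h2, h3) i * f m i + z' i" if "i < N" for i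
  proof -
    have "dest_output a b c \<rho> C m (h1, h2, h3) u z z' i
      = h3 * of_real (\<rho> powr (c / 2)) * f m i + h2 * of_real (\<rho> powr (b / 2)) * relay_input a \<rho> C m h1 u z i + z' i"
      using that by (simp add: dest_output_def C(1,2))
    then show ?thesis unfolding input[OF that] dest_gain_def by (simp add: distrib_right)
  qed
  have "(LEAST m'. m' = M \<or> (\<forall>i<N. cmod (dest_output a b c \<rho> C m (h1, h2, h3) u z z' i
      - dest_gain b c \<rho> k (h1, h2, h3) i * f m' i) \<le> \<tau>)) = m"
  proof (rule Least_decode[OF m])
    show "\<forall>i<N. cmod (dest_output a b c \<rho> C m (h1, h2, h3) u z z' i - dest_gain b c \<rho> k (h1, h2, h3) i * f m i) \<le> \<tau>"
      using z by (simp add: out)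
    fix m' assume m': "m' < M"
      and ok: "\<forall>i<N. cmod (dest_output a b c \<rho> C m (h1, h2, h3) u z z' i - dest_gain b c \<rho> k (h1, h2, h3) i * f m' i) \<le> \<tau>"
    have "dest_clash b c \<rho> \<tau> k N (h1, h2, h3) (f m) (f m')"
      unfolding dest_clash_def
    proof (intro allI impI)
      fix i assume i: "i < N"
      have "cmod (dest_output a b c \<rho> C m (h1, h2, h3) u z z' i - dest_gain b c \<rho> k (h1, h2, h3) i * f m i) \<le> \<tau>"
        using z(2)[OF i] by (simp add: out[OF i])
      from gain_clash[OF this ok[rule_format, OF i]]
      show "cmod (dest_gain b c \<rho> k (h1, h2, h3) i) * cmod (f m i - f m' i) \<le> 2 * \<tau>" .
    qed
    then show "m' = m" using dest m' by blast
  qed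
  then show ?thesis by (simp only: dec)
qed

lemma noise_exceeds:
  assumes "0 \<le> \<tau>"
  shows "{z \<in> space (noise n). \<exists>i<n. \<tau> < cmod (z i)} \<in> sets (noise n)"
    and "measure (noise n) {z \<in> space (noise n). \<exists>i<n. \<tau> < cmod (z i)} \<le> 2 * real n * exp (- \<tau>\<^sup>2 / 2)"
proof -
  let ?Z = "\<lambda>i. {z \<in> space (noise n). \<tau> < cmod (z i)}"
  have eq: "{z \<in> space (noise n). \<exists>i<n. \<tau> < cmod (z i)} = (\<Union>i\<in>{..<n}. ?Z i)" by auto
  have Z: "?Z i \<in> sets (noise n)" if "i \<in> {..<n}" for i
  proof -
    have [measurable]: "(\<lambda>z. z i) \<in> borel_measurable (noise n)"
      using that by (intro seqs_component_measurable[of "\<lambda>z. z" _ n]) auto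
    show ?thesis by measurable
  qed
  have Z_le: "measure (noise n) (?Z i) \<le> 2 * exp (- \<tau>\<^sup>2 / 2)" if "i \<in> {..<n}" for i
  proof -
    have [measurable]: "{y::complex. \<tau> < cmod y} \<in> sets borel" by measurable
    have "emeasure (noise n) (?Z i) = (\<integral>\<^sup>+z. indicator {y. \<tau> < cmod y} (z i) \<partial>noise n)"
      using Z[OF that] by (simp flip: nn_integral_indicator) (auto intro!: nn_integral_cong simp: indicator_def)
    also have "\<dots> = emeasure complex_gaussian {y. \<tau> < cmod y}"
      using that by (subst nn_integral_noise_component[where f = "indicator {y. \<tau> < cmod y}"]) auto
    finally have "measure (noise n) (?Z i) = measure complex_gaussian {y. \<tau> < cmod y}"
      by (simp add: measure_def)
    then show ?thesis using complex_gaussian_tail[OF assms] by simp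
  qed
  show "{z \<in> space (noise n). \<exists>i<n. \<tau> < cmod (z i)} \<in> sets (noise n)"
    unfolding eq using Z by (intro sets.finite_UN) auto
  have "measure (noise n) (\<Union>i\<in>{..<n}. ?Z i) \<le> (\<Sum>i<n. measure (noise n) (?Z i))"
    using Z by (intro noise.finite_measure_subadditive_finite) auto
  also have "\<dots> \<le> (\<Sum>i<n. 2 * exp (- \<tau>\<^sup>2 / 2))" by (intro sum_mono Z_le)
  finally show "measure (noise n) {z \<in> space (noise n). \<exists>i<n. \<tau> < cmod (z i)} \<le> 2 * real n * exp (- \<tau>\<^sup>2 / 2)"
    unfolding eq by (simp add: mult_ac)
qed

lemma clash_measurable:
  assumes [measurable]: "k \<in> borel \<rightarrow>\<^sub>M count_space UNIV"
    and bad [measurable]: "bad \<in> sets (borel \<Otimes>\<^sub>M (borel \<Otimes>\<^sub>M borel))"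
  shows "{h. h \<notin> bad \<and> (k (fst h) < N \<and> relay_clash a \<rho> \<tau> k (fst h) s s' \<or> dest_clash b c \<rho> \<tau> k N h s s')}
    \<in> sets fading"
proof -
  have 1: "Measurable.pred fading (\<lambda>h. relay_clash a \<rho> \<tau> k (fst h) s s')"
    unfolding relay_clash_def by measurable
  have 2: "Measurable.pred fading (\<lambda>h. dest_clash b c \<rho> \<tau> k N h s s')"
    unfolding dest_clash_def dest_gain_def by measurable
  have 3: "Measurable.pred fading (\<lambda>h. h \<notin> bad)" by measurable
  have 4: "Measurable.pred fading (\<lambda>h. k (fst h) < N)" by measurable
  have "Measurable.pred fading (\<lambda>h. h \<notin> bad \<and> (k (fst h) < N \<and> relay_clash a \<rho> \<tau> k (fst h) s s'
      \<or> dest_clash b c \<rho> \<tau> k N h s s'))"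
    by (intro pred_intros_logic(3)[OF 3] pred_intros_logic(5)[OF _ 2] pred_intros_logic(3)[OF 4 1])
  then show ?thesis by (simp add: pred_def)
qed

text \<open>A union bound over the ways in which \<open>repetition_code_correct\<close> can fail: a
  bad channel, large noise at either receiver with \<open>2 * N * exp (- \<tau>\<^sup>2 / 2)\<close>
  each, and a clash with another message.\<close>

lemma repetition_code_error_le:
  fixes a b c \<rho> \<tau> :: real and f :: "nat \<Rightarrow> nat \<Rightarrow> complex"
  assumes k: "k \<in> borel \<rightarrow>\<^sub>M count_space UNIV" and kN: "\<And>h. k h \<le> N"
    and bad: "bad \<in> sets (borel \<Otimes>\<^sub>M (borel \<Otimes>\<^sub>M borel))" and \<tau>: "0 \<le> \<tau>" and m: "m < M"
  defines "C \<equiv> repetition_code a b c \<rho> \<tau> k bad N M f"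
    and "T \<equiv> \<lambda>m'. {h. h \<notin> bad \<and> (k (fst h) < N \<and> relay_clash a \<rho> \<tau> k (fst h) (f m) (f m')
        \<or> dest_clash b c \<rho> \<tau> k N h (f m) (f m'))}"
  shows "measure (channel_randomness C) (error_event a b c \<rho> C m)
     \<le> measure fading bad + 4 * real N * exp (- \<tau>\<^sup>2 / 2) + (\<Sum>m'\<in>{..<M} - {m}. measure fading (T m'))"
proof -
  let ?R = "relay_randomness" and ?N = "noise N"
  let ?X = "?R \<Otimes>\<^sub>M (?N \<Otimes>\<^sub>M ?N)"
  have CR: "channel_randomness C = fading \<Otimes>\<^sub>M ?X" by (simp add: channel_randomness_def C_def)
  interpret CR: prob_space "channel_randomness C" by (rule prob_space_channel_randomness)
  have NN: "prob_space (?N \<Otimes>\<^sub>M ?N)" by (intro prob_space_pair noise.prob_space_axioms)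
  have X: "prob_space ?X" by (intro prob_space_pair NN rr.prob_space_axioms)
  define Z where "Z = {z \<in> space ?N. \<exists>i<N. \<tau> < cmod (z i)}"
  note Z = noise_exceeds[OF \<tau>, of N, folded Z_def]
  have T: "T m' \<in> sets fading" for m' unfolding T_def by (rule clash_measurable[OF k bad])
  have bad': "bad \<in> sets fading" using bad by (simp add: sets_fading)
  have sub: "error_event a b c \<rho> C m
     \<subseteq> (bad \<times> space ?X) \<union> (space fading \<times> (space ?R \<times> (Z \<times> space ?N)))
        \<union> (space fading \<times> (space ?R \<times> (space ?N \<times> Z))) \<union> (\<Union>m'\<in>{..<M} - {m}. T m' \<times> space ?X)"
    (is "?E \<subseteq> ?B1 \<union> ?B2 \<union> ?B3 \<union> ?B4")
  proof (rule subsetI, rule ccontr)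
    fix x assume x: "x \<in> ?E" "x \<notin> ?B1 \<union> ?B2 \<union> ?B3 \<union> ?B4"
    obtain h1 h2 h3 u z z' where x_eq: "x = ((h1, h2, h3), u, z, z')" by (metis prod.exhaust)
    have sp: "(u, z, z') \<in> space ?X" "z \<in> space ?N" "z' \<in> space ?N"
      using x(1) by (auto simp: error_event_def x_eq CR space_pair_measure)
    have "z \<notin> Z" "z' \<notin> Z" "(h1, h2, h3) \<notin> bad"
      using x(2) sp by (simp_all add: x_eq)
    moreover have nT: "(h1, h2, h3) \<notin> T m'" if "m' < M" "m' \<noteq> m" for m'
      using x(2) sp that by (auto simp: x_eq)
    moreover have "cmod (z i) \<le> \<tau>" "cmod (z' i) \<le> \<tau>" if "i < N" for i
      using \<open>z \<notin> Z\<close> \<open>z' \<notin> Z\<close> sp that by (auto simp: Z_def not_less[symmetric])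
    ultimately have "decoder C (h1, h2, h3) (dest_output a b c \<rho> C m (h1, h2, h3) u z z') = m"
      unfolding C_def by (intro repetition_code_correct m kN) (auto simp: T_def)
    then show False using x(1) by (simp add: error_event_def x_eq)
  qed
  have B: "?B1 \<in> CR.events" "?B2 \<in> CR.events" "?B3 \<in> CR.events" "?B4 \<in> CR.events"
    unfolding CR by (intro sets.finite_UN pair_measureI bad' T Z(1) sets.top finite_Diff finite_lessThan)+
  have "CR.prob ?E \<le> CR.prob (?B1 \<union> ?B2 \<union> ?B3 \<union> ?B4)"
    using B by (intro CR.finite_measure_mono sub sets.Un)
  also have "\<dots> \<le> CR.prob ?B1 + CR.prob ?B2 + CR.prob ?B3 + CR.prob ?B4"
    using B by (intro order_trans[OF measure_Un_le] add_mono order_refl sets.Un)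
  also have "CR.prob ?B1 = measure fading bad"
    unfolding CR using prob_space.prob_space[OF X] by (simp only: measure_Times[OF X bad' sets.top] mult_1_right)
  also have "CR.prob ?B2 = measure ?N Z"
  proof -
    have s1: "Z \<times> space ?N \<in> sets (?N \<Otimes>\<^sub>M ?N)" by (intro pair_measureI Z(1) sets.top)
    have s2: "space ?R \<times> (Z \<times> space ?N) \<in> sets ?X" by (intro pair_measureI s1 sets.top)
    show ?thesis
      unfolding CR by (simp only: measure_Times[OF X sets.top s2] measure_Times[OF NN sets.top s1]
          measure_Times[OF noise.prob_space_axioms Z(1) sets.top] noise.prob_space rr.prob_space fad.prob_space mult_1 mult_1_right)
  qed
  also have "CR.prob ?B3 = measure ?N Z"
  proof -
    have s1: "space ?N \<times> Z \<in> sets (?N \<Otimes>\<^sub>M ?N)" by (intro pair_measureI Z(1) sets.top)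
    have s2: "space ?R \<times> (space ?N \<times> Z) \<in> sets ?X" by (intro pair_measureI s1 sets.top)
    show ?thesis
      unfolding CR by (simp only: measure_Times[OF X sets.top s2] measure_Times[OF NN sets.top s1]
          measure_Times[OF noise.prob_space_axioms sets.top Z(1)] noise.prob_space rr.prob_space fad.prob_space mult_1 mult_1_right)
  qed
  finally have le: "CR.prob ?E \<le> measure fading bad + measure ?N Z + measure ?N Z + CR.prob ?B4" .
  have "CR.prob ?B4 \<le> (\<Sum>m'\<in>{..<M} - {m}. CR.prob (T m' \<times> space ?X))"
  proof (rule CR.finite_measure_subadditive_finite)
    show "(\<lambda>m'. T m' \<times> space ?X) ` ({..<M} - {m}) \<subseteq> CR.events"
      unfolding CR by (intro image_subsetI pair_measureI T sets.top)
  qed simp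
  also have "\<dots> = (\<Sum>m'\<in>{..<M} - {m}. measure fading (T m'))"
    unfolding CR using prob_space.prob_space[OF X] by (simp only: measure_Times[OF X T sets.top] mult_1_right)
  finally have "CR.prob ?B4 \<le> (\<Sum>m'\<in>{..<M} - {m}. measure fading (T m'))" .
  with le Z(2) show ?thesis by linarith
qed

text \<open>The sum over codebooks is moved inside the fading integral, where it becomes a count for
  one fixed channel. Channels in \<open>bad\<close> contribute nothing; for the others
  \<open>relay\<close> and \<open>dest\<close> are the union bounds over \<open>M\<close> competing
  messages.\<close>

lemma average_clash_le:
  fixes a b c \<rho> \<tau> G \<eta> :: real and N M Q :: nat
  assumes k: "k \<in> borel \<rightarrow>\<^sub>M count_space UNIV" and kN: "\<And>h. k h \<le> N"
    and bad: "bad \<in> sets (borel \<Otimes>\<^sub>M (borel \<Otimes>\<^sub>M borel))" and \<tau>: "0 < \<tau>" and G: "0 < G" "G \<le> \<tau> * real Q"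
    and \<eta>: "0 \<le> \<eta>" and m: "m < M" "m' < M" "m \<noteq> m'"
    and relay: "\<And>h. k h < N \<Longrightarrow> real M * clash_frac \<tau> G (cmod (h * of_real (\<rho> powr (a / 2)))) ^ k h \<le> \<eta>"
    and dest: "\<And>h. h \<notin> bad \<Longrightarrow> real M * (\<Prod>i<N. clash_frac \<tau> G (cmod (dest_gain b c \<rho> k h i))) \<le> \<eta>"
  defines "F \<equiv> PiE {..<M} (\<lambda>_. PiE {..<N} (\<lambda>_. grid Q))"
  shows "(\<Sum>f\<in>F. measure fading {h. h \<notin> bad \<and> (k (fst h) < N \<and> relay_clash a \<rho> \<tau> k (fst h) (f m) (f m')
        \<or> dest_clash b c \<rho> \<tau> k N h (f m) (f m'))}) \<le> 2 * \<eta> / real M * real (card F)"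
proof -
  let ?W = "PiE {..<N} (\<lambda>_. grid Q)"
  define T where "T f = {h. h \<notin> bad \<and> (k (fst h) < N \<and> relay_clash a \<rho> \<tau> k (fst h) (f m) (f m')
        \<or> dest_clash b c \<rho> \<tau> k N h (f m) (f m'))}" for f :: "nat \<Rightarrow> nat \<Rightarrow> complex"
  have M: "0 < M" using m by simp
  have W: "finite ?W" using finite_grid by (intro finite_PiE) auto
  have F: "finite F" unfolding F_def using W by (rule finite_PiE[OF finite_lessThan])
  have T: "T f \<in> sets fading" for f unfolding T_def by (rule clash_measurable[OF k bad])
  have pointwise: "(\<Sum>f\<in>F. indicator (T f) h) \<le> ennreal (2 * \<eta> / real M * real (card F))" for h
  proof -
    have "real (card {f \<in> F. h \<in> T f}) \<le> 2 * \<eta> / real M * real (card F)"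
    proof (cases "h \<in> bad")
      case True
      then have empty: "{f \<in> F. h \<in> T f} = {}" by (simp add: T_def)
      show ?thesis unfolding empty using \<eta> by simp
    next
      case False
      let ?R = "{f \<in> F. k (fst h) < N \<and> relay_clash a \<rho> \<tau> k (fst h) (f m) (f m')}"
      let ?D = "{f \<in> F. dest_clash b c \<rho> \<tau> k N h (f m) (f m')}"
      have R: "real (card ?R) \<le> \<eta> / real M * real (card F)"
      proof (cases "k (fst h) < N")
        case True
        let ?g = "cmod (fst h * of_real (\<rho> powr (a / 2)))"
        have "real (card {f \<in> F. relay_clash a \<rho> \<tau> k (fst h) (f m) (f m')})
            \<le> clash_frac \<tau> G ?g ^ k (fst h) * real (card F)"
          unfolding F_def
        proof (rule card_codebooks_pair[OF W])
          fix s assume s: "s \<in> ?W"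
          have "real (card {s' \<in> ?W. \<forall>j<k (fst h). ?g * cmod (s j - s' j) \<le> 2 * \<tau>})
              \<le> (\<Prod>j<k (fst h). clash_frac \<tau> G ?g) * real (card ?W)"
            by (rule card_clash_words[OF s G(2) G(1) _ \<tau> kN]) simp
          then show "real (card {s' \<in> ?W. relay_clash a \<rho> \<tau> k (fst h) s s'})
              \<le> clash_frac \<tau> G ?g ^ k (fst h) * real (card ?W)"
            by (simp add: relay_clash_def)
        qed (use m in auto)
        also have "\<dots> \<le> \<eta> / real M * real (card F)"
          using relay[OF True] M by (intro mult_right_mono) (auto simp: field_simps)
        finally show ?thesis using True by simp
      next
        case False
        then show ?thesis using \<eta> by simp
      qed
      have D: "real (card ?D) \<le> \<eta> / real M * real (card F)"
      proof -
        have "real (card ?D) \<le> (\<Prod>i<N. clash_frac \<tau> G (cmod (dest_gain b c \<rho> k h i))) * real (card F)"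
          unfolding F_def
        proof (rule card_codebooks_pair[OF W])
          fix s assume s: "s \<in> ?W"
          show "real (card {s' \<in> ?W. dest_clash b c \<rho> \<tau> k N h s s'})
              \<le> (\<Prod>i<N. clash_frac \<tau> G (cmod (dest_gain b c \<rho> k h i))) * real (card ?W)"
            unfolding dest_clash_def by (rule card_clash_words[OF s G(2) G(1) _ \<tau> order_refl]) simp
        qed (use m in auto)
        also have "\<dots> \<le> \<eta> / real M * real (card F)"
          using dest[OF False] M by (intro mult_right_mono) (auto simp: field_simps)
        finally show ?thesis .
      qed
      have "card {f \<in> F. h \<in> T f} \<le> card (?R \<union> ?D)"
        using F by (intro card_mono) (auto simp: T_def)
      also have "\<dots> \<le> card ?R + card ?D" by (rule card_Un_le)
      finally have "real (card {f \<in> F. h \<in> T f}) \<le> real (card ?R) + real (card ?D)"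
        by (simp flip: of_nat_add)
      moreover have "2 * \<eta> / real M * real (card F) = \<eta> / real M * real (card F) + \<eta> / real M * real (card F)"
        by simp
      ultimately show ?thesis using R D by linarith
    qed
    moreover have "(\<Sum>f\<in>F. indicator (T f) h :: ennreal) = of_nat (card {f \<in> F. h \<in> T f})"
    proof -
      have "(\<Sum>f\<in>F. indicator (T f) h :: ennreal) = (\<Sum>f\<in>F. if h \<in> T f then 1 else 0)"
        by (intro sum.cong) (auto simp: indicator_def)
      also have "\<dots> = of_nat (card {f \<in> F. h \<in> T f})"
        using F by (simp add: sum.If_cases Int_def)
      finally show ?thesis .
    qed
    ultimately show ?thesis by (simp add: ennreal_of_nat_eq_real_of_nat ennreal_leI)
  qed
  have "ennreal (\<Sum>f\<in>F. measure fading (T f)) = (\<Sum>f\<in>F. emeasure fading (T f))"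
    by (simp add: fad.emeasure_eq_measure sum_ennreal)
  also have "\<dots> = (\<integral>\<^sup>+h. (\<Sum>f\<in>F. indicator (T f) h) \<partial>fading)"
    using T by (subst nn_integral_sum) auto
  also have "\<dots> \<le> (\<integral>\<^sup>+h. ennreal (2 * \<eta> / real M * real (card F)) \<partial>fading)"
    by (intro nn_integral_mono pointwise)
  also have "\<dots> = ennreal (2 * \<eta> / real M * real (card F))"
    using fad.emeasure_space_1 by simp
  finally show ?thesis
    using \<eta> by (subst (asm) ennreal_le_iff) (auto simp: T_def)
qed

text \<open>Random coding: the average over all codebooks obeys the bound, hence some codebook does.
  Summing over at most \<open>M\<close> competitors cancels the factor 1 / M of the pairwise
  estimate.\<close>

lemma good_repetition_code:
  fixes a b c \<rho> \<tau> G \<eta> :: real and N M Q :: nat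
  assumes k: "k \<in> borel \<rightarrow>\<^sub>M count_space UNIV" and kN: "\<And>h. k h \<le> N"
    and bad: "bad \<in> sets (borel \<Otimes>\<^sub>M (borel \<Otimes>\<^sub>M borel))" and \<tau>: "0 < \<tau>" and G: "0 < G" "G \<le> \<tau> * real Q"
    and \<eta>: "0 \<le> \<eta>" and M: "0 < M"
    and relay: "\<And>h. k h < N \<Longrightarrow> real M * clash_frac \<tau> G (cmod (h * of_real (\<rho> powr (a / 2)))) ^ k h \<le> \<eta>"
    and dest: "\<And>h. h \<notin> bad \<Longrightarrow> real M * (\<Prod>i<N. clash_frac \<tau> G (cmod (dest_gain b c \<rho> k h i))) \<le> \<eta>"
  shows "\<exists>f. (\<forall>m<M. \<forall>i<N. cmod (f m i) \<le> 1) \<and>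
     error_prob a b c \<rho> (repetition_code a b c \<rho> \<tau> k bad N M f)
       \<le> measure fading bad + 4 * real N * exp (- \<tau>\<^sup>2 / 2) + 2 * \<eta>"
proof -
  let ?W = "PiE {..<N} (\<lambda>_. grid Q)"
  define F where "F = PiE {..<M} (\<lambda>_. ?W)"
  define e where "e = measure fading bad + 4 * real N * exp (- \<tau>\<^sup>2 / 2)"
  define T where "T f m m' = measure fading {h. h \<notin> bad \<and> (k (fst h) < N \<and> relay_clash a \<rho> \<tau> k (fst h) (f m) (f m')
        \<or> dest_clash b c \<rho> \<tau> k N h (f m) (f m'))}" for f :: "nat \<Rightarrow> nat \<Rightarrow> complex" and m m'
  define E where "E f = error_prob a b c \<rho> (repetition_code a b c \<rho> \<tau> k bad N M f)" for f
  have Q: "0 < Q" using G \<tau> by (cases Q) auto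
  have F: "finite F" "F \<noteq> {}"
  proof -
    show "finite F" unfolding F_def using finite_grid by (intro finite_PiE) auto
    have "grid Q \<noteq> {}" using card_grid[OF Q] Q by auto
    then show "F \<noteq> {}" unfolding F_def by (simp add: PiE_eq_empty_iff)
  qed
  have E_le: "E f \<le> e + (\<Sum>m<M. \<Sum>m'\<in>{..<M} - {m}. T f m m') / real M" for f
  proof -
    let ?C = "repetition_code a b c \<rho> \<tau> k bad N M f"
    have "E f = (\<Sum>m<M. measure (channel_randomness ?C) (error_event a b c \<rho> ?C m)) / real M"
      unfolding E_def error_prob_eq repetition_code_simps(2) ..
    also have "\<dots> \<le> (\<Sum>m<M. e + (\<Sum>m'\<in>{..<M} - {m}. T f m m')) / real M"
      unfolding e_def T_def
      by (intro divide_right_mono sum_mono repetition_code_error_le k kN bad) (use \<tau> in auto)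
    also have "\<dots> = e + (\<Sum>m<M. \<Sum>m'\<in>{..<M} - {m}. T f m m') / real M"
      using M by (simp add: sum.distrib add_divide_distrib)
    finally show ?thesis .
  qed
  have "(\<Sum>f\<in>F. \<Sum>m<M. \<Sum>m'\<in>{..<M} - {m}. T f m m') = (\<Sum>m<M. \<Sum>m'\<in>{..<M} - {m}. \<Sum>f\<in>F. T f m m')"
    by (subst sum.swap) (intro sum.cong refl sum.swap)
  also have "\<dots> \<le> (\<Sum>m<M. \<Sum>m'\<in>{..<M} - {m}. 2 * \<eta> / real M * real (card F))"
    unfolding T_def F_def
    by (intro sum_mono average_clash_le[where G = G]) (use assms in auto)
  also have "\<dots> \<le> (\<Sum>m<M. 2 * \<eta> * real (card F))"
  proof (rule sum_mono)
    fix m assume "m \<in> {..<M}"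
    have "(\<Sum>m'\<in>{..<M} - {m}. 2 * \<eta> / real M * real (card F)) \<le> (\<Sum>m'\<in>{..<M}. 2 * \<eta> / real M * real (card F))"
      using \<eta> by (intro sum_mono2) auto
    then show "(\<Sum>m'\<in>{..<M} - {m}. 2 * \<eta> / real M * real (card F)) \<le> 2 * \<eta> * real (card F)"
      using M by simp
  qed
  finally have T_sum: "(\<Sum>f\<in>F. \<Sum>m<M. \<Sum>m'\<in>{..<M} - {m}. T f m m') \<le> real M * (2 * \<eta> * real (card F))"
    by simp
  have "(\<Sum>f\<in>F. E f) \<le> (\<Sum>f\<in>F. e + (\<Sum>m<M. \<Sum>m'\<in>{..<M} - {m}. T f m m') / real M)"
    by (intro sum_mono E_le)
  also have "\<dots> = real (card F) * e + (\<Sum>f\<in>F. \<Sum>m<M. \<Sum>m'\<in>{..<M} - {m}. T f m m') / real M"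
    by (simp add: sum.distrib sum_divide_distrib)
  also have "\<dots> \<le> real (card F) * e + real M * (2 * \<eta> * real (card F)) / real M"
    using T_sum by (intro add_left_mono divide_right_mono) auto
  also have "\<dots> = (\<Sum>f\<in>F. e + 2 * \<eta>)" using M by (simp add: algebra_simps)
  finally have sum_le: "(\<Sum>f\<in>F. E f) \<le> (\<Sum>f\<in>F. e + 2 * \<eta>)" .
  have "\<exists>f\<in>F. E f \<le> e + 2 * \<eta>"
  proof (rule ccontr)
    assume "\<not> ?thesis"
    then have "(\<Sum>f\<in>F. e + 2 * \<eta>) < (\<Sum>f\<in>F. E f)"
      using F by (intro sum_strict_mono) auto
    with sum_le show False by simp
  qed
  then obtain f where f: "f \<in> F" "E f \<le> e + 2 * \<eta>" by blast
  have "cmod (f m i) \<le> 1" if "m < M" "i < N" for m i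
  proof -
    have "f m \<in> ?W" using f(1) that by (auto simp: F_def)
    then have "f m i \<in> grid Q" using that by auto
    then show ?thesis by (rule norm_grid_le)
  qed
  with f(2) show ?thesis by (auto simp: E_def e_def)
qed

text \<open>On a bad channel the decoder returns \<open>M\<close>, which is no message, so an error
  is certain.\<close>

lemma repetition_code_error_ge:
  assumes k: "k \<in> borel \<rightarrow>\<^sub>M count_space UNIV" and bad: "bad \<in> sets (borel \<Otimes>\<^sub>M (borel \<Otimes>\<^sub>M borel))"
    and M: "0 < M" and S: "S \<in> sets fading" "S \<subseteq> bad"
  shows "measure fading S \<le> error_prob a b c \<rho> (repetition_code a b c \<rho> \<tau> k bad N M f)"
proof -
  let ?C = "repetition_code a b c \<rho> \<tau> k bad N M f"
  let ?X = "relay_randomness \<Otimes>\<^sub>M (noise N \<Otimes>\<^sub>M noise N)"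
  have CR: "channel_randomness ?C = fading \<Otimes>\<^sub>M ?X" by (simp add: channel_randomness_def)
  interpret CR: prob_space "channel_randomness ?C" by (rule prob_space_channel_randomness)
  have X: "prob_space ?X" by (intro prob_space_pair noise.prob_space_axioms rr.prob_space_axioms)
  let ?E = "error_event a b c \<rho> ?C"
  have E: "?E m \<in> CR.events" for m
    using decoded_measurable[OF measurable_repetition_code[OF k bad], of a b c \<rho> \<tau> N M f a b c \<rho> m]
    unfolding error_event_def split_beta' by measurable
  have "measure fading S \<le> CR.prob (?E m)" if "m < M" for m
  proof -
    have "measure fading S = CR.prob (S \<times> space ?X)"
      unfolding CR using prob_space.prob_space[OF X] by (simp only: measure_Times[OF X S(1) sets.top] mult_1_right)
    also have "\<dots> \<le> CR.prob (?E m)"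
    proof (rule CR.finite_measure_mono[OF _ E])
      show "S \<times> space ?X \<subseteq> ?E m"
        using S(2) that by (auto simp: error_event_def CR space_pair_measure)
    qed
    finally show ?thesis .
  qed
  then have "(\<Sum>m<M. measure fading S) / real M \<le> (\<Sum>m<M. CR.prob (?E m)) / real M"
    by (intro divide_right_mono sum_mono) auto
  also have "\<dots> = error_prob a b c \<rho> ?C"
    unfolding error_prob_eq repetition_code_simps(2) ..
  finally show ?thesis using M by simp
qed

section \<open>Exponents of the random code\<close>

text \<open>The loss \<open>3 * \<epsilon>\<close> is one \<open>\<epsilon>\<close> for the constant
  81 = 9^2 and two for the square of the noise threshold \<open>\<rho> powr \<epsilon>\<close>. The
  cap \<open>\<rho> powr (p / 2)\<close> is harmless because
  \<open>q - \<alpha> \<le> p\<close>.\<close>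

lemma clash_frac_powr:
  fixes \<rho> \<epsilon> \<alpha> p q y :: real
  assumes \<rho>: "1 < \<rho>" "81 \<le> \<rho> powr \<epsilon>" and y: "0 \<le> y" "\<rho> powr (-\<alpha>) \<le> y\<^sup>2" and \<alpha>: "0 \<le> \<alpha>" "q \<le> p"
  shows "clash_frac (\<rho> powr \<epsilon>) (\<rho> powr (p / 2)) (y * \<rho> powr (q / 2)) \<le> \<rho> powr (- (q - \<alpha> - 3 * \<epsilon>))"
proof -
  define x where "x = \<rho> powr ((q - \<alpha>) / 2)"
  have sq: "(\<rho> powr (t / 2))\<^sup>2 = \<rho> powr t" for t
    using \<rho> by (simp add: power2_eq_square flip: powr_add)
  have "(\<rho> powr (-\<alpha> / 2))\<^sup>2 \<le> y\<^sup>2" using y(2) sq[of "-\<alpha>"] by simp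
  then have "\<rho> powr (-\<alpha> / 2) \<le> y" using y(1) by (rule power2_le_imp_le)
  then have "\<rho> powr (-\<alpha> / 2) * \<rho> powr (q / 2) \<le> y * \<rho> powr (q / 2)" by (intro mult_right_mono) auto
  moreover have "x = \<rho> powr (-\<alpha> / 2) * \<rho> powr (q / 2)"
    by (simp add: x_def diff_divide_distrib add.commute flip: powr_add)
  moreover have "x \<le> \<rho> powr (p / 2)" unfolding x_def using \<rho> \<alpha> by (intro powr_mono) auto
  ultimately have "clash_frac (\<rho> powr \<epsilon>) (\<rho> powr (p / 2)) (y * \<rho> powr (q / 2)) \<le> 81 * (\<rho> powr \<epsilon>)\<^sup>2 / x\<^sup>2"
    using \<rho> by (intro clash_frac_le) (auto simp: x_def)
  also have "\<dots> \<le> \<rho> powr \<epsilon> * (\<rho> powr \<epsilon>)\<^sup>2 / x\<^sup>2"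
    using \<rho> by (intro divide_right_mono mult_right_mono) auto
  also have "\<dots> = \<rho> powr \<epsilon> * \<rho> powr (2 * \<epsilon>) / \<rho> powr (q - \<alpha>)"
    using sq[of "2 * \<epsilon>"] sq[of "q - \<alpha>"] by (simp add: x_def)
  also have "\<dots> = \<rho> powr (- (q - \<alpha> - 3 * \<epsilon>))"
    by (simp add: powr_add[symmetric] powr_diff[symmetric])
  finally show ?thesis .
qed

text \<open>\<open>dmt_outage_slack\<close> provides a slack of \<open>2 * \<zeta>\<close> per
  symbol. One \<open>\<zeta>\<close> pays for the losses in \<epsilon>, which grow with the
  blocklength. The other, accumulated over \<open>N\<close> symbols, pays for the fixed costs: the
  target exponent \<open>d\<close> and the rounding of the listening time to an integer.\<close>

lemma exponent_budget:
  fixes p c r d D \<epsilon> \<zeta> \<alpha> \<beta> \<gamma> N k :: real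
  assumes pcr: "0 \<le> c" "c < r" "r < p / 2" and d: "0 \<le> d" and D: "0 \<le> D" "D < p - r"
    and \<zeta>: "2 * p * \<zeta> = (p - r) * (dmt p c r - D)" "0 < \<zeta>"
    and \<epsilon>: "0 \<le> \<epsilon>" "3 * \<epsilon> \<le> p - D - r" "\<epsilon> * (3 + 6 * p / r) \<le> \<zeta>"
    and abc: "0 \<le> \<alpha>" "0 \<le> \<beta>" "0 \<le> \<gamma>" "\<alpha> + \<beta> + \<gamma> \<le> D"
    and N: "d + (d / r + 1) * (2 * p) \<le> N * \<zeta>"
    and k: "k \<le> (r * N + d) / (p - \<alpha> - 3 * \<epsilon>) + 1"
  shows "r * N + d \<le> (c - \<gamma> - 3 * \<epsilon>) * k + (p - \<beta> - 3 * \<epsilon>) * (N - k)"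
proof -
  define A where "A = p - \<alpha> - 3 * \<epsilon>"
  define A0 where "A0 = p - \<alpha>"
  \<comment> \<open>The exponent lost by listening instead of talking for one symbol; the losses in
    \<epsilon> cancel in this difference.\<close>
  define U where "U = p - \<beta> - c + \<gamma>"
  have r: "0 < r" "r < p" using pcr by auto
  have A: "r \<le> A" "A \<le> A0" "A0 \<le> p" using \<epsilon> abc by (auto simp: A_def A0_def)
  have U: "0 \<le> U" "U \<le> 2 * p" using abc D pcr by (auto simp: U_def)
  have "2 * p * \<zeta> \<le> (p - \<alpha> - r) * (p - \<beta> - r) - r * (r - c + \<gamma>)"
    unfolding \<zeta>(1) using abc pcr by (intro dmt_outage_slack) auto
  also have "\<dots> = A0 * (p - \<beta>) - r * U - r * A0" by (simp add: A0_def U_def algebra_simps)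
  also have "\<dots> = A0 * (p - \<beta> - r * U / A0 - r)" using A r by (simp add: algebra_simps)
  finally have "A0 * (2 * \<zeta>) \<le> A0 * (p - \<beta> - r * U / A0 - r)"
    using mult_right_mono[OF A(3), of "2 * \<zeta>"] \<zeta>(2) by linarith
  then have 1: "2 * \<zeta> \<le> p - \<beta> - r * U / A0 - r" using A r by (subst (asm) mult_le_cancel_left_pos) auto
  \<comment> \<open>The relay's own loss \<open>3 * \<epsilon>\<close> lengthens the listening
    fraction from \<open>r / A0\<close> to \<open>r / A\<close>.\<close>
  have "r / A - r / A0 = (3 * \<epsilon> / A0) * (r / A)" using A r by (simp add: A_def A0_def field_simps)
  also have "\<dots> \<le> (3 * \<epsilon> / r) * 1" using A r \<epsilon> by (intro mult_mono divide_left_mono) auto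
  finally have "(r / A - r / A0) * U \<le> 3 * \<epsilon> / r * (2 * p)" using U r \<epsilon> by (intro mult_mono) auto
  moreover have "3 * \<epsilon> / r * (2 * p) = \<epsilon> * (6 * p / r)" "(r / A - r / A0) * U = r * U / A - r * U / A0"
    by (simp_all add: left_diff_distrib)
  ultimately have 2: "r * U / A \<le> r * U / A0 + \<epsilon> * (6 * p / r)" by linarith
  have 3: "\<zeta> \<le> (p - \<beta> - 3 * \<epsilon>) - r * U / A - r"
    using 1 2 \<epsilon>(3) by (simp add: distrib_left)
  have "d / A \<le> d / r" using A r d by (intro divide_left_mono) auto
  then have "(d / A + 1) * U \<le> (d / r + 1) * (2 * p)" using U A r d by (intro mult_mono) auto
  then have "d + (d / A + 1) * U \<le> N * \<zeta>" using N by linarith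
  also have "\<dots> \<le> N * ((p - \<beta> - 3 * \<epsilon>) - r * U / A - r)"
  proof (intro mult_left_mono 3)
    have "0 \<le> N * \<zeta>" using N d r by (intro order_trans[OF _ N] add_nonneg_nonneg mult_nonneg_nonneg) auto
    then show "0 \<le> N" using \<zeta>(2) by (simp add: zero_le_mult_iff)
  qed
  finally have "r * N + d \<le> (p - \<beta> - 3 * \<epsilon>) * N - ((r * N + d) / A + 1) * U"
    by (simp add: algebra_simps add_divide_distrib)
  also have "\<dots> \<le> (p - \<beta> - 3 * \<epsilon>) * N - k * U"
    using k U unfolding A_def[symmetric] by (intro diff_left_mono mult_right_mono) auto
  also have "\<dots> = (c - \<gamma> - 3 * \<epsilon>) * k + (p - \<beta> - 3 * \<epsilon>) * (N - k)"
    by (simp add: U_def algebra_simps)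
  finally show ?thesis .
qed

section \<open>The optimal tradeoff\<close>

lemma direct_fading_small:
  assumes "0 \<le> x"
  shows "{(h1, h2, h3). (cmod h3)\<^sup>2 \<le> x} \<in> sets fading"
    and "measure fading {(h1, h2, h3). (cmod h3)\<^sup>2 \<le> x} \<le> x"
    and "x \<le> 1 \<Longrightarrow> x * exp (-1) \<le> measure fading {(h1, h2, h3). (cmod h3)\<^sup>2 \<le> x}"
proof -
  let ?G = "complex_gaussian"
  let ?S = "{h::complex. (cmod h)\<^sup>2 \<le> x}"
  have S: "?S \<in> sets ?G" by simp
  have GG: "prob_space (?G \<Otimes>\<^sub>M ?G)" by (intro prob_space_pair cg.prob_space_axioms)
  have s: "space ?G \<times> ?S \<in> sets (?G \<Otimes>\<^sub>M ?G)" by (intro pair_measureI S sets.top)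
  have eq: "{(h1, h2, h3). (cmod h3)\<^sup>2 \<le> x} = space ?G \<times> (space ?G \<times> ?S)" by auto
  show "{(h1, h2, h3). (cmod h3)\<^sup>2 \<le> x} \<in> sets fading"
    unfolding eq fading_def by (intro pair_measureI s sets.top)
  have m: "measure fading {(h1, h2, h3). (cmod h3)\<^sup>2 \<le> x} = measure ?G ?S"
    unfolding eq fading_def
    by (simp only: measure_Times[OF GG sets.top s] measure_Times[OF cg.prob_space_axioms sets.top S] cg.prob_space mult_1)
  show "measure fading {(h1, h2, h3). (cmod h3)\<^sup>2 \<le> x} \<le> x"
    unfolding m using complex_gaussian_small_ball[OF assms, of 0] by simp
  assume "x \<le> 1"
  have "x * exp (-1) \<le> measure ?G {h. h \<noteq> 0 \<and> (cmod h)\<^sup>2 \<le> x}"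
    using complex_gaussian_small_ball_ge[OF assms \<open>x \<le> 1\<close>] by (simp add: punctured_ball_def)
  also have "\<dots> \<le> measure ?G ?S" using S by (intro cg.finite_measure_mono) auto
  finally show "x * exp (-1) \<le> measure fading {(h1, h2, h3). (cmod h3)\<^sup>2 \<le> x}" unfolding m .
qed

text \<open>
  A direct link weaker than \<open>\<rho> powr (-d)\<close> is declared an error, which pins the exponent of the
  error probability to exactly \<open>d\<close>.
\<close>

lemma code_at_snr:
  fixes p c r d D \<epsilon> \<zeta> \<rho> :: real and N M n :: nat
  assumes pcr: "0 \<le> c" "c < r" "r < p / 2" and d: "0 \<le> d" and D: "0 \<le> D" "D < p - r"
    and \<zeta>: "2 * p * \<zeta> = (p - r) * (dmt p c r - D)" "0 < \<zeta>"
    and \<epsilon>: "0 \<le> \<epsilon>" "3 * \<epsilon> \<le> p - D - r" "\<epsilon> * (3 + 6 * p / r) \<le> \<zeta>"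
    and N: "d + (d / r + 1) * (2 * p) \<le> real N * \<zeta>" "0 < N"
    and n: "0 < n" "d \<le> D - 3 * D / real n"
    and \<rho>: "1 < \<rho>" "81 \<le> \<rho> powr \<epsilon>" and M: "0 < M" "real M \<le> \<rho> powr (r * real N)"
  shows "\<exists>C. admissible_code p \<rho> C \<and> num_messages C = M \<and> blocklength C = N \<and>
    exp (-1) * \<rho> powr (-d) \<le> error_prob p p c \<rho> C \<and>
    error_prob p p c \<rho> C \<le> (real ((n + 1) ^ 3) + 3) * \<rho> powr (-d) + 4 * real N * exp (- (\<rho> powr \<epsilon>)\<^sup>2 / 2)"
proof -
  define \<tau> where "\<tau> = \<rho> powr \<epsilon>"
  define G where "G = \<rho> powr (p / 2)"
  define \<eta> where "\<eta> = \<rho> powr (-d)"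
  define Q where "Q = nat \<lceil>G / \<tau>\<rceil>"
  \<comment> \<open>With this \<open>w\<close> the gain in talking slots is
    \<open>h2 + w * h3\<close> times \<open>\<rho> powr (p / 2)\<close>, so the cover can be applied
    to the combined gain.\<close>
  define w where "w = complex_of_real (\<rho> powr ((c - p) / 2))"
  \<comment> \<open>The relay listens until its own union bound is at most \<open>\<eta>\<close>.
    The requirement on the relay in \<open>good_repetition_code\<close> then holds by construction,
    and what remains is that this time is short on most channels.\<close>
  define k where "k h = (LEAST j. j = N \<or> real M * clash_frac \<tau> G (cmod (h * of_real (\<rho> powr (p / 2)))) ^ j \<le> \<eta>)" for h
  define S where "S = {(h1 :: complex, h2 :: complex, h3). (cmod h3)\<^sup>2 \<le> \<eta>}"
  define gains where "gains h = real M * (\<Prod>i<N. clash_frac \<tau> G (cmod (dest_gain p c \<rho> k h i)))" for h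
  \<comment> \<open>Likewise the destination's union bound holds outside \<open>bad\<close> by
    construction; the work lies in showing that \<open>bad\<close> is rare.\<close>
  define bad where "bad = S \<union> {h. \<eta> < gains h}"
  have r: "0 < r" "r < p" using pcr by auto
  have \<tau>: "0 < \<tau>" and G: "0 < G" and \<eta>: "0 \<le> \<eta>" "\<eta> \<le> 1"
    using \<rho> d powr_mono[of "-d" 0 \<rho>] by (auto simp: \<tau>_def G_def \<eta>_def)
  have GQ: "G \<le> \<tau> * real Q"
  proof -
    have "G / \<tau> \<le> real Q" unfolding Q_def by (rule real_nat_ceiling_ge)
    then show ?thesis using \<tau> by (simp add: field_simps)
  qed
  have k_meas [measurable]: "k \<in> borel \<rightarrow>\<^sub>M count_space UNIV"
    unfolding k_def by measurable
  have kN: "k h \<le> N" for h unfolding k_def by (rule Least_le) simp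
  have k_relay: "real M * clash_frac \<tau> G (cmod (h * of_real (\<rho> powr (p / 2)))) ^ k h \<le> \<eta>" if "k h < N" for h
    using LeastI[of "\<lambda>j. j = N \<or> real M * clash_frac \<tau> G (cmod (h * of_real (\<rho> powr (p / 2)))) ^ j \<le> \<eta>" N] that
    unfolding k_def by auto
  have S: "S \<in> sets fading" "measure fading S \<le> \<eta>" "\<eta> * exp (-1) \<le> measure fading S"
    unfolding S_def using direct_fading_small[OF \<eta>(1)] \<eta>(2) by auto
  have bad: "bad \<in> sets (borel \<Otimes>\<^sub>M (borel \<Otimes>\<^sub>M borel))"
  proof -
    have g [measurable]: "gains \<in> borel_measurable (borel \<Otimes>\<^sub>M (borel \<Otimes>\<^sub>M borel))"
      unfolding gains_def
      by (intro borel_measurable_times borel_measurable_const borel_measurable_prod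
          measurable_compose[OF _ clash_frac_measurable] measurable_compose[OF _ borel_measurable_norm] dest_gain_measurable k_meas) auto
    have "{h \<in> space (borel \<Otimes>\<^sub>M (borel \<Otimes>\<^sub>M borel)). \<eta> < gains h} \<in> sets (borel \<Otimes>\<^sub>M (borel \<Otimes>\<^sub>M borel))"
      by measurable
    then show ?thesis
      unfolding bad_def using S(1) by (simp add: space_pair_measure sets_fading)
  qed
  obtain B where B: "B \<in> sets fading" "measure fading B \<le> real ((n + 1) ^ 3) * \<rho> powr (- (D - 3 * D / real n))"
    "\<And>h1 h2 h3. (h1, h2, h3) \<notin> B \<Longrightarrow> \<exists>\<alpha> \<beta> \<gamma>. 0 \<le> \<alpha> \<and> 0 \<le> \<beta> \<and> 0 \<le> \<gamma> \<and> \<alpha> + \<beta> + \<gamma> \<le> D \<and>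
        \<rho> powr (-\<alpha>) \<le> (cmod h1)\<^sup>2 \<and> \<rho> powr (-\<beta>) \<le> (cmod (h2 + w * h3))\<^sup>2 \<and> \<rho> powr (-\<gamma>) \<le> (cmod h3)\<^sup>2"
    using fading_exponents_cover[OF \<rho>(1) D(1) n(1), of w] by blast
  have "gains h \<le> \<eta>" if "h \<notin> B" for h
  proof -
    obtain h1 h2 h3 where h: "h = (h1, h2, h3)" by (cases h)
    from B(3) that obtain \<alpha> \<beta> \<gamma> where abc: "0 \<le> \<alpha>" "0 \<le> \<beta>" "0 \<le> \<gamma>" "\<alpha> + \<beta> + \<gamma> \<le> D"
      "\<rho> powr (-\<alpha>) \<le> (cmod h1)\<^sup>2" "\<rho> powr (-\<beta>) \<le> (cmod (h2 + w * h3))\<^sup>2" "\<rho> powr (-\<gamma>) \<le> (cmod h3)\<^sup>2"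
      unfolding h by blast
    define A where "A = p - \<alpha> - 3 * \<epsilon>"
    have A: "0 < A" using \<epsilon> abc r by (simp add: A_def)
    \<comment> \<open>A listening time at which the exponent \<open>A\<close> per symbol already
      pushes the relay's union bound below \<open>\<eta>\<close>; minimality gives
      \<open>k h1 \<le> j\<close>.\<close>
    define j where "j = nat \<lceil>(r * real N + d) / A\<rceil>"
    have j: "(r * real N + d) / A \<le> real j" "real j \<le> (r * real N + d) / A + 1"
    proof -
      have "0 \<le> (r * real N + d) / A" using A r d by (intro divide_nonneg_nonneg) auto
      then show "(r * real N + d) / A \<le> real j" "real j \<le> (r * real N + d) / A + 1"
        unfolding j_def by linarith+
    qed
    have relay: "clash_frac \<tau> G (cmod (h1 * of_real (\<rho> powr (p / 2)))) \<le> \<rho> powr (- A)"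
      using clash_frac_powr[OF \<rho> norm_ge_zero abc(5) abc(1), of p p] by (simp add: norm_mult \<tau>_def G_def A_def)
    have "real M * clash_frac \<tau> G (cmod (h1 * of_real (\<rho> powr (p / 2)))) ^ j \<le> \<rho> powr (r * real N) * (\<rho> powr (- A)) ^ j"
      using relay M clash_frac_bounds by (intro mult_mono power_mono) auto
    also have "\<dots> = \<rho> powr (r * real N - A * real j)"
      using \<rho> by (simp add: powr_realpow[symmetric] powr_powr powr_add[symmetric])
    also have "\<dots> \<le> \<eta>"
    proof -
      have "r * real N + d \<le> A * real j" using j(1) A by (simp add: field_simps)
      then show ?thesis unfolding \<eta>_def using \<rho> by (intro powr_mono) auto
    qed
    finally have "k h1 \<le> j" unfolding k_def by (intro Least_le) simp
    then have "real (k h1) \<le> (r * real N + d) / (p - \<alpha> - 3 * \<epsilon>) + 1" using j(2) by (simp add: A_def)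
    from exponent_budget[OF pcr d D \<zeta> \<epsilon> abc(1-4) N(1) this]
    have budget: "r * real N + d \<le> (c - \<gamma> - 3 * \<epsilon>) * real (k h1) + (p - \<beta> - 3 * \<epsilon>) * (real N - real (k h1))" .
    have gain: "clash_frac \<tau> G (cmod (dest_gain p c \<rho> k h i))
        \<le> (if i < k h1 then \<rho> powr (- (c - \<gamma> - 3 * \<epsilon>)) else \<rho> powr (- (p - \<beta> - 3 * \<epsilon>)))" for i
    proof (cases "i < k h1")
      case True
      have "clash_frac \<tau> G (cmod h3 * \<rho> powr (c / 2)) \<le> \<rho> powr (- (c - \<gamma> - 3 * \<epsilon>))"
        unfolding \<tau>_def G_def using clash_frac_powr[OF \<rho> norm_ge_zero abc(7) abc(3)] pcr r by simp
      then show ?thesis using True by (simp add: h dest_gain_def norm_mult)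
    next
      case False
      have "\<rho> powr (c / 2) = \<rho> powr (p / 2) * \<rho> powr ((c - p) / 2)"
        by (simp add: diff_divide_distrib flip: powr_add)
      then have "dest_gain p c \<rho> k h i = (h2 + w * h3) * of_real (\<rho> powr (p / 2))"
        using False by (simp add: h dest_gain_def w_def algebra_simps)
      moreover have "clash_frac \<tau> G (cmod (h2 + w * h3) * \<rho> powr (p / 2)) \<le> \<rho> powr (- (p - \<beta> - 3 * \<epsilon>))"
        unfolding \<tau>_def G_def using clash_frac_powr[OF \<rho> norm_ge_zero abc(6) abc(2)] by simp
      ultimately show ?thesis using False by (simp add: norm_mult)
    qed
    have "gains h \<le> \<rho> powr (r * real N) * (\<Prod>i<N. if i < k h1 then \<rho> powr (- (c - \<gamma> - 3 * \<epsilon>)) else \<rho> powr (- (p - \<beta> - 3 * \<epsilon>)))"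
      unfolding gains_def using M gain clash_frac_bounds by (intro mult_mono prod_mono) (auto intro: prod_nonneg)
    also have "(\<Prod>i<N. if i < k h1 then \<rho> powr (- (c - \<gamma> - 3 * \<epsilon>)) else \<rho> powr (- (p - \<beta> - 3 * \<epsilon>)))
        = (\<rho> powr (- (c - \<gamma> - 3 * \<epsilon>))) ^ k h1 * (\<rho> powr (- (p - \<beta> - 3 * \<epsilon>))) ^ (N - k h1)"
    proof -
      have "{..<N} \<inter> {i. i < k h1} = {..<k h1}" "{..<N} \<inter> - {i. i < k h1} = {k h1..<N}"
        using kN[of h1] by auto
      then show ?thesis by (simp add: prod.If_cases)
    qed
    also have "\<rho> powr (r * real N) * \<dots>
        = \<rho> powr (r * real N - ((c - \<gamma> - 3 * \<epsilon>) * real (k h1) + (p - \<beta> - 3 * \<epsilon>) * real (N - k h1)))"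
      using \<rho> by (simp add: powr_realpow[symmetric] powr_powr powr_add[symmetric] algebra_simps)
    also have "\<dots> \<le> \<eta>"
      unfolding \<eta>_def using budget \<rho> kN[of h1] by (intro powr_mono) (auto simp: of_nat_diff)
    finally show ?thesis .
  qed
  then have "bad \<subseteq> S \<union> B" by (auto simp: bad_def not_less[symmetric])
  then have "measure fading bad \<le> measure fading (S \<union> B)"
    using S B by (intro fad.finite_measure_mono) auto
  also have "\<dots> \<le> measure fading S + measure fading B" using S B by (intro measure_Un_le)
  also have "\<dots> \<le> \<eta> + real ((n + 1) ^ 3) * \<eta>"
  proof (intro add_mono S(2) order_trans[OF B(2)] mult_left_mono)
    show "\<rho> powr (- (D - 3 * D / real n)) \<le> \<eta>" unfolding \<eta>_def using n \<rho> by (intro powr_mono) auto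
  qed simp
  finally have bad_le: "measure fading bad \<le> \<eta> + real ((n + 1) ^ 3) * \<eta>" .
  obtain f where f: "\<And>m i. m < M \<Longrightarrow> i < N \<Longrightarrow> cmod (f m i) \<le> 1"
    "error_prob p p c \<rho> (repetition_code p p c \<rho> \<tau> k bad N M f)
       \<le> measure fading bad + 4 * real N * exp (- \<tau>\<^sup>2 / 2) + 2 * \<eta>"
  proof -
    have "\<exists>f. (\<forall>m<M. \<forall>i<N. cmod (f m i) \<le> 1) \<and>
     error_prob p p c \<rho> (repetition_code p p c \<rho> \<tau> k bad N M f)
       \<le> measure fading bad + 4 * real N * exp (- \<tau>\<^sup>2 / 2) + 2 * \<eta>"
    proof (rule good_repetition_code[OF k_meas kN bad \<tau> G GQ \<eta>(1) M(1) k_relay])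
      fix h assume "h \<notin> bad"
      then show "real M * (\<Prod>i<N. clash_frac \<tau> G (cmod (dest_gain p c \<rho> k h i))) \<le> \<eta>"
        by (simp add: bad_def gains_def)
    qed
    then show thesis using that by blast
  qed
  let ?C = "repetition_code p p c \<rho> \<tau> k bad N M f"
  have "admissible_code p \<rho> ?C" by (rule admissible_repetition_code[OF k_meas bad N(2) M(1) f(1)])
  moreover have "exp (-1) * \<rho> powr (-d) \<le> error_prob p p c \<rho> ?C"
  proof -
    have "exp (-1) * \<eta> \<le> measure fading S" using S(3) by (simp add: mult.commute)
    also have "\<dots> \<le> error_prob p p c \<rho> ?C"
      by (rule repetition_code_error_ge[OF k_meas bad M(1) S(1)]) (auto simp: bad_def)
    finally show ?thesis by (simp add: \<eta>_def)
  qed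
  moreover have "error_prob p p c \<rho> ?C \<le> (real ((n + 1) ^ 3) + 3) * \<rho> powr (-d) + 4 * real N * exp (- (\<rho> powr \<epsilon>)\<^sup>2 / 2)"
  proof -
    have "(real ((n + 1) ^ 3) + 3) * \<eta> = (\<eta> + real ((n + 1) ^ 3) * \<eta>) + 2 * \<eta>" by (simp only: ring_distribs)
    then show ?thesis using f(2) bad_le unfolding \<eta>_def \<tau>_def by linarith
  qed
  ultimately show ?thesis by (intro exI[of _ ?C]) simp
qed

lemma eventually_le_powr:
  fixes a k :: real
  assumes "0 < a"
  shows "eventually (\<lambda>\<rho>. k \<le> \<rho> powr a) at_top"
  using assms by real_asymp

text \<open>\<open>D\<close> is placed strictly between \<open>d\<close> and
  \<open>dmt p c r\<close>, which fixes the slack \<open>\<zeta>\<close>; the mesh \<open>n\<close>,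
  the noise margin \<open>\<epsilon>\<close> and a blocklength \<open>N\<close> independent of
  \<rho> are then chosen to fit into it. Since admissibility is demanded at every SNR, those below
  \<open>\<rho>0\<close> get a trivial code.\<close>

lemma achievable:
  assumes pcr: "0 \<le> c" "c < r" "r < p / 2" and d: "0 < d" "d < dmt p c r"
  shows "\<exists>\<C>. (\<forall>\<rho>>1. admissible_code p \<rho> (\<C> \<rho>)) \<and> achieves_multiplexing_gain \<C> r \<and>
    achieves_diversity_gain p p c \<C> (ereal d)"
proof -
  define D where "D = (d + dmt p c r) / 2"
  define \<zeta> where "\<zeta> = (p - r) * (dmt p c r - D) / (2 * p)"
  define n where "n = nat \<lceil>3 * D / (D - d)\<rceil> + 1"
  define \<epsilon> where "\<epsilon> = min ((p - D - r) / 3) (\<zeta> / (3 + 6 * p / r))"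
  define N where "N = nat \<lceil>(d + (d / r + 1) * (2 * p)) / \<zeta>\<rceil> + 1"
  have r: "0 < r" "r < p" using pcr by auto
  have D: "d < D" "D < dmt p c r" using d by (auto simp: D_def)
  have D': "0 \<le> D" "D < p - r" using D d dmt_bounds(2)[OF pcr] by auto
  have \<zeta>: "2 * p * \<zeta> = (p - r) * (dmt p c r - D)" "0 < \<zeta>" using r D by (auto simp: \<zeta>_def)
  have den: "0 < 3 + 6 * p / r" using r by (simp add: add_pos_pos)
  have \<epsilon>: "0 < \<epsilon>" "3 * \<epsilon> \<le> p - D - r" "\<epsilon> * (3 + 6 * p / r) \<le> \<zeta>"
  proof -
    show "0 < \<epsilon>" using D' den \<zeta> by (simp add: \<epsilon>_def)
    have "\<epsilon> \<le> (p - D - r) / 3" unfolding \<epsilon>_def by (rule min.cobounded1)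
    then show "3 * \<epsilon> \<le> p - D - r" by simp
    have "\<epsilon> \<le> \<zeta> / (3 + 6 * p / r)" unfolding \<epsilon>_def by (rule min.cobounded2)
    then show "\<epsilon> * (3 + 6 * p / r) \<le> \<zeta>" using den by (subst (asm) pos_le_divide_eq)
  qed
  have N: "d + (d / r + 1) * (2 * p) \<le> real N * \<zeta>" "0 < N"
  proof -
    have "(d + (d / r + 1) * (2 * p)) / \<zeta> \<le> real N" unfolding N_def by linarith
    then show "d + (d / r + 1) * (2 * p) \<le> real N * \<zeta>" using \<zeta>(2) by (subst (asm) pos_divide_le_eq)
  qed (simp add: N_def)
  have n: "0 < n" "d \<le> D - 3 * D / real n"
  proof -
    have "3 * D / (D - d) \<le> real n" unfolding n_def by linarith
    then have "3 * D \<le> real n * (D - d)" using D by (simp add: pos_divide_le_eq)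
    then have "3 * D / real n \<le> D - d" by (simp add: n_def pos_divide_le_eq mult.commute)
    then show "d \<le> D - 3 * D / real n" by simp
  qed (simp add: n_def)
  \<comment> \<open>Rounding down costs at most a factor 2 for large \<rho>, that is
    \<open>ln 2 / N\<close> in the rate.\<close>
  define M where "M \<rho> = nat \<lfloor>\<rho> powr (r * real N)\<rfloor>" for \<rho> :: real
  define K where "K = real ((n + 1) ^ 3) + 4"
  have rN: "0 < r * real N" using r N by simp
  have M_le: "real (M \<rho>) \<le> \<rho> powr (r * real N)" for \<rho> unfolding M_def by simp
  have M_ge: "\<rho> powr (r * real N) / 2 \<le> real (M \<rho>)" "0 < M \<rho>" if "2 \<le> \<rho> powr (r * real N)" for \<rho>
    using that unfolding M_def by linarith+
  have "eventually (\<lambda>\<rho>. 2 \<le> \<rho> powr (r * real N)) at_top"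
    using rN by (rule eventually_le_powr)
  moreover have "eventually (\<lambda>\<rho>. 81 \<le> \<rho> powr \<epsilon>) at_top"
    using \<epsilon>(1) by (rule eventually_le_powr)
  moreover have "eventually (\<lambda>\<rho>. 4 * real N * exp (- (\<rho> powr \<epsilon>)\<^sup>2 / 2) \<le> \<rho> powr (-d)) at_top"
    using \<epsilon>(1) d(1) N(2) by real_asymp
  ultimately have "eventually (\<lambda>\<rho>. 1 < \<rho> \<and> 2 \<le> \<rho> powr (r * real N) \<and> 81 \<le> \<rho> powr \<epsilon> \<and>
      4 * real N * exp (- (\<rho> powr \<epsilon>)\<^sup>2 / 2) \<le> \<rho> powr (-d)) at_top"
    using eventually_gt_at_top[of "1::real"] by eventually_elim auto
  then obtain \<rho>0 where \<rho>0: "\<And>\<rho>. \<rho>0 \<le> \<rho> \<Longrightarrow> 1 < \<rho> \<and> 2 \<le> \<rho> powr (r * real N) \<and> 81 \<le> \<rho> powr \<epsilon> \<and>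
      4 * real N * exp (- (\<rho> powr \<epsilon>)\<^sup>2 / 2) \<le> \<rho> powr (-d)"
    unfolding eventually_at_top_linorder by blast
  have good: "\<exists>C. admissible_code p \<rho> C \<and> (\<rho>0 \<le> \<rho> \<longrightarrow> num_messages C = M \<rho> \<and> blocklength C = N \<and>
    exp (-1) * \<rho> powr (-d) \<le> error_prob p p c \<rho> C \<and> error_prob p p c \<rho> C \<le> K * \<rho> powr (-d))" for \<rho>
  proof (cases "\<rho>0 \<le> \<rho>")
    case True
    from \<rho>0[OF True] have \<rho>: "1 < \<rho>" "2 \<le> \<rho> powr (r * real N)" "81 \<le> \<rho> powr \<epsilon>"
      "4 * real N * exp (- (\<rho> powr \<epsilon>)\<^sup>2 / 2) \<le> \<rho> powr (-d)" by auto
    have "K * \<rho> powr (-d) = (real ((n + 1) ^ 3) + 3) * \<rho> powr (-d) + \<rho> powr (-d)"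
      by (simp add: K_def distrib_right)
    with code_at_snr[OF pcr less_imp_le[OF d(1)] D' \<zeta> less_imp_le[OF \<epsilon>(1)] \<epsilon>(2,3) N n \<rho>(1,3) M_ge(2)[OF \<rho>(2)] M_le] \<rho>(4)
    show ?thesis by (metis add_left_mono order_trans)
  next
    case False
    have "admissible_code p \<rho> (repetition_code p p c \<rho> 0 (\<lambda>_. 0) {} 1 1 (\<lambda>_ _. 0))"
      by (rule admissible_repetition_code) auto
    with False show ?thesis by blast
  qed
  define \<C> where "\<C> \<rho> = (SOME C. admissible_code p \<rho> C \<and> (\<rho>0 \<le> \<rho> \<longrightarrow> num_messages C = M \<rho> \<and> blocklength C = N \<and>
    exp (-1) * \<rho> powr (-d) \<le> error_prob p p c \<rho> C \<and> error_prob p p c \<rho> C \<le> K * \<rho> powr (-d)))" for \<rho>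
  have \<C>: "admissible_code p \<rho> (\<C> \<rho>)" "\<rho>0 \<le> \<rho> \<Longrightarrow> num_messages (\<C> \<rho>) = M \<rho>" "\<rho>0 \<le> \<rho> \<Longrightarrow> blocklength (\<C> \<rho>) = N"
    "\<rho>0 \<le> \<rho> \<Longrightarrow> exp (-1) * \<rho> powr (-d) \<le> error_prob p p c \<rho> (\<C> \<rho>)"
    "\<rho>0 \<le> \<rho> \<Longrightarrow> error_prob p p c \<rho> (\<C> \<rho>) \<le> K * \<rho> powr (-d)" for \<rho>
    using someI_ex[OF good[of \<rho>]] unfolding \<C>_def[symmetric] by auto
  have "achieves_multiplexing_gain \<C> r"
    unfolding achieves_multiplexing_gain_def
  proof (rule tendsto_sandwich)
    have "((\<lambda>\<rho>. r - (ln 2 / real N) / ln \<rho>) \<longlongrightarrow> r - 0) at_top"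
      by (intro tendsto_intros tendsto_div_ln)
    then show "((\<lambda>\<rho>. r - (ln 2 / real N) / ln \<rho>) \<longlongrightarrow> r) at_top" by simp
    show "((\<lambda>\<rho>. r) \<longlongrightarrow> r) (at_top :: real filter)" by simp
    show "eventually (\<lambda>\<rho>. r - (ln 2 / real N) / ln \<rho> \<le> rate (\<C> \<rho>) / ln \<rho>) at_top"
      using eventually_ge_at_top[of \<rho>0]
    proof eventually_elim
      case (elim \<rho>)
      from \<rho>0[OF elim] have \<rho>: "1 < \<rho>" "2 \<le> \<rho> powr (r * real N)" by auto
      have "r * real N * ln \<rho> - ln 2 = ln (\<rho> powr (r * real N) / 2)"
        using \<rho> by (simp add: ln_div ln_powr)
      also have "\<dots> \<le> ln (real (M \<rho>))"
        using M_ge[OF \<rho>(2)] \<rho> by (intro iffD2[OF ln_le_cancel_iff]) auto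
      finally have "(r * real N * ln \<rho> - ln 2) / (real N * ln \<rho>) \<le> ln (real (M \<rho>)) / (real N * ln \<rho>)"
        using \<rho> by (intro divide_right_mono) auto
      then show ?case
        using \<rho> N(2) elim by (simp add: rate_def \<C> diff_divide_distrib)
    qed
    show "eventually (\<lambda>\<rho>. rate (\<C> \<rho>) / ln \<rho> \<le> r) at_top"
      using eventually_ge_at_top[of \<rho>0]
    proof eventually_elim
      case (elim \<rho>)
      from \<rho>0[OF elim] have \<rho>: "1 < \<rho>" "2 \<le> \<rho> powr (r * real N)" by auto
      have "ln (real (M \<rho>)) \<le> ln (\<rho> powr (r * real N))"
        using M_ge[OF \<rho>(2)] M_le[of \<rho>] \<rho> by (intro iffD2[OF ln_le_cancel_iff]) auto
      also have "\<dots> = r * real N * ln \<rho>" using \<rho> by (simp add: ln_powr)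
      finally have "ln (real (M \<rho>)) / (real N * ln \<rho>) \<le> r * real N * ln \<rho> / (real N * ln \<rho>)"
        using \<rho> by (intro divide_right_mono) auto
      then show ?case using \<rho> N(2) elim by (simp add: rate_def \<C>)
    qed
  qed
  moreover have "achieves_diversity_gain p p c \<C> (ereal d)"
    unfolding achieves_diversity_gain_def
  proof (rule snr_exponent_tendsto[of _ 1])
    show "0 \<le> error_prob p p c \<rho> (\<C> \<rho>)" for \<rho>
      unfolding error_prob_def by (intro divide_nonneg_nonneg sum_nonneg) auto
    fix e :: real assume e: "0 < e"
    have mono: "\<rho> powr (- (d + e)) \<le> \<rho> powr (-d)" "\<rho> powr (-d) \<le> \<rho> powr (- (d - e))" if "\<rho>0 \<le> \<rho>" for \<rho>
      using \<rho>0[OF that] e by (auto intro!: powr_mono)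
    have "eventually (\<lambda>\<rho>. exp (-1) * \<rho> powr (- (d + e)) \<le> error_prob p p c \<rho> (\<C> \<rho>)) at_top"
      using eventually_ge_at_top[of \<rho>0]
    proof eventually_elim
      case (elim \<rho>)
      have "exp (-1) * \<rho> powr (- (d + e)) \<le> exp (-1) * \<rho> powr (-d)" using mono[OF elim] by simp
      then show ?case using \<C>(4)[OF elim] by linarith
    qed
    then show "\<exists>\<kappa>>0. eventually (\<lambda>\<rho>. \<kappa> * \<rho> powr (- (d + e)) \<le> error_prob p p c \<rho> (\<C> \<rho>)) at_top"
      by (intro exI[of _ "exp (-1)"]) auto
    have K: "0 < K" by (simp add: K_def add_nonneg_pos)
    have "eventually (\<lambda>\<rho>. error_prob p p c \<rho> (\<C> \<rho>) \<le> K * \<rho> powr (- (d - e))) at_top"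
      using eventually_ge_at_top[of \<rho>0]
    proof eventually_elim
      case (elim \<rho>)
      have "K * \<rho> powr (-d) \<le> K * \<rho> powr (- (d - e))" using mono[OF elim] K by simp
      then show ?case using \<C>(5)[OF elim] by linarith
    qed
    then show "\<exists>K>0. eventually (\<lambda>\<rho>. error_prob p p c \<rho> (\<C> \<rho>) \<le> K * \<rho> powr (- (d - e))) at_top"
      using K by blast
  qed simp
  ultimately show ?thesis using \<C>(1) by blast
qed

text \<open>The limit inherits the bound of \<open>converse\<close> for every small
  \<open>\<epsilon>\<close>, and \<open>\<epsilon>\<close> then tends to 0.\<close>

lemma diversity_gain_le:
  assumes pcr: "0 \<le> c" "c < r" "r < p / 2"
    and adm: "\<And>\<rho>. 1 < \<rho> \<Longrightarrow> admissible_code p \<rho> (\<C> \<rho>)"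
    and mux: "achieves_multiplexing_gain \<C> r" and div: "achieves_diversity_gain p p c \<C> d"
  shows "d \<le> ereal (dmt p c r)"
proof -
  have "d \<le> ereal (dmt p c r + \<epsilon>)" if \<epsilon>: "0 < \<epsilon>" "\<epsilon> \<le> r - c" for \<epsilon>
  proof -
    obtain \<kappa> where \<kappa>: "\<kappa> > 0" "eventually (\<lambda>\<rho>. \<kappa> * \<rho> powr (- (dmt p c r + \<epsilon>)) \<le> error_prob p p c \<rho> (\<C> \<rho>)) at_top"
      using converse[OF pcr adm mux \<epsilon>] by blast
    have "((\<lambda>\<rho>. dmt p c r + \<epsilon> - ln \<kappa> / ln \<rho>) \<longlongrightarrow> dmt p c r + \<epsilon> - 0) at_top"
      by (intro tendsto_intros tendsto_div_ln)
    then have "((\<lambda>\<rho>. ereal (dmt p c r + \<epsilon> - ln \<kappa> / ln \<rho>)) \<longlongrightarrow> ereal (dmt p c r + \<epsilon>)) at_top" by simp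
    moreover have "eventually (\<lambda>\<rho>. snr_exponent (error_prob p p c \<rho> (\<C> \<rho>)) \<rho> \<le> ereal (dmt p c r + \<epsilon> - ln \<kappa> / ln \<rho>)) at_top"
      using \<kappa>(2) eventually_gt_at_top[of 1] by eventually_elim (intro snr_exponent_le \<kappa>(1))
    ultimately show ?thesis
      using div unfolding achieves_diversity_gain_def by (intro tendsto_le[of at_top]) auto
  qed
  note le = this
  show ?thesis
  proof (rule ereal_le_epsilon2)
    fix e :: real assume e: "0 < e"
    have "d \<le> ereal (dmt p c r + min e (r - c))" using e pcr by (intro le) auto
    also have "\<dots> \<le> ereal (dmt p c r) + ereal e" by simp
    finally show "d \<le> ereal (dmt p c r) + ereal e" .
  qed
qed

text \<open>Only values strictly below \<open>dmt p c r\<close> are shown to be attained, which is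
  enough for the supremum.\<close>

lemma optimal_dmt_eq:
  assumes pcr: "0 \<le> c" "c < r" "r < p / 2"
  shows "optimal_dmt p p c r = ereal (dmt p c r)"
  unfolding optimal_dmt_def
proof (rule antisym)
  let ?A = "{d. \<exists>\<C>. (\<forall>\<rho>>1. admissible_code p \<rho> (\<C> \<rho>)) \<and> achieves_multiplexing_gain \<C> r \<and> achieves_diversity_gain p p c \<C> d}"
  show "Sup ?A \<le> ereal (dmt p c r)"
    by (rule Sup_least) (auto intro: diversity_gain_le[OF pcr])
  show "ereal (dmt p c r) \<le> Sup ?A"
  proof (rule ereal_le_epsilon2)
    fix e :: real assume e: "0 < e"
    \<comment> \<open>The second argument keeps \<open>d\<close> positive when \<open>e\<close> is
      large, as \<open>achievable\<close> asks.\<close>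
    define d where "d = max (dmt p c r - e) (dmt p c r / 2)"
    have "0 < dmt p c r" using dmt_bounds(1)[OF pcr] pcr by linarith
    then have d: "0 < d" "d < dmt p c r" using e by (auto simp: d_def)
    have "ereal d \<in> ?A" using achievable[OF pcr d] by blast
    then have "ereal d \<le> Sup ?A" by (rule Sup_upper)
    moreover have "dmt p c r - e \<le> d" unfolding d_def by (rule max.cobounded1)
    then have "ereal (dmt p c r) \<le> ereal d + ereal e" by simp
    ultimately show "ereal (dmt p c r) \<le> Sup ?A + ereal e" by (meson add_right_mono order_trans)
  qed
qed

theorem lemma6:
  fixes p c r :: real
  assumes "0 \<le> c" and "c < r" and "r < p / 2"
  shows "ddf_diversity_gain p p c r (optimal_dmt p p c r)"
  unfolding ddf_diversity_gain_def optimal_dmt_eq[OF assms]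
proof (intro allI impI)
  fix R assume R: "((\<lambda>\<rho>. R \<rho> / ln \<rho>) \<longlongrightarrow> r) at_top"
  have dmt0: "c < dmt p c r" by (rule dmt_bounds(1)[OF assms])
  show "((\<lambda>\<rho>. snr_exponent (ddf_outage_prob p p c \<rho> (R \<rho>)) \<rho>) \<longlongrightarrow> ereal (dmt p c r)) at_top"
  \<comment> \<open>The cap \<open>r - c\<close> is what \<open>ddf_outage_prob_ge\<close> asks for;
    the cap \<open>dmt p c r\<close> keeps \<open>D\<close> below nonnegative.\<close>
  proof (rule snr_exponent_tendsto[of _ "min (r - c) (dmt p c r)"])
    show "0 \<le> ddf_outage_prob p p c \<rho> (R \<rho>)" for \<rho> by (simp add: ddf_outage_prob_def)
    show "0 < min (r - c) (dmt p c r)" using assms dmt0 by auto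
    fix \<epsilon> assume \<epsilon>: "0 < \<epsilon>" "\<epsilon> \<le> min (r - c) (dmt p c r)"
    have "eventually (\<lambda>\<rho>. exp (-3) * \<rho> powr (- (dmt p c r + \<epsilon>)) \<le> ddf_outage_prob p p c \<rho> (R \<rho>)) at_top"
      using \<epsilon> by (intro ddf_outage_prob_ge[OF assms _ _ R]) auto
    then show "\<exists>\<kappa>>0. eventually (\<lambda>\<rho>. \<kappa> * \<rho> powr (- (dmt p c r + \<epsilon>)) \<le> ddf_outage_prob p p c \<rho> (R \<rho>)) at_top"
      by (intro exI[of _ "exp (-3)"]) auto
    \<comment> \<open>One half of \<open>\<epsilon>\<close> goes into \<open>D\<close>, the other
      into the mesh error \<open>3 * D / n\<close>.\<close>
    define D where "D = dmt p c r - \<epsilon> / 2"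
    define n where "n = nat \<lceil>6 * D / \<epsilon>\<rceil> + 1"
    have D: "0 \<le> D" "D < dmt p c r" using \<epsilon> by (auto simp: D_def)
    have "6 * D / \<epsilon> \<le> real n" unfolding n_def by linarith
    then have "6 * D \<le> real n * \<epsilon>" using \<epsilon> by (simp add: pos_divide_le_eq)
    then have "3 * D / real n \<le> \<epsilon> / 2" by (simp add: n_def pos_divide_le_eq field_simps)
    then have "D - \<epsilon> / 2 \<le> D - 3 * D / real n" by simp
    moreover have "dmt p c r - \<epsilon> = D - \<epsilon> / 2" by (simp add: D_def)
    ultimately have n: "dmt p c r - \<epsilon> \<le> D - 3 * D / real n" by linarith
    have "eventually (\<lambda>\<rho>. ddf_outage_prob p p c \<rho> (R \<rho>) \<le> real ((n + 1) ^ 3) * \<rho> powr (- (D - 3 * D / real n))) at_top"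
      by (rule ddf_outage_prob_le[OF assms D R]) (simp add: n_def)
    with eventually_gt_at_top[of 1]
    have "eventually (\<lambda>\<rho>. ddf_outage_prob p p c \<rho> (R \<rho>) \<le> real ((n + 1) ^ 3) * \<rho> powr (- (dmt p c r - \<epsilon>))) at_top"
    proof eventually_elim
      case (elim \<rho>)
      have "real ((n + 1) ^ 3) * \<rho> powr (- (D - 3 * D / real n)) \<le> real ((n + 1) ^ 3) * \<rho> powr (- (dmt p c r - \<epsilon>))"
        using n elim by (intro mult_left_mono powr_mono) auto
      with elim show ?case by linarith
    qed
    then show "\<exists>K>0. eventually (\<lambda>\<rho>. ddf_outage_prob p p c \<rho> (R \<rho>) \<le> K * \<rho> powr (- (dmt p c r - \<epsilon>))) at_top"
      by (intro exI[of _ "real ((n + 1) ^ 3)"]) auto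
  qed
qed

end
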